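(* Let $d\in\mathbb{N}$, $d\ge2$, and let $\chi\ge24$ be the fixed numerical constant used in the definition of $\widehat m$. Let $x\in\mathbb{R}^d$, $L\in(0,\infty)$ and $\beta>d/2$. Then there exists a constant $C(L,\beta,d)>0$, depending only on $L$, $\beta$ and $d$ (and on the fixed numerical constant $\chi$), such that for all $n\in\mathbb{N}$, $n\ge2$, $$\sup_{f\in\mathcal{W}^\beta(L)}\mathbb{E}_{\mathcal{R}[f]}\left[\left|\widehat f_{\widehat m}(x)-f(x)\right|^2\right]\le C(L,\beta,d)\left(\frac{n}{\log(n)}\right)^{-\frac{2\beta-d}{2\beta+d-1}},$$ where the supremum is over all probability densities $f$ on $\mathbb{R}^d$ belonging to $\mathcal{W}^\beta(L)$.
   Context: $\|\cdot\|$ and $\langle\cdot,\cdot\rangle$ are the Euclidean norm and scalar product, $\mathbb{S}^{d-1}$ is the unit sphere of $\mathbb{R}^d$ with surface measure $\sigma^{d-1}$, and $\rho_d:=2\pi^{d/2}/\Gamma(d/2)$ is its total surface measure. $\lambda^d$ is Lebesgue measure on $\mathbb{R}^d$; $a_+:=\max\{a,0\}$ and $a\wedge b:=\min\{a,b\}$; $\mathbb{N}=\{1,2,\dots\}$. Radon transform: for $h\in L^1(\mathbb{R}^d)$ and $(s,u)\in\mathbb{S}^{d-1}\times\mathbb{R}$, $\mathcal{R}[h](s,u):=\int_{\{v\in\mathbb{R}^d:\langle v,s\rangle=u\}}h(v)\,dv$, integration being with respect to the hypersurface ($(d-1)$-dimensional Lebesgue) measure on the hyperplane. For a probability density $f$,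 $\rho_d^{-1}\mathcal{R}[f]$ is a probability density on $\mathbb{S}^{d-1}\times\mathbb{R}$ with respect to $\sigma^{d-1}\otimes\lambda^1$. The observations $(S_1,U_1),\dots,(S_n,U_n)$ are i.i.d. with this density, and $\mathbb{E}_{\mathcal{R}[f]}$ is the corresponding expectation. Fourier transform: $\mathcal{F}_d[h](t):=\int_{\mathbb{R}^d}e^{i\langle t,y\rangle}h(y)\,d\lambda^d(y)$ (extended to $L^2(\mathbb{R}^d)$ as usual). A density $f$ with $\mathcal{F}_d[f]\in L^1(\mathbb{R}^d)$ (which holds for $f\in\mathcal{W}^\beta(L)$ with $\beta>d/2$) is identified with its continuous version. Sobolev ellipsoid: $\mathcal{W}^\beta(L):=\{f\in L^2(\mathbb{R}^d):\int_{\mathbb{R}^d}(1+\|t\|^2)^\beta|\mathcal{F}_d[f](t)|^2\,d\lambda^d(t)\le L\}$. Estimator: for $m>0$, $\widehat f_m(x):=\frac1n\sum_{i=1}^nK_m(\langle S_i,x\rangle-U_i)$ with $K_m(u):=\frac{\rho_d}{(2\pi)^d}\int_0^mr^{d-1}\cos(ur)\,dr$, $u\in\mathbb{R}$. Data-driven choice of $m$ (all quantities depend on $x$, suppressed in notation): $\mathcal{M}_n:=\{m\in\mathbb{N}:m\le n^{1/(2d-1)}\}$. For $m\in\mathcal{M}_n$ put $\widehat\mu_m:=\frac1n\sum_{j=1}^nmK_1^2(m(\langle S_j,x\rangle-U_j))$, $\widehat V(m):=2\chi(1+\widehat\mu_m)m^{2d-1}\log(n)/n$, $\widehat A(m):=\sup_{m'\in\mathcal{M}_n}\left(|\widehat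 f_{m'\wedge m}(x)-\widehat f_{m'}(x)|^2-\widehat V(m')\right)_+$, and $\widehat m:=\arg\min_{m\in\mathcal{M}_n}\{\widehat A(m)+\widehat V(m)\}$ (any measurable selection of a minimizer). *)

theory Defs
  imports "HOL-Probability.Probability"
begin

definition sphere_area :: "nat \<Rightarrow> real" where
  "sphere_area d = 2 * pi powr (real d / 2) / Gamma (real d / 2)"

text \<open>Surface measure on the unit sphere, as a measure whose space is the sphere, via polar
  coordinates: \<open>\<sigma>(A) = d * \<lambda>({r s | s \<in> A, 0 < r < 1})\<close>. Here \<open>sgn y = y / norm y\<close>.\<close>

definition sphere_measure :: "'a::euclidean_space measure" where
  "sphere_measure = scale_measure (of_nat DIM('a))
     (distr (restrict_space lborel (ball 0 1 - {0})) (restrict_space borel (sphere 0 1)) sgn)"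

definition orthonormal_basis_of :: "'a::euclidean_space set \<Rightarrow> 'a set \<Rightarrow> bool" where
  "orthonormal_basis_of V B \<longleftrightarrow>
     pairwise orthogonal B \<and> (\<forall>b\<in>B. norm b = 1) \<and> span B = V"

text \<open>Lebesgue measure of dimension \<open>d - 1\<close> on the hyperplane \<open>{v. v \<bullet> s = u}\<close>, for a unit
  vector \<open>s\<close>: the image of the product Lebesgue measure under the isometric parametrisation by
  an orthonormal basis of the orthogonal complement of \<open>s\<close> (any choice of basis gives the same
  measure). It lives on the Borel sets of the whole space and is concentrated on the
  hyperplane.\<close>

definition hyperplane_measure :: "'a::euclidean_space \<Rightarrow> real \<Rightarrow> 'a measure" where
  "hyperplane_measure s u =
     (let B = (SOME B. orthonormal_basis_of {v. v \<bullet> s = 0} B)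
      in distr (\<Pi>\<^sub>M b\<in>B. lborel) borel (\<lambda>g. u *\<^sub>R s + (\<Sum>b\<in>B. g b *\<^sub>R b)))"

definition radon_transform :: "('a::euclidean_space \<Rightarrow> real) \<Rightarrow> 'a \<Rightarrow> real \<Rightarrow> real" where
  "radon_transform h s u = (\<integral>v. h v \<partial>hyperplane_measure s u)"

definition radon_law :: "('a::euclidean_space \<Rightarrow> real) \<Rightarrow> ('a \<times> real) measure" where
  "radon_law f = density (sphere_measure \<Otimes>\<^sub>M lborel)
     (\<lambda>(s, u). ennreal (radon_transform f s u / sphere_area DIM('a)))"

definition prob_density :: "('a::euclidean_space \<Rightarrow> real) \<Rightarrow> bool" where
  "prob_density f \<longleftrightarrow>
     f \<in> borel_measurable borel \<and> (\<forall>y. 0 \<le> f y) \<and> (\<integral>\<^sup>+y. ennreal (f y) \<partial>lborel) = 1"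

definition fourier_integral :: "('a::euclidean_space \<Rightarrow> complex) \<Rightarrow> 'a \<Rightarrow> complex" where
  "fourier_integral h t = (\<integral>y. cis (t \<bullet> y) * h y \<partial>lborel)"

text \<open>The integral on \<open>L\<^sup>1\<close>; for other \<open>h\<close> in \<open>L\<^sup>2\<close> the Plancherel extension, i.e. the limit in
  \<open>L\<^sup>2\<close> of the transforms of the truncations of \<open>h\<close> to balls (determined up to null sets).\<close>

definition fourier_transform :: "('a::euclidean_space \<Rightarrow> complex) \<Rightarrow> 'a \<Rightarrow> complex" where
  "fourier_transform h =
     (if integrable lborel h then fourier_integral h
      else (SOME g. g \<in> borel_measurable borel \<and>
        ((\<lambda>R. \<integral>\<^sup>+t. ennreal ((cmod (g t
             - fourier_integral (\<lambda>y. indicator (cball 0 R) y * h y) t))\<^sup>2) \<partial>lborel) \<longlongrightarrow> 0) at_top))"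

definition sobolev_ellipsoid :: "real \<Rightarrow> real \<Rightarrow> ('a::euclidean_space \<Rightarrow> real) set" where
  "sobolev_ellipsoid \<beta> L =
     {f. f \<in> borel_measurable borel \<and> integrable lborel (\<lambda>y. (f y)\<^sup>2) \<and>
       (\<integral>\<^sup>+t. ennreal ((1 + (norm t)\<^sup>2) powr \<beta> *
           (cmod (fourier_transform (\<lambda>y. complex_of_real (f y)) t))\<^sup>2) \<partial>lborel) \<le> ennreal L}"

text \<open>The continuous representative of \<open>f\<close>, unique if it exists. Point values of densities are
  those of this representative.\<close>

definition continuous_version :: "('a::euclidean_space \<Rightarrow> real) \<Rightarrow> 'a \<Rightarrow> real" where
  "continuous_version f = (SOME g. continuous_on UNIV g \<and> (AE y in lborel. f y = g y))"

definition kern :: "nat \<Rightarrow> real \<Rightarrow> real \<Rightarrow> real" where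
  "kern d m u =
     sphere_area d / (2 * pi) ^ d * integral {0..m} (\<lambda>r. r ^ (d - 1) * cos (u * r))"

text \<open>In the following, \<open>\<omega>\<close> is the sample: \<open>\<omega> i = (S\<^sub>i, U\<^sub>i)\<close> for \<open>i \<in> {1..n}\<close>.\<close>

definition estimator ::
    "nat \<Rightarrow> (nat \<Rightarrow> 'a::euclidean_space \<times> real) \<Rightarrow> 'a \<Rightarrow> real \<Rightarrow> real" where
  "estimator n \<omega> x m =
     (\<Sum>i=1..n. kern DIM('a) m (fst (\<omega> i) \<bullet> x - snd (\<omega> i))) / real n"

definition cutoffs :: "nat \<Rightarrow> nat \<Rightarrow> nat set" where
  "cutoffs d n = {m. 1 \<le> m \<and> real m \<le> real n powr (1 / (2 * real d - 1))}"

definition mu_hat ::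
    "nat \<Rightarrow> (nat \<Rightarrow> 'a::euclidean_space \<times> real) \<Rightarrow> 'a \<Rightarrow> nat \<Rightarrow> real" where
  "mu_hat n \<omega> x m =
     (\<Sum>j=1..n. real m * (kern DIM('a) 1 (real m * (fst (\<omega> j) \<bullet> x - snd (\<omega> j))))\<^sup>2) / real n"

definition V_hat ::
    "real \<Rightarrow> nat \<Rightarrow> (nat \<Rightarrow> 'a::euclidean_space \<times> real) \<Rightarrow> 'a \<Rightarrow> nat \<Rightarrow> real" where
  "V_hat \<kappa> n \<omega> x m =
     2 * \<kappa> * (1 + mu_hat n \<omega> x m) * real m ^ (2 * DIM('a) - 1) * ln (real n) / real n"

definition A_hat ::
    "real \<Rightarrow> nat \<Rightarrow> (nat \<Rightarrow> 'a::euclidean_space \<times> real) \<Rightarrow> 'a \<Rightarrow> nat \<Rightarrow> real" where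
  "A_hat \<kappa> n \<omega> x m =
     (SUP m'\<in>cutoffs DIM('a) n.
        max 0 (\<bar>estimator n \<omega> x (real (min m' m)) - estimator n \<omega> x (real m')\<bar>\<^sup>2
               - V_hat \<kappa> n \<omega> x m'))"

definition sample_space :: "nat \<Rightarrow> (nat \<Rightarrow> 'a::euclidean_space \<times> real) measure" where
  "sample_space n = (\<Pi>\<^sub>M i\<in>{1..n}. sphere_measure \<Otimes>\<^sub>M lborel)"

definition sample_law ::
    "nat \<Rightarrow> ('a::euclidean_space \<Rightarrow> real) \<Rightarrow> (nat \<Rightarrow> 'a \<times> real) measure" where
  "sample_law n f = (\<Pi>\<^sub>M i\<in>{1..n}. radon_law f)"

text \<open>Measurable selections of a minimiser of \<open>m \<mapsto> A(m) + V(m)\<close>; only the measurable structure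
  of \<open>sample_space\<close> matters here, and it is that of \<open>sample_law n f\<close> for every \<open>f\<close>.\<close>

definition cutoff_selection ::
    "real \<Rightarrow> nat \<Rightarrow> 'a::euclidean_space \<Rightarrow> ((nat \<Rightarrow> 'a \<times> real) \<Rightarrow> nat) \<Rightarrow> bool" where
  "cutoff_selection \<kappa> n x m_hat \<longleftrightarrow>
     m_hat \<in> sample_space n \<rightarrow>\<^sub>M count_space UNIV \<and>
     (\<forall>\<omega>\<in>space (sample_space n).
        is_arg_min (\<lambda>m. A_hat \<kappa> n \<omega> x m + V_hat \<kappa> n \<omega> x m)
          (\<lambda>m. m \<in> cutoffs DIM('a) n) (m_hat \<omega>))"

end

theory Submission
  imports Defs "HOL-Real_Asymp.Real_Asymp"
begin

text \<open>An observation has the law of \<open>(S, V \<bullet> S)\<close> with \<open>S\<close> uniform on the sphere and \<open>V\<close> of density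
  \<open>f\<close>, independent. In polar coordinates the expectation of the estimator is therefore the inversion
  integral of the Fourier transform of \<open>f\<close>, truncated to the ball of radius \<open>m\<close>; the Sobolev
  condition bounds the squared bias by a multiple of \<open>m powr (d - 2 * \<beta>)\<close>, and the second moment of the
  kernel by a multiple of \<open>m ^ (2 * d - 1)\<close>, uniformly in \<open>f\<close> and \<open>x\<close>. A self-normalised Bernstein
  inequality shows that twice the squared stochastic error stays below \<open>V_hat\<close>, with the constant 24
  and for every \<open>n \<ge> 2\<close>, except on an event so rare that it contributes \<open>O(1 / n)\<close>. The usual
  Goldenshluger-Lepski comparison then bounds the loss by the value of \<open>V_hat\<close> plus the squared bias at
  any fixed cutoff, and the cutoff of order \<open>(n / ln n) powr (1 / (2 * \<beta> + d - 1))\<close> balances the two.\<close>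

text \<open>Three demands shape the argument: a bound uniform in \<open>f\<close> and
  \<open>x\<close>, the penalty constant 24, and validity for every \<open>n \<ge> 2\<close>. Let b
  bound the kernel at cutoff m and let q = m^(2d-1). Bernstein's inequality loses its linear term
  once t b^2 is at most n times the variance proxy. The summand 1 in \<open>1 + mu_hat\<close> pays
  for a proxy of order q even if the true second moment is tiny, and b^2 <= q m / 81 with m ln n <=
  2 n then secures the condition. For t = 3 ln n the threshold 16 t q (1 + mu_hat) / n is
  \<open>V_hat\<close> with constant 24, and the failure probability 3 / n^3 outweighs the crude
  bound 8 b^2 on the excess. Uniformity in \<open>f\<close> rests on the integral of |F f(t)| /
  |t|^(d-1): the polar volume element cancels the singularity at 0, and the Sobolev condition
  controls the rest. Since the target is the value of a continuous version at one point, Fourier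
  inversion must hold at every point; Gaussian smoothing provides it.\<close>

section \<open>Law of the observations\<close>

text \<open>Integrating the indicator of \<open>{(x, y). T x \<in> ball 0 1 \<and> y + T x \<in> A}\<close> in both orders shows
  that the translation invariant measure \<open>distr lborel borel T\<close> is proportional to \<open>lborel\<close>; the
  unit ball fixes the factor.\<close>

lemma lborel_orthogonal_transformation:
  fixes T :: "'a::euclidean_space \<Rightarrow> 'a"
  assumes T: "orthogonal_transformation T"
  shows "distr lborel borel T = lborel"
proof (rule measure_eqI)
  fix A assume "A \<in> sets (distr lborel borel T)"
  then have A[measurable]: "A \<in> sets borel" by simp
  have lin: "linear T" using T by (rule orthogonal_transformation_linear)
  have [measurable]: "T \<in> borel_measurable borel"
    by (intro borel_measurable_continuous_onI linear_continuous_on linear_linear[THEN iffD2] lin)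
  let ?b = "ball (0::'a) 1"
  have [measurable]: "?b \<in> sets borel" by simp
  have Tb: "T x \<in> ?b \<longleftrightarrow> x \<in> ?b" for x
    using orthogonal_transformation_norm[OF T] by simp
  have trans: "(\<integral>\<^sup>+x. F (c + x) \<partial>lborel) = (\<integral>\<^sup>+x. F x \<partial>lborel)"
    if [measurable]: "F \<in> borel_measurable borel" for F :: "'a \<Rightarrow> ennreal" and c
    by (subst (2) lborel_distr_plus[of c, symmetric]) (simp add: nn_integral_distr)
  let ?V = "emeasure lborel ?b"
  have V: "?V \<noteq> 0" "?V \<noteq> top"
    using unit_ball_vol_pos[of "real DIM('a)", THEN less_imp_neq] by (auto simp: emeasure_ball)
  have "?V * emeasure lborel A = (\<integral>\<^sup>+x. indicator ?b x * emeasure lborel A \<partial>lborel)"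
    by (subst nn_integral_multc) (auto intro!: borel_measurable_indicator)
  also have "\<dots> = (\<integral>\<^sup>+x. \<integral>\<^sup>+y. indicator ?b (T x) * indicator A (T x + y) \<partial>lborel \<partial>lborel)"
  proof (rule nn_integral_cong)
    fix x :: 'a
    have "indicator ?b (T x) = (indicator ?b x :: ennreal)" using Tb[of x] by (simp only: indicator_def)
    then show "indicator ?b x * emeasure lborel A = (\<integral>\<^sup>+y. indicator ?b (T x) * indicator A (T x + y) \<partial>lborel)"
      by (subst nn_integral_cmult) (auto simp: trans[of "indicator A"])
  qed
  also have "\<dots> = (\<integral>\<^sup>+y. \<integral>\<^sup>+x. indicator ?b (T x) * indicator A (T x + y) \<partial>lborel \<partial>lborel)"
    by (rule lborel_pair.Fubini') measurable
  also have "\<dots> = (\<integral>\<^sup>+y. \<integral>\<^sup>+x. indicator ?b (T x - y) * indicator A (T x) \<partial>lborel \<partial>lborel)"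
  proof (rule nn_integral_cong)
    fix y :: 'a
    obtain z where y: "y = T z" using orthogonal_transformation_surj[OF T] by (metis surjD)
    show "(\<integral>\<^sup>+x. indicator ?b (T x) * indicator A (T x + y) \<partial>lborel)
        = (\<integral>\<^sup>+x. indicator ?b (T x - y) * indicator A (T x) \<partial>lborel)"
      using trans[of "\<lambda>x. indicator ?b (T x - y) * indicator A (T x)" z]
      by (simp add: y linear_add[OF lin] add.commute)
  qed
  also have "\<dots> = (\<integral>\<^sup>+x. \<integral>\<^sup>+y. indicator ?b (T x - y) * indicator A (T x) \<partial>lborel \<partial>lborel)"
    by (rule lborel_pair.Fubini') measurable
  also have "\<dots> = (\<integral>\<^sup>+x. ?V * indicator A (T x) \<partial>lborel)"
  proof (rule nn_integral_cong)
    fix x :: 'a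
    have "(\<integral>\<^sup>+y. indicator ?b (T x - y) \<partial>lborel) = (\<integral>\<^sup>+y. indicator (ball (T x) 1) y \<partial>lborel)"
      by (intro nn_integral_cong) (simp add: indicator_def dist_norm norm_minus_commute)
    also have "\<dots> = ?V" by (simp add: emeasure_ball)
    finally show "(\<integral>\<^sup>+y. indicator ?b (T x - y) * indicator A (T x) \<partial>lborel) = ?V * indicator A (T x)"
      by (subst nn_integral_multc) auto
  qed
  also have "\<dots> = ?V * emeasure (distr lborel borel T) A"
    by (simp add: nn_integral_cmult nn_integral_distr flip: nn_integral_indicator)
  finally show "emeasure (distr lborel borel T) A = emeasure lborel A"
    using V by (simp add: ennreal_mult_cancel_left)
qed simp

text \<open>Relabelling coordinates along a bijection permutes the factors of the volume of a box.
  This links the product over \<open>Basis\<close> behind \<open>lborel\<close> to products over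
  other orthonormal bases.\<close>

lemma distr_PiM_lborel_reindex:
  assumes p: "bij_betw p I J" and fin: "finite I"
  shows "distr (\<Pi>\<^sub>M i\<in>I. (lborel :: real measure)) (\<Pi>\<^sub>M j\<in>J. lborel) (\<lambda>g. \<lambda>j\<in>J. g (inv_into I p j))
    = (\<Pi>\<^sub>M j\<in>J. lborel)"
proof -
  let ?T = "distr (\<Pi>\<^sub>M i\<in>I. (lborel :: real measure)) (\<Pi>\<^sub>M j\<in>J. lborel) (\<lambda>g. \<lambda>j\<in>J. g (inv_into I p j))"
  interpret product_sigma_finite "\<lambda>_. lborel :: real measure"
    by (simp add: product_sigma_finite_def sigma_finite_lborel)
  have q: "\<And>j. j \<in> J \<Longrightarrow> inv_into I p j \<in> I"
    using p by (auto simp: bij_betw_def intro: inv_into_into)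
  have m[measurable]: "(\<lambda>g. \<lambda>j\<in>J. g (inv_into I p j)) \<in> (\<Pi>\<^sub>M i\<in>I. (lborel :: real measure)) \<rightarrow>\<^sub>M (\<Pi>\<^sub>M j\<in>J. lborel)"
    by (rule measurable_restrict) (use q in measurable)
  have finJ: "finite J" using p fin bij_betw_finite by blast
  show ?thesis
  proof (rule PiM_eqI[OF finJ])
    fix A :: "'b \<Rightarrow> real set" assume A: "\<And>i. i \<in> J \<Longrightarrow> A i \<in> sets lborel"
    have pinv: "\<And>i. i \<in> I \<Longrightarrow> inv_into I p (p i) = i" "\<And>i. i \<in> I \<Longrightarrow> p i \<in> J"
      using p by (auto simp: bij_betw_def)
    have "(\<lambda>g. \<lambda>j\<in>J. g (inv_into I p j)) -` Pi\<^sub>E J A \<inter> space (\<Pi>\<^sub>M i\<in>I. lborel)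
       = Pi\<^sub>E I (\<lambda>i. A (p i))"
    proof (intro equalityI subsetI)
      fix g assume g: "g \<in> (\<lambda>g. \<lambda>j\<in>J. g (inv_into I p j)) -` Pi\<^sub>E J A \<inter> space (\<Pi>\<^sub>M i\<in>I. lborel)"
      then have "\<And>j. j \<in> J \<Longrightarrow> g (inv_into I p j) \<in> A j" by (auto simp: PiE_iff)
      from this[OF pinv(2)] g show "g \<in> Pi\<^sub>E I (\<lambda>i. A (p i))"
        by (auto simp: PiE_iff space_PiM pinv)
    next
      fix g assume g: "g \<in> Pi\<^sub>E I (\<lambda>i. A (p i))"
      have "p (inv_into I p j) = j" if "j \<in> J" for j
        using p that by (auto simp: bij_betw_def f_inv_into_f)
      with g q show "g \<in> (\<lambda>g. \<lambda>j\<in>J. g (inv_into I p j)) -` Pi\<^sub>E J A \<inter> space (\<Pi>\<^sub>M i\<in>I. lborel)"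
        by (fastforce simp: PiE_iff space_PiM)
    qed
    moreover have "Pi\<^sub>E J A \<in> sets (\<Pi>\<^sub>M j\<in>J. lborel)"
      using A finJ by (intro sets_PiM_I_finite) auto
    ultimately have "emeasure ?T (Pi\<^sub>E J A)
      = (\<Prod>i\<in>I. emeasure lborel (A (p i)))"
      using A pinv fin by (simp add: emeasure_distr emeasure_PiM)
    also have "\<dots> = (\<Prod>j\<in>J. emeasure lborel (A j))"
      using p by (rule prod.reindex_bij_betw)
    finally show "emeasure ?T (Pi\<^sub>E J A)
      = (\<Prod>j\<in>J. emeasure lborel (A j))" .
  qed simp
qed

text \<open>The linear map that sends \<open>Basis\<close> to \<open>C\<close> along a bijection
  preserves inner products, so rotation invariance of \<open>lborel\<close> applies.\<close>

lemma lborel_orthonormal_coordinates: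
  fixes C :: "'a::euclidean_space set"
  assumes C: "orthonormal_basis_of UNIV C"
  shows "distr (\<Pi>\<^sub>M b\<in>C. lborel) borel (\<lambda>g. \<Sum>b\<in>C. g b *\<^sub>R b) = lborel"
proof -
  have orth: "pairwise orthogonal C" and nrm: "\<And>b. b \<in> C \<Longrightarrow> norm b = 1" and sp: "span C = UNIV"
    using C by (auto simp: orthonormal_basis_of_def)
  have "independent C" using orth nrm by (intro pairwise_orthogonal_independent) force+
  then have finC: "finite C" and cardC: "card C = card (Basis :: 'a set)"
    using independent_imp_finite dim_eq_card[of C UNIV] sp by auto
  obtain p where p: "bij_betw p (Basis :: 'a set) C"
    using finite_same_card_bij[OF finite_Basis finC cardC[symmetric]] by blast
  have pC: "p b \<in> C" if "b \<in> Basis" for b using p that by (auto simp: bij_betw_def)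
  have pp: "p a \<bullet> p b = (if a = b then 1 else 0)" if "a \<in> Basis" "b \<in> Basis" for a b
  proof (cases "a = b")
    case False
    then have "p a \<noteq> p b" using p that by (auto simp: bij_betw_def inj_on_def)
    with False orth pC that show ?thesis by (auto simp: pairwise_def orthogonal_def)
  qed (use nrm pC that in \<open>auto simp: dot_square_norm\<close>)
  define T where "T x = (\<Sum>b\<in>Basis. (x \<bullet> b) *\<^sub>R p b)" for x :: "'a"
  have linT: "linear T"
    unfolding T_def
    by (intro linearI) (auto simp: inner_add_left scaleR_add_left sum.distrib scaleR_sum_right)
  have "T v \<bullet> T w = v \<bullet> w" for v w
  proof -
    have "T v \<bullet> T w = (\<Sum>a\<in>Basis. \<Sum>b\<in>Basis. (v \<bullet> a) * ((w \<bullet> b) * (p a \<bullet> p b)))"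
      by (simp add: T_def inner_sum_left inner_sum_right sum_distrib_left) (subst sum.swap, simp add: mult_ac)
    also have "\<dots> = (\<Sum>a\<in>Basis. \<Sum>b\<in>Basis. if a = b then (v \<bullet> a) * (w \<bullet> b) else 0)"
      by (intro sum.cong refl) (auto simp: pp)
    also have "\<dots> = v \<bullet> w" by (simp add: euclidean_inner[of v w])
    finally show ?thesis .
  qed
  then have T: "orthogonal_transformation T"
    using linT by (simp add: orthogonal_transformation_def)
  have Tm[measurable]: "T \<in> borel_measurable borel"
    by (intro borel_measurable_continuous_onI linear_continuous_on linear_linear[THEN iffD2] linT)
  let ?P = "\<Pi>\<^sub>M b\<in>(Basis :: 'a set). (lborel :: real measure)"
  have q: "\<And>j. j \<in> C \<Longrightarrow> inv_into Basis p j \<in> Basis"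
    using p by (auto simp: bij_betw_def intro: inv_into_into)
  have m[measurable]: "(\<lambda>g. \<lambda>j\<in>C. g (inv_into Basis p j)) \<in> ?P \<rightarrow>\<^sub>M (\<Pi>\<^sub>M j\<in>C. lborel)"
    by (rule measurable_restrict) (use q in measurable)
  have "distr (\<Pi>\<^sub>M b\<in>C. lborel) borel (\<lambda>g. \<Sum>b\<in>C. g b *\<^sub>R b)
     = distr (distr ?P (\<Pi>\<^sub>M b\<in>C. lborel) (\<lambda>g. \<lambda>j\<in>C. g (inv_into Basis p j))) borel (\<lambda>g. \<Sum>b\<in>C. g b *\<^sub>R b)"
    by (subst distr_PiM_lborel_reindex[OF p]) auto
  also have "\<dots> = distr ?P borel (\<lambda>g. T (\<Sum>b\<in>Basis. g b *\<^sub>R b))"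
  proof (subst distr_distr)
    show "(\<lambda>g. \<Sum>b\<in>C. g b *\<^sub>R b) \<in> (\<Pi>\<^sub>M j\<in>C. lborel) \<rightarrow>\<^sub>M borel" by measurable
    show "distr ?P borel ((\<lambda>g. \<Sum>b\<in>C. g b *\<^sub>R b) \<circ> (\<lambda>g. \<lambda>j\<in>C. g (inv_into Basis p j)))
      = distr ?P borel (\<lambda>g. T (\<Sum>b\<in>Basis. g b *\<^sub>R b))"
    proof (intro distr_cong refl)
      fix g :: "'a \<Rightarrow> real"
      have "(\<Sum>b\<in>C. g (inv_into Basis p b) *\<^sub>R b) = (\<Sum>b\<in>Basis. g (inv_into Basis p (p b)) *\<^sub>R p b)"
        by (rule sum.reindex_bij_betw[OF p, symmetric])
      also have "\<dots> = (\<Sum>b\<in>Basis. g b *\<^sub>R p b)"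
        using p by (intro sum.cong) (auto simp: bij_betw_def)
      also have "\<dots> = T (\<Sum>b\<in>Basis. g b *\<^sub>R b)"
        unfolding T_def by (intro sum.cong refl) simp
      finally show "((\<lambda>g. \<Sum>b\<in>C. g b *\<^sub>R b) \<circ> (\<lambda>g. \<lambda>j\<in>C. g (inv_into Basis p j))) g = T (\<Sum>b\<in>Basis. g b *\<^sub>R b)"
        by simp
    qed
  qed measurable
  also have "\<dots> = distr (distr ?P borel (\<lambda>g. \<Sum>b\<in>Basis. g b *\<^sub>R b)) borel T"
    by (subst distr_distr) (auto simp: comp_def)
  also have "\<dots> = lborel"
    by (simp add: lborel_eq[symmetric] lborel_orthogonal_transformation[OF T])
  finally show ?thesis .
qed

section \<open>Slicing by parallel hyperplanes\<close>

context
  fixes s :: "'a::euclidean_space" and B :: "('a) set"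
  assumes s: "norm s = 1" and B: "orthonormal_basis_of {v. v \<bullet> s = 0} B"
begin

lemma perp_basis_inner: "b \<in> B \<Longrightarrow> b \<bullet> s = 0"
  using B span_superset[of B] by (auto simp: orthonormal_basis_of_def)

lemma perp_basis_independent: "independent B"
  using B by (intro pairwise_orthogonal_independent) (force simp: orthonormal_basis_of_def)+

lemma perp_basis_finite: "finite B"
  using perp_basis_independent independent_imp_finite by blast

lemma notin_perp_basis: "s \<notin> B"
  using perp_basis_inner[of s] s by (auto simp: dot_square_norm)

lemma orthonormal_insert: "orthonormal_basis_of UNIV (insert s B)"
proof -
  have "pairwise orthogonal (insert s B)"
    using B perp_basis_inner by (auto simp: orthonormal_basis_of_def pairwise_insert orthogonal_def inner_commute)
  moreover have "\<forall>b\<in>insert s B. norm b = 1" using B s by (auto simp: orthonormal_basis_of_def)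
  moreover have "x \<in> span (insert s B)" for x
  proof -
    have "x - (x \<bullet> s) *\<^sub>R s \<in> span B"
      using B s by (auto simp: orthonormal_basis_of_def inner_diff_left dot_square_norm)
    then show ?thesis by (auto simp: span_insert)
  qed
  ultimately show ?thesis by (auto simp: orthonormal_basis_of_def)
qed

text \<open>Coordinates with respect to \<open>insert s B\<close>, the one along \<open>s\<close>
  being integrated last: Fubini over the hyperplanes orthogonal to \<open>s\<close>.\<close>

lemma nn_integral_slices:
  assumes [measurable]: "F \<in> borel_measurable borel"
  shows "(\<integral>\<^sup>+y. F y \<partial>lborel)
    = (\<integral>\<^sup>+u. \<integral>\<^sup>+g. F (u *\<^sub>R s + (\<Sum>b\<in>B. g b *\<^sub>R b)) \<partial>(\<Pi>\<^sub>M b\<in>B. lborel) \<partial>lborel)"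
proof -
  interpret product_sigma_finite "\<lambda>_. lborel :: real measure"
    by (simp add: product_sigma_finite_def sigma_finite_lborel)
  have "(\<integral>\<^sup>+y. F y \<partial>lborel) = (\<integral>\<^sup>+y. F y \<partial>distr (\<Pi>\<^sub>M b\<in>insert s B. lborel) borel (\<lambda>g. \<Sum>b\<in>insert s B. g b *\<^sub>R b))"
    by (simp only: lborel_orthonormal_coordinates[OF orthonormal_insert])
  also have "\<dots> = (\<integral>\<^sup>+g. F (\<Sum>b\<in>insert s B. g b *\<^sub>R b) \<partial>(\<Pi>\<^sub>M b\<in>insert s B. lborel))"
    by (subst nn_integral_distr) auto
  also have "\<dots> = (\<integral>\<^sup>+u. \<integral>\<^sup>+g. F (\<Sum>b\<in>insert s B. (g(s := u)) b *\<^sub>R b) \<partial>(\<Pi>\<^sub>M b\<in>B. lborel) \<partial>lborel)"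
    by (rule product_nn_integral_insert_rev[OF perp_basis_finite notin_perp_basis]) measurable
  also have "\<dots> = (\<integral>\<^sup>+u. \<integral>\<^sup>+g. F (u *\<^sub>R s + (\<Sum>b\<in>B. g b *\<^sub>R b)) \<partial>(\<Pi>\<^sub>M b\<in>B. lborel) \<partial>lborel)"
  proof (intro nn_integral_cong arg_cong[of _ _ F])
    fix u :: real and g :: "'a \<Rightarrow> real"
    have "(\<Sum>b\<in>B. (g(s := u)) b *\<^sub>R b) = (\<Sum>b\<in>B. g b *\<^sub>R b)"
      by (intro sum.cong refl) (use notin_perp_basis in auto)
    then show "(\<Sum>b\<in>insert s B. (g(s := u)) b *\<^sub>R b) = u *\<^sub>R s + (\<Sum>b\<in>B. g b *\<^sub>R b)"
      using perp_basis_finite notin_perp_basis by simp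
  qed
  finally show ?thesis .
qed

lemma slice_inner: "(u *\<^sub>R s + (\<Sum>b\<in>B. g b *\<^sub>R b)) \<bullet> s = u"
  using perp_basis_inner s by (simp add: inner_add_left inner_sum_left dot_square_norm)

text \<open>Averaging over the slab \<open>0 \<le> y \<bullet> s \<le> 1\<close> removes the choice of the basis; in this form the
  hyperplane measure visibly depends measurably on \<open>(s, u)\<close>.\<close>

lemma hyperplane_measure_slab_aux:
  "distr (\<Pi>\<^sub>M b\<in>B. lborel) borel (\<lambda>g. u *\<^sub>R s + (\<Sum>b\<in>B. g b *\<^sub>R b))
    = distr (density lborel (\<lambda>y. indicator {0..1} (y \<bullet> s))) borel (\<lambda>y. u *\<^sub>R s + (y - (y \<bullet> s) *\<^sub>R s))"
  (is "?L = ?R")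
proof (rule measure_eqI)
  fix A assume "A \<in> sets ?L"
  then have A[measurable]: "A \<in> sets borel" by simp
  \<comment> \<open>Projecting orthogonally to \<open>s\<close> forgets the coordinate w, so the
    slab contributes the hyperplane integral times the length 1 of its range of w.\<close>
  have proj: "(w *\<^sub>R s + (\<Sum>b\<in>B. g b *\<^sub>R b)) - ((w *\<^sub>R s + (\<Sum>b\<in>B. g b *\<^sub>R b)) \<bullet> s) *\<^sub>R s
    = (\<Sum>b\<in>B. g b *\<^sub>R b)" for w g by (simp add: slice_inner)
  have "emeasure ?R A = (\<integral>\<^sup>+y. indicator A y \<partial>?R)" by simp
  also have "\<dots> = (\<integral>\<^sup>+y. indicator {0..1} (y \<bullet> s) * indicator A (u *\<^sub>R s + (y - (y \<bullet> s) *\<^sub>R s)) \<partial>lborel)"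
    by (simp add: nn_integral_distr nn_integral_density del: nn_integral_indicator)
  also have "\<dots> = (\<integral>\<^sup>+w. \<integral>\<^sup>+g. indicator {0..1::real} w * indicator A (u *\<^sub>R s + (\<Sum>b\<in>B. g b *\<^sub>R b)) \<partial>(\<Pi>\<^sub>M b\<in>B. lborel) \<partial>lborel)"
    by (subst nn_integral_slices) (simp_all only: proj, simp_all add: slice_inner)
  also have "\<dots> = (\<integral>\<^sup>+w. indicator {0..1::real} w * emeasure ?L A \<partial>lborel)"
    by (intro nn_integral_cong, subst nn_integral_cmult)
       (auto simp: nn_integral_distr simp flip: nn_integral_indicator)
  also have "\<dots> = emeasure ?L A" by (subst nn_integral_multc) auto
  finally show "emeasure ?L A = emeasure ?R A" ..
qed simp

end

lemma orthonormal_basis_exists: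
  fixes s :: "'a::euclidean_space"
  shows "\<exists>B. orthonormal_basis_of {v. v \<bullet> s = 0} B"
proof -
  have "subspace {v. v \<bullet> s = 0}" by (simp add: subspace_hyperplane2 inner_commute subspace_hyperplane)
  from orthonormal_basis_subspace[OF this] show ?thesis
    unfolding orthonormal_basis_of_def by metis
qed

lemma hyperplane_measure_slab:
  fixes s :: "'a::euclidean_space"
  assumes "norm s = 1"
  shows "hyperplane_measure s u
    = distr (density lborel (\<lambda>y. indicator {0..1} (y \<bullet> s))) borel (\<lambda>y. u *\<^sub>R s + (y - (y \<bullet> s) *\<^sub>R s))"
  using hyperplane_measure_slab_aux[OF assms someI_ex[OF orthonormal_basis_exists]]
  by (simp add: hyperplane_measure_def)

text \<open>A weight depending only on the offset can be pulled through the slices. With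
  \<open>h\<close> constant 1 this gives the total mass of the Radon transform along a direction,
  with \<open>h\<close> an indicator the law of \<open>v \<bullet> s\<close>.\<close>

lemma nn_integral_hyperplane_measure:
  fixes s :: "'a::euclidean_space"
  assumes s: "norm s = 1" and [measurable]: "F \<in> borel_measurable borel" "h \<in> borel_measurable borel"
  shows "(\<integral>\<^sup>+u. (\<integral>\<^sup>+v. F v \<partial>hyperplane_measure s u) * h u \<partial>lborel) = (\<integral>\<^sup>+v. F v * h (v \<bullet> s) \<partial>lborel)"
proof -
  define B where "B = (SOME B. orthonormal_basis_of {v. v \<bullet> s = 0} B)"
  have B: "orthonormal_basis_of {v. v \<bullet> s = 0} B"
    unfolding B_def by (rule someI_ex[OF orthonormal_basis_exists])
  have "(\<integral>\<^sup>+v. F v * h (v \<bullet> s) \<partial>lborel)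
     = (\<integral>\<^sup>+u. \<integral>\<^sup>+g. F (u *\<^sub>R s + (\<Sum>b\<in>B. g b *\<^sub>R b)) * h u \<partial>(\<Pi>\<^sub>M b\<in>B. lborel) \<partial>lborel)"
    by (subst nn_integral_slices[OF s B]) (simp_all only: slice_inner[OF s B], measurable)
  also have "\<dots> = (\<integral>\<^sup>+u. (\<integral>\<^sup>+v. F v \<partial>hyperplane_measure s u) * h u \<partial>lborel)"
    by (intro nn_integral_cong, subst nn_integral_multc)
       (auto simp: hyperplane_measure_def B_def[symmetric] nn_integral_distr)
  finally show ?thesis ..
qed

section \<open>The uniform law on the sphere\<close>

definition uniform_sphere :: "'a::euclidean_space measure" where
  "uniform_sphere = scale_measure (ennreal (1 / sphere_area DIM('a))) sphere_measure"

lemma sphere_area_pos: "0 < d \<Longrightarrow> 0 < sphere_area d"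
  by (simp add: sphere_area_def)

lemma space_sphere_measure[simp]: "space sphere_measure = sphere 0 1"
  by (simp add: sphere_measure_def space_scale_measure space_restrict_space)

lemma sets_sphere_measure[measurable_cong]: "sets sphere_measure = sets (restrict_space borel (sphere 0 1))"
  by (simp add: sphere_measure_def)

lemma space_uniform_sphere[simp]: "space uniform_sphere = sphere 0 1"
  by (simp add: uniform_sphere_def space_scale_measure)

lemma sets_uniform_sphere[measurable_cong]: "sets uniform_sphere = sets (restrict_space borel (sphere 0 1))"
  by (simp add: uniform_sphere_def sets_sphere_measure)

lemma measurable_fst_sphere[measurable]:
  "fst \<in> borel_measurable (sphere_measure \<Otimes>\<^sub>M N)" "fst \<in> borel_measurable (uniform_sphere \<Otimes>\<^sub>M N)"
proof -
  have id: "(\<lambda>s. s) \<in> borel_measurable (restrict_space borel (sphere 0 1))"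
    by (rule measurable_restrict_space1) simp
  show "fst \<in> borel_measurable (sphere_measure \<Otimes>\<^sub>M N)"
    using id by (intro measurable_compose[OF measurable_fst]) (simp cong: measurable_cong_sets add: sets_sphere_measure)
  show "fst \<in> borel_measurable (uniform_sphere \<Otimes>\<^sub>M N)"
    using id by (intro measurable_compose[OF measurable_fst]) (simp cong: measurable_cong_sets add: sets_uniform_sphere)
qed

lemma borel_measurable_sgn_euclidean[measurable]:
  "(sgn :: 'a::euclidean_space \<Rightarrow> 'a) \<in> borel_measurable borel"
  unfolding sgn_div_norm[abs_def] by measurable

lemma sgn_measurable_sphere:
  "sgn \<in> restrict_space lborel (ball 0 1 - {0}) \<rightarrow>\<^sub>M restrict_space borel (sphere (0::'a::euclidean_space) 1)"
proof (rule measurable_restrict_space2)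
  show "sgn \<in> space (restrict_space lborel (ball 0 1 - {0})) \<rightarrow> sphere (0::'a) 1"
    by (auto simp: space_restrict_space norm_sgn)
  show "sgn \<in> restrict_space lborel (ball 0 1 - {0}) \<rightarrow>\<^sub>M (borel :: 'a measure)"
    by (intro measurable_restrict_space1) simp
qed

text \<open>The functional equation of Gamma. It reconciles \<open>sphere_measure\<close>, which is
  defined through the ball, with the closed form \<open>sphere_area\<close>.\<close>

lemma DIM_unit_ball_vol:
  "real DIM('a::euclidean_space) * unit_ball_vol (real DIM('a)) = sphere_area DIM('a)"
proof -
  have "real DIM('a) / 2 \<notin> \<int>\<^sub>\<le>\<^sub>0" using nonpos_Ints_nonpos[of "real DIM('a) / 2"] by auto
  then have G: "Gamma (real DIM('a) / 2 + 1) = real DIM('a) / 2 * Gamma (real DIM('a) / 2)"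
    using Gamma_plus1[of "real DIM('a) / 2"] by simp
  show ?thesis unfolding unit_ball_vol_def sphere_area_def G by simp
qed

lemma emeasure_sphere_measure:
  "emeasure (sphere_measure :: 'a::euclidean_space measure) (sphere 0 1) = ennreal (sphere_area DIM('a))"
proof -
  have "emeasure (sphere_measure :: 'a measure) (sphere 0 1)
     = of_nat DIM('a) * emeasure (restrict_space lborel (ball 0 1 - {0::'a})) (sgn -` sphere 0 1 \<inter> (ball 0 1 - {0}))"
    unfolding sphere_measure_def
    by (subst emeasure_scale_measure, subst emeasure_distr[OF sgn_measurable_sphere])
       (auto simp: sets_restrict_space space_restrict_space)
  also have "sgn -` sphere (0::'a) 1 \<inter> (ball 0 1 - {0}) = ball 0 1 - {0}"
    by (auto simp: norm_sgn)
  also have "emeasure (restrict_space lborel (ball 0 1 - {0::'a})) (ball 0 1 - {0}) = emeasure lborel (ball (0::'a) 1 - {0})"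
    by (subst emeasure_restrict_space) auto
  also have "\<dots> = unit_ball_vol (real DIM('a))"
    by (subst emeasure_Diff) (auto simp: emeasure_ball)
  also have "of_nat DIM('a) * ennreal (unit_ball_vol (real DIM('a))) = ennreal (sphere_area DIM('a))"
    by (simp add: ennreal_of_nat_eq_real_of_nat DIM_unit_ball_vol flip: ennreal_mult)
  finally show ?thesis .
qed

lemma prob_space_uniform_sphere: "prob_space (uniform_sphere :: 'a::euclidean_space measure)"
proof
  show "emeasure (uniform_sphere :: 'a measure) (space uniform_sphere) = 1"
    using sphere_area_pos[of "DIM('a)"]
    by simp (simp add: uniform_sphere_def emeasure_sphere_measure flip: ennreal_mult)
qed

lemma finite_sphere_measure: "finite_measure (sphere_measure :: 'a::euclidean_space measure)"
  by (rule finite_measureI) (simp add: emeasure_sphere_measure)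

lemma prob_densityD:
  assumes "prob_density f"
  shows "f \<in> borel_measurable borel" "0 \<le> f y" "integrable lborel f" "(\<integral>y. f y \<partial>lborel) = 1"
    "prob_space (density lborel (\<lambda>y. ennreal (f y)))"
proof -
  show m[measurable]: "f \<in> borel_measurable borel" and nn: "0 \<le> f y" for y
    using assms by (auto simp: prob_density_def)
  have 1: "(\<integral>\<^sup>+y. ennreal (f y) \<partial>lborel) = 1"
    using assms by (auto simp: prob_density_def)
  show "integrable lborel f"
    using 1 nn by (intro integrableI_nonneg) auto
  show "(\<integral>y. f y \<partial>lborel) = 1"
    using 1 nn by (simp add: integral_eq_nn_integral)
  show "prob_space (density lborel (\<lambda>y. ennreal (f y)))"
    using 1 by (intro prob_spaceI) (simp add: emeasure_density)
qed

section \<open>The Radon transform as a conditional density\<close>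

lemma radon_transform_slab:
  fixes s :: "'a::euclidean_space" and f :: "'a \<Rightarrow> real"
  assumes s: "norm s = 1" and [measurable]: "f \<in> borel_measurable borel"
  shows "radon_transform f s u
    = (\<integral>y. indicator {0..1} (y \<bullet> s) * f (u *\<^sub>R s + (y - (y \<bullet> s) *\<^sub>R s)) \<partial>lborel)"
proof -
  have "radon_transform f s u
    = (\<integral>y. f (u *\<^sub>R s + (y - (y \<bullet> s) *\<^sub>R s)) \<partial>density lborel (\<lambda>y. ennreal (indicator {0..1} (y \<bullet> s))))"
    unfolding radon_transform_def hyperplane_measure_slab[OF s]
    by (subst integral_distr) (auto simp: ennreal_indicator)
  also have "\<dots> = (\<integral>y. indicator {0..1} (y \<bullet> s) * f (u *\<^sub>R s + (y - (y \<bullet> s) *\<^sub>R s)) \<partial>lborel)"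
    by (subst integral_density) (auto simp: comp_def)
  finally show ?thesis .
qed

lemma radon_transform_measurable:
  fixes f :: "'a::euclidean_space \<Rightarrow> real"
  assumes [measurable]: "f \<in> borel_measurable borel"
  shows "(\<lambda>(s, u). radon_transform f s u) \<in> borel_measurable (sphere_measure \<Otimes>\<^sub>M lborel)"
proof -
  have "(\<lambda>p. \<integral>y. indicator {0..1} (y \<bullet> fst p) * f (snd p *\<^sub>R fst p + (y - (y \<bullet> fst p) *\<^sub>R fst p)) \<partial>lborel)
    \<in> borel_measurable (sphere_measure \<Otimes>\<^sub>M (lborel :: real measure))"
    by measurable
  then show ?thesis
    by (rule measurable_cong[THEN iffD1, rotated])
       (auto simp: space_pair_measure radon_transform_slab)
qed

text \<open>For a fixed direction, slicing shows that the Radon transform is the density of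
  \<open>v \<bullet> s\<close> when \<open>v\<close> has density \<open>f\<close>; mixing over
  uniform directions gives the joint law. Expectations over observations thereby become integrals
  against \<open>f\<close>, where Fubini is available.\<close>

lemma radon_law_eq_distr:
  fixes f :: "'a::euclidean_space \<Rightarrow> real"
  assumes f: "prob_density f"
  shows "radon_law f = distr (uniform_sphere \<Otimes>\<^sub>M density lborel (\<lambda>y. ennreal (f y)))
    (sphere_measure \<Otimes>\<^sub>M lborel) (\<lambda>(s, v). (s, v \<bullet> s))"
    (is "_ = distr (_ \<Otimes>\<^sub>M ?D) _ _")
proof (rule measure_eqI)
  let ?R = "distr (uniform_sphere \<Otimes>\<^sub>M ?D) (sphere_measure \<Otimes>\<^sub>M lborel) (\<lambda>(s, v). (s, v \<bullet> s))"
  note prob_densityD[OF f, measurable]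
  interpret D: prob_space ?D by (rule prob_densityD[OF f])
  let ?\<rho> = "sphere_area DIM('a)"
  have \<rho>: "0 < ?\<rho>" by (simp add: sphere_area_pos)
  note radon_transform_measurable[OF prob_densityD(1)[OF f], measurable]
  fix A assume "A \<in> sets (radon_law f)"
  then have A[measurable]: "A \<in> sets (sphere_measure \<Otimes>\<^sub>M lborel)" by (simp add: radon_law_def)
  have "emeasure (radon_law f) A
    = (\<integral>\<^sup>+s. \<integral>\<^sup>+u. ennreal (radon_transform f s u / ?\<rho>) * indicator A (s, u) \<partial>lborel \<partial>sphere_measure)"
    unfolding radon_law_def
    by (subst emeasure_density[OF _ A], measurable, subst lborel.nn_integral_fst[symmetric], measurable)
  also have "\<dots> = (\<integral>\<^sup>+s. ennreal (1 / ?\<rho>) * (\<integral>\<^sup>+v. ennreal (f v) * indicator A (s, v \<bullet> s) \<partial>lborel) \<partial>sphere_measure)"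
  proof (rule nn_integral_cong)
    fix s :: 'a assume "s \<in> space sphere_measure"
    then have s: "norm s = 1" by simp
    have h[measurable]: "(\<lambda>u. indicator A (s, u) :: ennreal) \<in> borel_measurable borel"
      using measurable_compose[OF measurable_Pair1'[OF \<open>s \<in> space sphere_measure\<close>, of lborel]
          borel_measurable_indicator[OF A]]
      by simp
    let ?N = "\<lambda>u. \<integral>\<^sup>+v. ennreal (f v) \<partial>hyperplane_measure s u"
    have "(\<integral>\<^sup>+u. ?N u * 1 \<partial>lborel) = (\<integral>\<^sup>+v. ennreal (f v) * 1 \<partial>lborel)"
      by (rule nn_integral_hyperplane_measure[OF s]) auto
    then have N1: "(\<integral>\<^sup>+u. ?N u \<partial>lborel) = 1" using f by (simp add: prob_density_def)
    have sh: "sets (hyperplane_measure s u) = sets borel" for u by (simp add: hyperplane_measure_slab[OF s])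
    have Nm: "?N \<in> borel_measurable lborel"
      unfolding hyperplane_measure_slab[OF s] by (simp add: nn_integral_distr nn_integral_density)
    \<comment> \<open>Where the hyperplane integral of \<open>f\<close> diverges,
      \<open>radon_transform\<close> takes the default value 0 of the Bochner integral. Total mass 1
      confines this to a null set of offsets.\<close>
    have "AE u in lborel. ?N u \<noteq> \<infinity>"
      by (rule nn_integral_noteq_infinite[OF Nm]) (simp add: N1)
    then have "AE u in lborel. ennreal (radon_transform f s u / ?\<rho>) = ennreal (1 / ?\<rho>) * ?N u"
    proof eventually_elim
      case (elim u)
      then have "integrable (hyperplane_measure s u) f"
        using prob_densityD[OF f] by (intro integrableI_nonneg) (auto simp: sh less_top cong: measurable_cong_sets)
      then have "ennreal (radon_transform f s u) = ?N u"
        unfolding radon_transform_def using prob_densityD[OF f]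
        by (intro nn_integral_eq_integral[symmetric]) auto
      then show ?case using \<rho>
        by (metis divide_inverse divide_real_def ennreal_mult' inverse_eq_divide less_imp_le mult.commute zero_le_divide_1_iff)
    qed
    then have "(\<integral>\<^sup>+u. ennreal (radon_transform f s u / ?\<rho>) * indicator A (s, u) \<partial>lborel)
      = (\<integral>\<^sup>+u. ennreal (1 / ?\<rho>) * (?N u * indicator A (s, u)) \<partial>lborel)"
      by (intro nn_integral_cong_AE) (auto simp: mult.assoc)
    also have "\<dots> = ennreal (1 / ?\<rho>) * (\<integral>\<^sup>+u. ?N u * indicator A (s, u) \<partial>lborel)"
      using Nm h by (intro nn_integral_cmult borel_measurable_times_ennreal) simp_all
    also have "(\<integral>\<^sup>+u. ?N u * indicator A (s, u) \<partial>lborel) = (\<integral>\<^sup>+v. ennreal (f v) * indicator A (s, v \<bullet> s) \<partial>lborel)"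
      by (rule nn_integral_hyperplane_measure[OF s]) auto
    finally show "(\<integral>\<^sup>+u. ennreal (radon_transform f s u / ?\<rho>) * indicator A (s, u) \<partial>lborel)
      = ennreal (1 / ?\<rho>) * (\<integral>\<^sup>+v. ennreal (f v) * indicator A (s, v \<bullet> s) \<partial>lborel)" .
  qed
  also have "\<dots> = ennreal (1 / ?\<rho>) * (\<integral>\<^sup>+s. \<integral>\<^sup>+v. ennreal (f v) * indicator A (s, v \<bullet> s) \<partial>lborel \<partial>sphere_measure)"
    by (rule nn_integral_cmult) measurable
  also have "\<dots> = (\<integral>\<^sup>+s. \<integral>\<^sup>+v. indicator A (s, v \<bullet> s) \<partial>?D \<partial>uniform_sphere)"
    unfolding uniform_sphere_def
    by (subst nn_integral_scale_measure) (auto simp: nn_integral_density intro!: arg_cong2[where f="(*)"] nn_integral_cong)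
  also have "\<dots> = (\<integral>\<^sup>+p. indicator A (fst p, snd p \<bullet> fst p) \<partial>(uniform_sphere \<Otimes>\<^sub>M ?D))"
    by (subst D.nn_integral_fst[symmetric]) auto
  also have "\<dots> = (\<integral>\<^sup>+p. indicator A p \<partial>?R)"
    by (subst nn_integral_distr, measurable) (simp add: case_prod_beta)
  also have "\<dots> = emeasure ?R A"
    by (rule nn_integral_indicator) (simp only: sets_distr A)
  finally show "emeasure (radon_law f) A = emeasure ?R A" .
qed (simp add: radon_law_def)

section \<open>Polar coordinates\<close>

definition radial_measure :: "nat \<Rightarrow> real measure" where
  "radial_measure d = density lborel (\<lambda>r. ennreal (indicator {0<..} r * r ^ (d - 1)))"

lemma sets_radial_measure[simp, measurable_cong]: "sets (radial_measure d) = sets borel"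
  by (simp add: radial_measure_def)

lemma space_radial_measure[simp]: "space (radial_measure d) = UNIV"
  by (simp add: radial_measure_def)

lemma emeasure_radial_measure:
  assumes "0 < d"
  shows "emeasure (radial_measure d) {..<x} = ennreal (max 0 x ^ d / real d)"
proof (cases "0 < x")
  case True
  have "emeasure (radial_measure d) {..<x} = (\<integral>\<^sup>+r. ennreal (r ^ (d - 1)) * indicator {0..x} r \<partial>lborel)"
    unfolding radial_measure_def
  proof (subst emeasure_density)
    show "(\<integral>\<^sup>+ r. ennreal (indicator {0<..} r * r ^ (d - 1)) * indicator {..<x} r \<partial>lborel)
       = (\<integral>\<^sup>+r. ennreal (r ^ (d - 1)) * indicator {0..x} r \<partial>lborel)"
      by (intro nn_integral_cong_AE) (use AE_lborel_singleton[of 0] AE_lborel_singleton[of x] in eventually_elim, auto simp: indicator_def)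
  qed simp_all
  also have "\<dots> = ennreal (x ^ d / real d - 0 ^ d / real d)"
  proof (rule nn_integral_FTC_Icc)
    fix r :: real
    show "DERIV (\<lambda>r. r ^ d / real d) r :> r ^ (d - 1)"
      using assms by (auto intro!: derivative_eq_intros)
  qed (use True in auto)
  finally show ?thesis using assms True by (simp add: max_def zero_power)
next
  case False
  have "emeasure (radial_measure d) {..<x} = (\<integral>\<^sup>+r. 0 \<partial>(lborel :: real measure))"
    unfolding radial_measure_def
    by (subst emeasure_density, simp, simp, intro nn_integral_cong) (use False in \<open>auto simp: indicator_def\<close>)
  then show ?thesis using False assms by (simp add: max_def)
qed

lemma sigma_finite_radial_measure:
  assumes "0 < d"
  shows "sigma_finite_measure (radial_measure d)"
proof
  show "\<exists>A. countable A \<and> A \<subseteq> sets (radial_measure d) \<and> \<Union> A = space (radial_measure d) \<and>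
      (\<forall>a\<in>A. emeasure (radial_measure d) a \<noteq> \<infinity>)"
  proof (intro exI[of _ "range (\<lambda>n::nat. {..<real n})"] conjI)
    show "\<Union> (range (\<lambda>n::nat. {..<real n})) = space (radial_measure d)"
      by (auto intro: reals_Archimedean2)
  qed (auto simp: emeasure_radial_measure[OF assms])
qed

text \<open>Scaling by \<open>x\<close> carries the cone of radius 1 to the cone of radius
  \<open>x\<close> and multiplies volumes by x^d; the cone of radius 1 is what defines
  \<open>sphere_measure\<close>.\<close>

lemma emeasure_cone:
  fixes A :: "'a::euclidean_space set"
  assumes A: "A \<in> sets (restrict_space borel (sphere 0 1))"
  shows "emeasure lborel {t. t \<noteq> 0 \<and> sgn t \<in> A \<and> norm t < x}
    = emeasure sphere_measure A * ennreal (max 0 x ^ DIM('a) / real DIM('a))"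
proof (cases "0 < x")
  case False
  then have "{t. t \<noteq> 0 \<and> sgn t \<in> A \<and> norm t < x} = {}"
    using norm_ge_zero le_less_trans by blast
  moreover have "max 0 x ^ DIM('a) / real DIM('a) = 0" using False by (simp add: max_def)
  ultimately show ?thesis by (simp only: emeasure_empty ennreal_0 mult_zero_right)
next
  case True
  have A'[measurable]: "A \<in> sets borel"
    using A by (auto simp: sets_restrict_space)
  let ?S = "\<lambda>x. {t::'a. t \<noteq> 0 \<and> sgn t \<in> A \<and> norm t < x}"
  have S[measurable]: "?S x \<in> sets borel" for x by measurable
  have "emeasure lborel (?S x) = (\<integral>\<^sup>+t. indicator (?S x) t \<partial>density (distr lborel borel (\<lambda>y. 0 + x *\<^sub>R y)) (\<lambda>_. ennreal (\<bar>x\<bar> ^ DIM('a))))"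
    using True by (subst lborel_affine[symmetric]) auto
  also have "\<dots> = ennreal (x ^ DIM('a)) * (\<integral>\<^sup>+y. indicator (?S x) (x *\<^sub>R y) \<partial>lborel)"
    using True by (simp add: nn_integral_density nn_integral_distr nn_integral_cmult del: nn_integral_indicator)
  also have "(\<integral>\<^sup>+y. indicator (?S x) (x *\<^sub>R y) \<partial>lborel) = (\<integral>\<^sup>+y. indicator (?S 1) y \<partial>lborel)"
    using True by (intro nn_integral_cong) (auto simp: indicator_def sgn_scaleR)
  also have "\<dots> = emeasure lborel (?S 1)" by simp
  finally have S: "emeasure lborel (?S x) = ennreal (x ^ DIM('a)) * emeasure lborel (?S 1)" .
  have "emeasure sphere_measure A = of_nat DIM('a) * emeasure lborel (?S 1)"
  proof -
    have "emeasure sphere_measure A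
       = of_nat DIM('a) * emeasure (restrict_space lborel (ball 0 1 - {0::'a})) (sgn -` A \<inter> (ball 0 1 - {0}))"
      unfolding sphere_measure_def
      by (subst emeasure_scale_measure, subst emeasure_distr[OF sgn_measurable_sphere])
         (use A in \<open>auto simp: space_restrict_space\<close>)
    also have "sgn -` A \<inter> (ball 0 1 - {0}) = ?S 1" by auto
    also have "emeasure (restrict_space lborel (ball 0 1 - {0::'a})) (?S 1) = emeasure lborel (?S 1)"
      by (subst emeasure_restrict_space) auto
    finally show ?thesis .
  qed
  then have "emeasure sphere_measure A * ennreal (max 0 x ^ DIM('a) / real DIM('a))
    = (of_nat DIM('a) * ennreal (x ^ DIM('a) / real DIM('a))) * emeasure lborel (?S 1)"
    using True by (simp add: max_def mult_ac)
  also have "of_nat DIM('a) * ennreal (x ^ DIM('a) / real DIM('a)) = ennreal (x ^ DIM('a))"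
    using True by (simp add: ennreal_of_nat_eq_real_of_nat flip: ennreal_mult)
  finally show ?thesis using S by simp
qed

text \<open>For fixed \<open>A\<close> both sides are measures in \<open>B\<close>. They agree on
  the half-lines \<open>{..<x}\<close> by \<open>emeasure_cone\<close>, and these form an
  intersection-stable generator on which both are finite.\<close>

lemma cone_measure_eq:
  fixes A :: "'a::euclidean_space set"
  assumes A: "A \<in> sets (restrict_space borel (sphere 0 1))" and B: "B \<in> sets borel"
  shows "emeasure lborel {t. t \<noteq> 0 \<and> sgn t \<in> A \<and> norm t \<in> B}
    = emeasure sphere_measure A * emeasure (radial_measure DIM('a)) B"
proof -
  have A'[measurable]: "A \<in> sets borel"
    using A by (auto simp: sets_restrict_space)
  define M where "M = distr (density lborel (indicator {t::'a. t \<noteq> 0 \<and> sgn t \<in> A})) borel norm"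
  define N where "N = scale_measure (emeasure sphere_measure A) (radial_measure DIM('a))"
  have M: "emeasure M C = emeasure lborel {t. t \<noteq> 0 \<and> sgn t \<in> A \<and> norm t \<in> C}" if [measurable]: "C \<in> sets borel" for C
  proof -
    have "emeasure M C = (\<integral>\<^sup>+t. indicator {t. t \<noteq> 0 \<and> sgn t \<in> A} t * indicator {t. norm t \<in> C} t \<partial>lborel)"
      unfolding M_def by (subst emeasure_distr, simp, simp, subst emeasure_density, measurable)
        (auto intro!: nn_integral_cong simp: indicator_def)
    also have "\<dots> = (\<integral>\<^sup>+t. indicator {t. t \<noteq> 0 \<and> sgn t \<in> A \<and> norm t \<in> C} t \<partial>lborel)"
      by (intro nn_integral_cong) (auto simp: indicator_def)
    also have "\<dots> = emeasure lborel {t. t \<noteq> 0 \<and> sgn t \<in> A \<and> norm t \<in> C}"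
      by (rule nn_integral_indicator) measurable
    finally show ?thesis .
  qed
  have "emeasure sphere_measure A < \<infinity>"
    using finite_measure.emeasure_finite[OF finite_sphere_measure, of A] by (simp add: less_top)
  then have fin: "emeasure M {..<x} < \<infinity>" for x
    by (subst M) (auto simp: emeasure_cone[OF A] ennreal_mult_less_top)
  have "M = N"
  proof (rule measure_eqI_generator_eq[where E="range lessThan" and A="\<lambda>n::nat. {..<real n}" and \<Omega>=UNIV])
    show "Int_stable (range (lessThan :: real \<Rightarrow> _))"
    proof -
      have "{..<a} \<inter> {..<b} = {..<min a b}" for a b :: real by auto
      then show ?thesis by (auto simp: Int_stable_def)
    qed
    show "sets M = sigma_sets UNIV (range lessThan)" "sets N = sigma_sets UNIV (range lessThan)"
    proof -
      have "sets (borel :: real measure) = sigma_sets UNIV (range lessThan)"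
        by (subst borel_Iio) simp
      then show "sets M = sigma_sets UNIV (range lessThan)" "sets N = sigma_sets UNIV (range lessThan)"
        by (simp_all add: M_def N_def)
    qed
    show "emeasure M X = emeasure N X" if "X \<in> range lessThan" for X
      using that by (auto simp: M emeasure_cone[OF A] N_def emeasure_radial_measure)
    show "(\<Union>i::nat. {..<real i}) = UNIV" by (auto intro: reals_Archimedean2)
    show "emeasure M {..<real i} \<noteq> \<infinity>" for i using fin[of "real i"] by simp
  qed auto
  then have "emeasure M B = emeasure N B" by simp
  then show ?thesis by (simp add: M[OF B] N_def)
qed

text \<open>Agreement on rectangles is \<open>cone_measure_eq\<close>, and sigma-finiteness extends
  it to the product. The origin is removed because \<open>sgn 0 = 0\<close> lies off the
  sphere.\<close>

lemma polar_measure: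
  "distr (restrict_space lborel (- {0})) (sphere_measure \<Otimes>\<^sub>M radial_measure DIM('a)) (\<lambda>t. (sgn t, norm t))
    = (sphere_measure \<Otimes>\<^sub>M radial_measure DIM('a::euclidean_space) :: ('a \<times> real) measure)"
  and measurable_polar:
  "(\<lambda>t::'a. (sgn t, norm t)) \<in> restrict_space lborel (- {0}) \<rightarrow>\<^sub>M sphere_measure \<Otimes>\<^sub>M radial_measure DIM('a)"
proof -
  have "sgn \<in> restrict_space lborel (- {0}) \<rightarrow>\<^sub>M restrict_space borel (sphere (0::'a) 1)"
  proof (rule measurable_restrict_space2)
    show "sgn \<in> space (restrict_space lborel (- {0})) \<rightarrow> sphere (0::'a) 1"
      by (auto simp: space_restrict_space norm_sgn)
    show "sgn \<in> restrict_space lborel (- {0}) \<rightarrow>\<^sub>M (borel :: 'a measure)"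
      by (intro measurable_restrict_space1) simp
  qed
  then have s: "sgn \<in> restrict_space lborel (- {0}) \<rightarrow>\<^sub>M (sphere_measure :: 'a measure)"
    by (simp cong: measurable_cong_sets add: sets_sphere_measure)
  have n: "norm \<in> restrict_space lborel (- {0::'a}) \<rightarrow>\<^sub>M radial_measure DIM('a)"
    by (intro measurable_restrict_space1) (simp cong: measurable_cong_sets)
  show m: "(\<lambda>t::'a. (sgn t, norm t)) \<in> restrict_space lborel (- {0}) \<rightarrow>\<^sub>M sphere_measure \<Otimes>\<^sub>M radial_measure DIM('a)"
    by (rule measurable_Pair[OF s n])
  interpret S: finite_measure "sphere_measure :: 'a measure" by (rule finite_sphere_measure)
  show "distr (restrict_space lborel (- {0})) (sphere_measure \<Otimes>\<^sub>M radial_measure DIM('a)) (\<lambda>t. (sgn t, norm t))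
    = (sphere_measure \<Otimes>\<^sub>M radial_measure DIM('a) :: ('a \<times> real) measure)" (is "?M = _")
  proof (rule pair_measure_eqI[symmetric])
    show "sigma_finite_measure (sphere_measure :: 'a measure)" by (rule S.sigma_finite_measure_axioms)
    show "sigma_finite_measure (radial_measure DIM('a))" by (rule sigma_finite_radial_measure) simp
    show "sets (sphere_measure \<Otimes>\<^sub>M radial_measure DIM('a)) = sets ?M" by simp
    fix A :: "'a set" and B assume A: "A \<in> sets sphere_measure" and B: "B \<in> sets (radial_measure DIM('a))"
    then have [measurable]: "B \<in> sets borel" by simp
    have A1: "A \<in> sets (restrict_space borel (sphere 0 1))" using A by (simp add: sets_sphere_measure)
    then have A'[measurable]: "A \<in> sets borel" by (auto simp: sets_restrict_space)
    have "emeasure ?M (A \<times> B) = emeasure (restrict_space lborel (- {0})) {t. t \<noteq> 0 \<and> sgn t \<in> A \<and> norm t \<in> B}"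
      by (subst emeasure_distr[OF m]) (use A B in \<open>auto intro!: arg_cong2[where f=emeasure] simp: space_restrict_space\<close>)
    also have "\<dots> = emeasure lborel {t. t \<noteq> 0 \<and> sgn t \<in> A \<and> norm t \<in> B}"
      by (subst emeasure_restrict_space) auto
    finally show "emeasure sphere_measure A * emeasure (radial_measure DIM('a)) B = emeasure ?M (A \<times> B)"
      by (simp add: cone_measure_eq[OF A1])
  qed
qed

text \<open>Off the origin, a null set, recombining direction and length gives back the
  point.\<close>

lemma lborel_polar:
  "(lborel :: 'a::euclidean_space measure)
    = distr (sphere_measure \<Otimes>\<^sub>M radial_measure DIM('a)) borel (\<lambda>(s, r). r *\<^sub>R s)" (is "_ = ?R")
proof (rule measure_eqI)
  fix B :: "'a set" assume "B \<in> sets lborel"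
  then have B[measurable]: "B \<in> sets borel" by simp
  have m: "(\<lambda>(s, r). r *\<^sub>R s) \<in> (sphere_measure \<Otimes>\<^sub>M radial_measure DIM('a)) \<rightarrow>\<^sub>M (borel :: 'a measure)"
    by (simp add: case_prod_beta)
  have "emeasure ?R B = emeasure (distr (distr (restrict_space lborel (- {0})) (sphere_measure \<Otimes>\<^sub>M radial_measure DIM('a)) (\<lambda>t. (sgn t, norm t))) borel (\<lambda>(s, r). r *\<^sub>R s)) B"
    by (simp only: polar_measure)
  also have "\<dots> = emeasure (distr (restrict_space lborel (- {0})) borel (\<lambda>t. t)) B"
    by (subst distr_distr[OF m measurable_polar])
       (auto simp: comp_def sgn_div_norm space_restrict_space intro!: arg_cong2[where f=emeasure] distr_cong)
  also have "\<dots> = emeasure lborel (B - {0})"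
    by (subst emeasure_distr) (auto simp: space_restrict_space emeasure_restrict_space Diff_eq
        intro: measurable_restrict_space1)
  also have "\<dots> = emeasure lborel B"
    by (rule emeasure_Diff_null_set) auto
  finally show "emeasure lborel B = emeasure ?R B" ..
qed simp

lemma nn_integral_polar:
  fixes h :: "real \<Rightarrow> ennreal"
  assumes [measurable]: "h \<in> borel_measurable borel"
  shows "(\<integral>\<^sup>+t. h (norm t) \<partial>(lborel :: 'a::euclidean_space measure))
    = ennreal (sphere_area DIM('a)) * (\<integral>\<^sup>+r. ennreal (indicator {0<..} r * r ^ (DIM('a) - 1)) * h r \<partial>lborel)"
proof -
  interpret R: sigma_finite_measure "radial_measure DIM('a)" by (rule sigma_finite_radial_measure) simp
  have "(\<integral>\<^sup>+t. h (norm t) \<partial>(lborel :: 'a measure))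
     = (\<integral>\<^sup>+p. h (norm (snd p *\<^sub>R fst p)) \<partial>(sphere_measure \<Otimes>\<^sub>M radial_measure DIM('a) :: ('a \<times> real) measure))"
    by (subst lborel_polar, subst nn_integral_distr) (auto simp: case_prod_beta)
  also have "\<dots> = (\<integral>\<^sup>+s. \<integral>\<^sup>+r. h (norm (r *\<^sub>R s)) \<partial>radial_measure DIM('a) \<partial>(sphere_measure :: 'a measure))"
    by (subst R.nn_integral_fst[symmetric]) auto
  also have "\<dots> = (\<integral>\<^sup>+s. (\<integral>\<^sup>+r. ennreal (indicator {0<..} r * r ^ (DIM('a) - 1)) * h r \<partial>lborel) \<partial>(sphere_measure :: 'a measure))"
    by (intro nn_integral_cong) (auto simp: radial_measure_def nn_integral_density indicator_def intro!: nn_integral_cong)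
  also have "\<dots> = ennreal (sphere_area DIM('a)) * (\<integral>\<^sup>+r. ennreal (indicator {0<..} r * r ^ (DIM('a) - 1)) * h r \<partial>lborel)"
    by (simp add: emeasure_sphere_measure mult.commute)
  finally show ?thesis .
qed

lemma integral_uniform_sphere:
  fixes h :: "'a::euclidean_space \<Rightarrow> real"
  assumes [measurable]: "h \<in> borel_measurable sphere_measure"
  shows "integral\<^sup>L uniform_sphere h = integral\<^sup>L sphere_measure h / sphere_area DIM('a)"
proof -
  have *: "uniform_sphere = density (sphere_measure :: 'a measure) (\<lambda>_. ennreal (1 / sphere_area DIM('a)))"
    unfolding uniform_sphere_def
    by (rule measure_eqI) (auto simp: emeasure_density nn_integral_cmult)
  show ?thesis
    unfolding * using sphere_area_pos[of "DIM('a)"] by (subst integral_density) auto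
qed

text \<open>In polar coordinates the volume element r^(d-1) cancels the denominator of
  \<open>q\<close>. A cosine transform on the half-line, averaged over directions, is thus a cosine
  transform on the whole space; this is how a kernel on the real line comes to act as a
  d-dimensional Fourier multiplier.\<close>

lemma radial_cosine_transform:
  fixes w :: "real \<Rightarrow> real" and z :: "'a::euclidean_space"
  assumes [measurable]: "w \<in> borel_measurable borel" and int: "integrable lborel (\<lambda>r. indicator {0<..} r * w r)"
  defines "q \<equiv> \<lambda>r. w r / r ^ (DIM('a) - 1)"
  shows "integrable lborel (\<lambda>t::'a. q (norm t))"
    and "(\<integral>s. (\<integral>r. indicator {0<..} r * w r * cos ((s \<bullet> z) * r) \<partial>lborel) \<partial>uniform_sphere)
      = (\<integral>t. q (norm t) * cos (t \<bullet> z) \<partial>lborel) / sphere_area DIM('a)"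
proof -
  have [measurable]: "q \<in> borel_measurable borel" by (simp add: q_def)
  interpret S: finite_measure "sphere_measure :: 'a measure" by (rule finite_sphere_measure)
  interpret R: sigma_finite_measure "radial_measure DIM('a)" by (rule sigma_finite_radial_measure) simp
  interpret SR: pair_sigma_finite "sphere_measure :: 'a measure" "radial_measure DIM('a)" ..
  have fin: "(\<integral>\<^sup>+r. ennreal (indicator {0<..} r * \<bar>w r\<bar>) \<partial>lborel) < \<infinity>"
    using int by (simp add: integrable_iff_bounded abs_mult)
  have "(\<integral>\<^sup>+t. ennreal \<bar>q (norm t)\<bar> \<partial>(lborel :: 'a measure))
     = ennreal (sphere_area DIM('a)) * (\<integral>\<^sup>+r. ennreal (indicator {0<..} r * r ^ (DIM('a) - 1)) * ennreal \<bar>q r\<bar> \<partial>lborel)"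
    by (rule nn_integral_polar) measurable
  also have "(\<integral>\<^sup>+r. ennreal (indicator {0<..} r * r ^ (DIM('a) - 1)) * ennreal \<bar>q r\<bar> \<partial>lborel)
     = (\<integral>\<^sup>+r. ennreal (indicator {0<..} r * \<bar>w r\<bar>) \<partial>lborel)"
    by (intro nn_integral_cong) (auto simp: q_def indicator_def abs_divide simp flip: ennreal_mult)
  finally have "(\<integral>\<^sup>+t. ennreal \<bar>q (norm t)\<bar> \<partial>(lborel :: 'a measure)) < \<infinity>"
    using fin by (simp add: ennreal_mult_less_top)
  then show qint: "integrable lborel (\<lambda>t::'a. q (norm t))"
    by (simp add: integrable_iff_bounded)
  have qint': "integrable lborel (\<lambda>t::'a. q (norm t) * cos (t \<bullet> z))"
    by (rule Bochner_Integration.integrable_bound[OF qint]) (auto simp: abs_mult mult_left_le)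
  let ?h = "\<lambda>p::'a \<times> real. q (norm (snd p *\<^sub>R fst p)) * cos ((snd p *\<^sub>R fst p) \<bullet> z)"
  have m: "(\<lambda>(s, r). r *\<^sub>R s) \<in> (sphere_measure \<Otimes>\<^sub>M radial_measure DIM('a)) \<rightarrow>\<^sub>M (borel :: 'a measure)"
    by (simp add: case_prod_beta)
  have "integrable (distr (sphere_measure \<Otimes>\<^sub>M radial_measure DIM('a)) borel (\<lambda>(s, r). r *\<^sub>R s)) (\<lambda>t::'a. q (norm t) * cos (t \<bullet> z))"
    using qint' by (subst (asm) lborel_polar)
  then have hint: "integrable (sphere_measure \<Otimes>\<^sub>M radial_measure DIM('a)) ?h"
    by (subst (asm) integrable_distr_eq[OF m]) (auto simp: case_prod_beta)
  have "(\<integral>t. q (norm t) * cos (t \<bullet> z) \<partial>lborel) = integral\<^sup>L (sphere_measure \<Otimes>\<^sub>M radial_measure DIM('a)) ?h"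
    by (subst lborel_polar, subst integral_distr[OF m]) (auto simp: case_prod_beta)
  also have "\<dots> = (\<integral>s. (\<integral>r. ?h (s, r) \<partial>radial_measure DIM('a)) \<partial>sphere_measure)"
    by (rule SR.integral_fst'[symmetric, OF hint])
  also have "\<dots> = (\<integral>s. (\<integral>r. indicator {0<..} r * w r * cos ((s \<bullet> z) * r) \<partial>lborel) \<partial>sphere_measure)"
  proof (rule Bochner_Integration.integral_cong[OF refl])
    fix s :: 'a assume "s \<in> space sphere_measure"
    then have s: "norm s = 1" by simp
    have "(\<integral>r. ?h (s, r) \<partial>radial_measure DIM('a)) = (\<integral>r. (indicator {0<..} r * r ^ (DIM('a) - 1)) * ?h (s, r) \<partial>lborel)"
      unfolding radial_measure_def by (subst integral_density) (auto simp: indicator_def)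
    also have "\<dots> = (\<integral>r. indicator {0<..} r * w r * cos ((s \<bullet> z) * r) \<partial>lborel)"
      by (intro Bochner_Integration.integral_cong) (auto simp: indicator_def s q_def mult_ac)
    finally show "(\<integral>r. ?h (s, r) \<partial>radial_measure DIM('a)) = (\<integral>r. indicator {0<..} r * w r * cos ((s \<bullet> z) * r) \<partial>lborel)" .
  qed
  also have "\<dots> = sphere_area DIM('a) * (\<integral>s. (\<integral>r. indicator {0<..} r * w r * cos ((s \<bullet> z) * r) \<partial>lborel) \<partial>uniform_sphere)"
  proof -
    have "(\<lambda>s. \<integral>r. indicator {0<..} r * w r * cos ((s \<bullet> z) * r) \<partial>lborel) \<in> borel_measurable (sphere_measure :: 'a measure)"
      by measurable
    then show ?thesis using sphere_area_pos[of "DIM('a)"] by (simp add: integral_uniform_sphere)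
  qed
  finally show "(\<integral>s. (\<integral>r. indicator {0<..} r * w r * cos ((s \<bullet> z) * r) \<partial>lborel) \<partial>uniform_sphere)
      = (\<integral>t. q (norm t) * cos (t \<bullet> z) \<partial>lborel) / sphere_area DIM('a)"
    using sphere_area_pos[of "DIM('a)"] by simp
qed

section \<open>Fourier inversion\<close>

abbreviation char_fun :: "('a::euclidean_space \<Rightarrow> real) \<Rightarrow> 'a \<Rightarrow> complex" where
  "char_fun f \<equiv> fourier_integral (\<lambda>y. complex_of_real (f y))"

text \<open>The real part of \<open>exp (- i t \<bullet> x)\<close> times the Fourier transform; up to the factor
  \<open>(2 * pi) ^ d\<close> this is the integrand of the inversion formula for a real function.\<close>

definition inv_integrand :: "('a::euclidean_space \<Rightarrow> real) \<Rightarrow> 'a \<Rightarrow> 'a \<Rightarrow> real" where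
  "inv_integrand f x t = (\<integral>v. f v * cos (t \<bullet> (x - v)) \<partial>lborel)"

lemma cis_measurable[measurable]: "cis \<in> borel_measurable borel"
  by (intro borel_measurable_continuous_onI continuous_intros)

lemma char_fun_measurable[measurable]:
  assumes [measurable]: "f \<in> borel_measurable borel"
  shows "char_fun f \<in> borel_measurable borel"
  unfolding fourier_integral_def by measurable

lemma inv_integrand_measurable[measurable]:
  assumes [measurable]: "f \<in> borel_measurable borel"
  shows "(\<lambda>p. inv_integrand f (fst p) (snd p)) \<in> borel_measurable (borel \<Otimes>\<^sub>M borel)"
    and "inv_integrand f x \<in> borel_measurable borel"
    and "(\<lambda>x. inv_integrand f x t) \<in> borel_measurable borel"
  unfolding inv_integrand_def by measurable

lemma integrable_cis_mult:
  assumes "integrable lborel f"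
  shows "integrable lborel (\<lambda>v. cis (t \<bullet> v) * complex_of_real (f v))"
  by (rule Bochner_Integration.integrable_bound[OF assms])
     (use assms in \<open>auto simp: norm_mult dest!: borel_measurable_integrable\<close>)

lemma inv_integrand_eq:
  assumes "integrable lborel f"
  shows "inv_integrand f x t = Re (cis (- (t \<bullet> x)) * char_fun f t)"
proof -
  have i: "integrable lborel (\<lambda>v. cis (- (t \<bullet> x)) * (cis (t \<bullet> v) * complex_of_real (f v)))"
    using integrable_cis_mult[OF assms] by (rule integrable_mult_right)
  have "cis (- (t \<bullet> x)) * char_fun f t = (\<integral>v. cis (- (t \<bullet> x)) * (cis (t \<bullet> v) * complex_of_real (f v)) \<partial>lborel)"
    by (simp add: fourier_integral_def)
  then have "Re (cis (- (t \<bullet> x)) * char_fun f t)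
     = (\<integral>v. Re (cis (- (t \<bullet> x)) * (cis (t \<bullet> v) * complex_of_real (f v))) \<partial>lborel)"
    by (simp only: integral_bounded_linear[OF bounded_linear_Re i])
  also have "\<dots> = (\<integral>v. f v * cos (t \<bullet> (x - v)) \<partial>lborel)"
  proof (rule Bochner_Integration.integral_cong[OF refl])
    fix v
    have "cis (- (t \<bullet> x)) * (cis (t \<bullet> v) * complex_of_real (f v)) = cis (- (t \<bullet> (x - v))) * complex_of_real (f v)"
      by (simp only: mult.assoc[symmetric] cis_mult) (simp add: inner_diff_right)
    then show "Re (cis (- (t \<bullet> x)) * (cis (t \<bullet> v) * complex_of_real (f v))) = f v * cos (t \<bullet> (x - v))"
      by (simp only:) simp
  qed
  finally show ?thesis by (simp add: inv_integrand_def)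
qed

lemma abs_inv_integrand_le:
  assumes "integrable lborel f"
  shows "\<bar>inv_integrand f x t\<bar> \<le> cmod (char_fun f t)"
  using abs_Re_le_cmod[of "cis (- (t \<bullet> x)) * char_fun f t"] by (simp add: inv_integrand_eq[OF assms] norm_mult)

lemma cmod_char_fun_le_1:
  assumes "prob_density f"
  shows "cmod (char_fun f t) \<le> 1"
proof -
  have "cmod (char_fun f t) \<le> (\<integral>v. cmod (cis (t \<bullet> v) * complex_of_real (f v)) \<partial>lborel)"
    unfolding fourier_integral_def by (rule integral_norm_bound)
  also have "\<dots> = 1" using prob_densityD[OF assms] by (simp add: norm_mult)
  finally show ?thesis .
qed

text \<open>An observation enters as s \<bullet> x - v \<bullet> s = s \<bullet> (x - v). Averaging
  over s first gives the d-dimensional transform at x - v, and Fubini then moves the integral over v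
  inside. The lemma serves twice: with a truncated power as weight for the mean of the estimator,
  with an exponential weight for the second moment.\<close>

lemma expectation_radial_cosine_transform:
  fixes w :: "real \<Rightarrow> real" and f :: "'a::euclidean_space \<Rightarrow> real" and x :: 'a
  assumes f: "prob_density f"
    and [measurable]: "w \<in> borel_measurable borel" and int: "integrable lborel (\<lambda>r. indicator {0<..} r * w r)"
  shows "(\<integral>p. (\<integral>r. indicator {0<..} r * w r * cos ((fst p \<bullet> x - snd p) * r) \<partial>lborel) \<partial>radon_law f)
      = (\<integral>t. w (norm t) / norm t ^ (DIM('a) - 1) * inv_integrand f x t \<partial>lborel) / sphere_area DIM('a)"
proof -
  note prob_densityD[OF f, measurable]
  define q where "q r = w r / r ^ (DIM('a) - 1)" for r
  have [measurable]: "q \<in> borel_measurable borel" by (simp add: q_def[abs_def])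
  have qint: "integrable lborel (\<lambda>t::'a. q (norm t))"
    using radial_cosine_transform(1)[OF _ int] by (simp add: q_def)
  define W where "W u = (\<integral>r. indicator {0<..} r * w r * cos (u * r) \<partial>lborel)" for u
  have Wm[measurable]: "W \<in> borel_measurable borel" unfolding W_def[abs_def] by measurable
  have Wb: "\<bar>W u\<bar> \<le> (\<integral>r. \<bar>indicator {0<..} r * w r\<bar> \<partial>lborel)" for u
  proof -
    have "\<bar>W u\<bar> \<le> (\<integral>r. \<bar>indicator {0<..} r * w r * cos (u * r)\<bar> \<partial>lborel)"
      unfolding W_def by (rule integral_abs_bound)
    also have "\<dots> \<le> (\<integral>r. \<bar>indicator {0<..} r * w r\<bar> \<partial>lborel)"
    proof (rule integral_mono)
      show "integrable lborel (\<lambda>r. \<bar>indicator {0<..} r * w r * cos (u * r)\<bar>)"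
        by (rule Bochner_Integration.integrable_bound[OF int]) (auto simp: abs_mult mult_left_le)
      show "\<bar>indicator {0<..} r * w r * cos (u * r)\<bar> \<le> \<bar>indicator {0<..} r * w r\<bar>" for r
        by (simp add: abs_mult mult_left_le)
    qed (use int in auto)
    finally show ?thesis .
  qed
  let ?D = "density lborel (\<lambda>y. ennreal (f y))"
  interpret D: prob_space ?D by (rule prob_densityD[OF f])
  interpret S: prob_space "uniform_sphere :: 'a measure" by (rule prob_space_uniform_sphere)
  interpret SD: pair_prob_space "uniform_sphere :: 'a measure" ?D ..
  interpret DL: pair_sigma_finite ?D "lborel :: 'a measure" ..
  have Dint: "(\<integral>v. h v \<partial>?D) = (\<integral>v. f v * h v \<partial>lborel)" if [measurable]: "h \<in> borel_measurable borel" for h :: "'a \<Rightarrow> real"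
    by (subst integral_density) (use prob_densityD[OF f] in auto)
  have m: "(\<lambda>(s, v). (s, v \<bullet> s)) \<in> (uniform_sphere \<Otimes>\<^sub>M ?D) \<rightarrow>\<^sub>M (sphere_measure \<Otimes>\<^sub>M lborel)"
    by measurable
  have "(\<integral>p. W (fst p \<bullet> x - snd p) \<partial>radon_law f) = (\<integral>p. W (fst p \<bullet> (x - snd p)) \<partial>(uniform_sphere \<Otimes>\<^sub>M ?D))"
    unfolding radon_law_eq_distr[OF f]
    by (subst integral_distr[OF m]) (auto simp: case_prod_beta inner_diff_right inner_commute)
  also have "\<dots> = (\<integral>v. \<integral>s. W (s \<bullet> (x - v)) \<partial>uniform_sphere \<partial>?D)"
  proof -
    have "integrable (uniform_sphere \<Otimes>\<^sub>M ?D) (\<lambda>(s, v). W (s \<bullet> (x - v)))"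
      by (rule SD.P.integrable_const_bound[of _ "\<integral>r. \<bar>indicator {0<..} r * w r\<bar> \<partial>lborel"])
         (use Wb in \<open>auto simp: case_prod_beta\<close>)
    from SD.integral_snd[OF this] show ?thesis by (simp add: case_prod_beta')
  qed
  also have "\<dots> = (\<integral>v. (\<integral>t. q (norm t) * cos (t \<bullet> (x - v)) \<partial>lborel) / sphere_area DIM('a) \<partial>?D)"
    unfolding W_def q_def by (intro Bochner_Integration.integral_cong refl radial_cosine_transform(2)[OF _ int]) measurable
  also have "\<dots> = (\<integral>v. \<integral>t. q (norm t) * cos (t \<bullet> (x - v)) \<partial>lborel \<partial>?D) / sphere_area DIM('a)"
    by simp
  also have "(\<integral>v. \<integral>t. q (norm t) * cos (t \<bullet> (x - v)) \<partial>lborel \<partial>?D) = (\<integral>t. \<integral>v. q (norm t) * cos (t \<bullet> (x - v)) \<partial>?D \<partial>lborel)"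
  proof (rule DL.Fubini_integral[symmetric])
    have "integrable (?D \<Otimes>\<^sub>M lborel) (\<lambda>(v, t::'a). q (norm t))"
      using qint by (intro DL.Fubini_integrable) (auto simp: case_prod_beta')
    then show "integrable (?D \<Otimes>\<^sub>M lborel) (\<lambda>(v, t). q (norm t) * cos (t \<bullet> (x - v)))"
      by (rule Bochner_Integration.integrable_bound) (auto simp: case_prod_beta' abs_mult mult_left_le)
  qed
  also have "\<dots> = (\<integral>t. q (norm t) * inv_integrand f x t \<partial>lborel)"
    by (intro Bochner_Integration.integral_cong refl) (simp add: Dint inv_integrand_def)
  finally show ?thesis by (simp add: W_def q_def)
qed

section \<open>Gaussian kernels and smoothed inversion\<close>

lemma lborel_integral_prod:
  fixes h :: "'a::euclidean_space \<Rightarrow> real \<Rightarrow> 'b::{real_normed_field,banach,second_countable_topology}"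
  assumes int: "\<And>b. b \<in> Basis \<Longrightarrow> integrable lborel (h b)"
  shows "integrable lborel (\<lambda>t::'a. \<Prod>b\<in>Basis. h b (t \<bullet> b))"
    and "(\<integral>t. (\<Prod>b\<in>Basis. h b (t \<bullet> b)) \<partial>(lborel :: 'a measure)) = (\<Prod>b\<in>Basis. \<integral>y. h b y \<partial>lborel)"
proof -
  interpret P: product_sigma_finite "\<lambda>_::'a. lborel :: real measure"
    by (simp add: product_sigma_finite_def sigma_finite_lborel)
  have [measurable]: "\<And>b. b \<in> Basis \<Longrightarrow> h b \<in> borel_measurable borel"
    using int by (auto dest: borel_measurable_integrable)
  have m[measurable]: "(\<lambda>t::'a. \<Prod>b\<in>Basis. h b (t \<bullet> b)) \<in> borel_measurable borel"
    by measurable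
  have c: "(\<Prod>b\<in>Basis. h b ((\<Sum>c\<in>Basis. g c *\<^sub>R c) \<bullet> b)) = (\<Prod>b\<in>Basis. h b (g b))" for g :: "'a \<Rightarrow> real"
    by (intro prod.cong refl) (simp add: inner_sum_left_Basis)
  have mm: "(\<lambda>g. \<Sum>b\<in>Basis. g b *\<^sub>R b) \<in> (\<Pi>\<^sub>M b\<in>Basis. lborel) \<rightarrow>\<^sub>M (borel :: 'a measure)"
    by measurable
  show "integrable lborel (\<lambda>t::'a. \<Prod>b\<in>Basis. h b (t \<bullet> b))"
    by (subst lborel_eq, subst integrable_distr_eq[OF mm m], subst c)
       (rule P.product_integrable_prod[OF finite_Basis int])
  show "(\<integral>t. (\<Prod>b\<in>Basis. h b (t \<bullet> b)) \<partial>(lborel :: 'a measure)) = (\<Prod>b\<in>Basis. \<integral>y. h b y \<partial>lborel)"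
    by (subst lborel_eq, subst integral_distr[OF mm m], subst c)
       (rule P.product_integral_prod[OF finite_Basis int])
qed

text \<open>The isotropic normal density with standard deviation \<open>e\<close> in each
  coordinate, written as a product so that its integrals factor.\<close>

definition gauss :: "real \<Rightarrow> 'a::euclidean_space \<Rightarrow> real" where
  "gauss e y = (\<Prod>b\<in>Basis. normal_density 0 e (y \<bullet> b))"

lemma gauss_measurable[measurable]: "gauss e \<in> borel_measurable borel"
  unfolding gauss_def[abs_def] by measurable

lemma gauss_nonneg: "0 \<le> gauss e y"
  by (simp add: gauss_def prod_nonneg)

lemma nn_integral_gauss:
  assumes "0 < e"
  shows "(\<integral>\<^sup>+y. ennreal (gauss e y) \<partial>(lborel :: 'a::euclidean_space measure)) = 1"
proof -
  have "(\<integral>y. gauss e y \<partial>(lborel :: 'a measure)) = 1" "integrable lborel (gauss e :: 'a \<Rightarrow> real)"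
    unfolding gauss_def[abs_def]
    using lborel_integral_prod[of "\<lambda>_::'a. normal_density 0 e"] assms by auto
  then show ?thesis by (subst nn_integral_eq_integral) (auto simp: gauss_nonneg)
qed

text \<open>The characteristic function of the standard normal law, evaluated at
  \<open>y / e\<close>, after the substitution u = e t.\<close>

lemma normal_density_fourier:
  fixes e y :: real
  assumes e: "0 < e"
  shows "integrable lborel (\<lambda>t. cis (t * y) * complex_of_real (exp (- (e * t)\<^sup>2 / 2)))"
    and "(\<integral>t. cis (t * y) * complex_of_real (exp (- (e * t)\<^sup>2 / 2)) \<partial>lborel)
      = complex_of_real (2 * pi * normal_density 0 e y)"
proof -
  let ?J = "(\<integral>t. cis (t * y) * complex_of_real (exp (- (e * t)\<^sup>2 / 2)) \<partial>lborel)"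
  have "integrable lborel std_normal_density" by simp
  then have "integrable lborel (\<lambda>t. std_normal_density (0 + e * t))"
    using e by (intro lborel_integrable_real_affine) auto
  then have "integrable lborel (\<lambda>t. sqrt (2 * pi) * std_normal_density (e * t))" by simp
  also have "(\<lambda>t. sqrt (2 * pi) * std_normal_density (e * t)) = (\<lambda>t. exp (- (e * t)\<^sup>2 / 2))"
    by (simp add: std_normal_density_def fun_eq_iff)
  finally have i: "integrable lborel (\<lambda>t. exp (- (e * t)\<^sup>2 / 2))" .
  show "integrable lborel (\<lambda>t. cis (t * y) * complex_of_real (exp (- (e * t)\<^sup>2 / 2)))"
    by (rule Bochner_Integration.integrable_bound[OF i]) (auto simp: norm_mult)
  have "complex_of_real (exp (- (y / e)\<^sup>2 / 2)) = (\<integral>u. iexp (y / e * u) \<partial>std_normal_distribution)"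
    using fun_cong[OF char_std_normal_distribution, of "y / e"] by (simp add: char_def)
  also have "\<dots> = (\<integral>u. std_normal_density u *\<^sub>R iexp (y / e * u) \<partial>lborel)"
    by (subst integral_density) auto
  also have "\<dots> = \<bar>e\<bar> *\<^sub>R (\<integral>t. std_normal_density (0 + e * t) *\<^sub>R iexp (y / e * (0 + e * t)) \<partial>lborel)"
    using e by (intro lborel_integral_real_affine) simp
  also have "(\<integral>t. std_normal_density (0 + e * t) *\<^sub>R iexp (y / e * (0 + e * t)) \<partial>lborel)
     = (\<integral>t. complex_of_real (1 / sqrt (2 * pi)) * (cis (t * y) * complex_of_real (exp (- (e * t)\<^sup>2 / 2))) \<partial>lborel)"
    using e by (intro Bochner_Integration.integral_cong refl)
      (simp add: std_normal_density_def cis_conv_exp scaleR_conv_of_real mult_ac)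
  also have "\<dots> = complex_of_real (1 / sqrt (2 * pi)) * ?J"
    by simp
  finally have eq: "complex_of_real (exp (- (y / e)\<^sup>2 / 2))
    = complex_of_real (e / sqrt (2 * pi)) * ?J"
    using e by (simp add: scaleR_conv_of_real)
  have "?J
     = complex_of_real (sqrt (2 * pi) / e) * (complex_of_real (e / sqrt (2 * pi)) * ?J)"
  proof -
    have "complex_of_real (sqrt (2 * pi) / e) * complex_of_real (e / sqrt (2 * pi)) = 1"
      using e by (simp only: of_real_mult[symmetric]) simp
    then show ?thesis by (simp only: mult.assoc[symmetric]) simp
  qed
  also have "\<dots> = complex_of_real (sqrt (2 * pi) / e * exp (- (y / e)\<^sup>2 / 2))"
    by (simp only: eq[symmetric] of_real_mult)
  also have "sqrt (2 * pi) / e * exp (- (y / e)\<^sup>2 / 2) = 2 * pi * normal_density 0 e y"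
  proof -
    have "sqrt (2 * pi * e\<^sup>2) = sqrt (2 * pi) * e" using e by (simp add: real_sqrt_mult)
    moreover have "sqrt (2 * pi) * sqrt (2 * pi) = 2 * pi" by simp
    ultimately show ?thesis using e by (simp add: normal_density_def power_divide field_simps)
  qed
  finally show "?J
      = complex_of_real (2 * pi * normal_density 0 e y)" .
qed

lemma cis_sum: "cis (\<Sum>i\<in>I. a i) = (\<Prod>i\<in>I. cis (a i))"
  by (induction I rule: infinite_finite_induct) (auto simp flip: cis_mult)

lemma gauss_fourier:
  fixes y :: "'a::euclidean_space"
  assumes e: "0 < e"
  shows "integrable lborel (\<lambda>t::'a. exp (- (e * norm t)\<^sup>2 / 2))"
    and "(\<integral>t. exp (- (e * norm t)\<^sup>2 / 2) * cos (t \<bullet> y) \<partial>lborel) = (2 * pi) ^ DIM('a) * gauss e y"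
proof -
  have prod: "(\<Prod>b\<in>Basis. cis ((t \<bullet> b) * (z \<bullet> b)) * complex_of_real (exp (- (e * (t \<bullet> b))\<^sup>2 / 2)))
     = cis (t \<bullet> z) * complex_of_real (exp (- (e * norm t)\<^sup>2 / 2))" for t z :: 'a
  proof -
    have "(norm t)\<^sup>2 = (\<Sum>b\<in>Basis. (t \<bullet> b)\<^sup>2)"
      unfolding power2_norm_eq_inner by (subst euclidean_inner) (simp add: power2_eq_square)
    then have "- (e * norm t)\<^sup>2 / 2 = (\<Sum>b\<in>Basis. - (e * (t \<bullet> b))\<^sup>2 / 2)"
      by (simp add: power_mult_distrib sum_distrib_left sum_negf sum_divide_distrib)
    then have "exp (- (e * norm t)\<^sup>2 / 2) = (\<Prod>b\<in>Basis. exp (- (e * (t \<bullet> b))\<^sup>2 / 2))"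
      by (simp only: exp_sum finite_Basis)
    moreover have "cis (t \<bullet> z) = (\<Prod>b\<in>Basis. cis ((t \<bullet> b) * (z \<bullet> b)))"
      by (simp add: euclidean_inner[of t z] cis_sum)
    ultimately show ?thesis by (simp add: prod.distrib)
  qed
  note int = lborel_integral_prod[of "\<lambda>b s. cis (s * (z \<bullet> b)) * complex_of_real (exp (- (e * s)\<^sup>2 / 2))" for z :: 'a,
      OF normal_density_fourier(1)[OF e], unfolded prod normal_density_fourier(2)[OF e]]
  have "integrable lborel (\<lambda>t::'a. norm (cis (t \<bullet> 0) * complex_of_real (exp (- (e * norm t)\<^sup>2 / 2))))"
    by (rule integrable_norm[OF int(1)])
  then show "integrable lborel (\<lambda>t::'a. exp (- (e * norm t)\<^sup>2 / 2))" by (simp add: norm_mult)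
  have "(\<integral>t. exp (- (e * norm t)\<^sup>2 / 2) * cos (t \<bullet> y) \<partial>lborel)
     = (\<integral>t. Re (cis (t \<bullet> y) * complex_of_real (exp (- (e * norm t)\<^sup>2 / 2))) \<partial>lborel)"
    by (intro Bochner_Integration.integral_cong refl) simp
  also have "\<dots> = Re (\<integral>t. cis (t \<bullet> y) * complex_of_real (exp (- (e * norm t)\<^sup>2 / 2)) \<partial>lborel)"
    by (rule integral_bounded_linear[OF bounded_linear_Re int(1)])
  also have "\<dots> = Re (complex_of_real (\<Prod>b\<in>Basis. 2 * pi * normal_density 0 e (y \<bullet> b)))"
    by (simp only: int(2) of_real_prod)
  also have "\<dots> = (2 * pi) ^ DIM('a) * gauss e y"
    by (simp only: Re_complex_of_real) (simp add: gauss_def prod.distrib)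
  finally show "(\<integral>t. exp (- (e * norm t)\<^sup>2 / 2) * cos (t \<bullet> y) \<partial>lborel) = (2 * pi) ^ DIM('a) * gauss e y" .
qed

text \<open>The Gaussian factor makes the double integral over v and t absolutely convergent for any
  density, so Fubini gives an inversion formula for the smoothed \<open>f\<close>. Full inversion
  follows by letting \<open>e\<close> tend to 0.\<close>

lemma gauss_convolution:
  fixes f :: "'a::euclidean_space \<Rightarrow> real"
  assumes f: "prob_density f" and e: "0 < e"
  shows "integrable lborel (\<lambda>v. f v * gauss e (x - v))"
    and "(\<integral>v. f v * gauss e (x - v) \<partial>lborel)
      = (\<integral>t. exp (- (e * norm t)\<^sup>2 / 2) * inv_integrand f x t \<partial>lborel) / (2 * pi) ^ DIM('a)"
proof -
  note prob_densityD[OF f, measurable]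
  note gi = gauss_fourier(1)[OF e, where 'a='a]
  \<comment> \<open>Replacing the cosine by 1 in the Fourier integral bounds \<open>gauss e\<close>
    uniformly, which makes its product with \<open>f\<close> integrable.\<close>
  have "gauss e z \<le> (\<integral>t. exp (- (e * norm t)\<^sup>2 / 2) \<partial>(lborel :: 'a measure)) / (2 * pi) ^ DIM('a)" for z :: 'a
  proof -
    have "(2 * pi) ^ DIM('a) * gauss e z \<le> (\<integral>t. exp (- (e * norm t)\<^sup>2 / 2) \<partial>(lborel :: 'a measure))"
      unfolding gauss_fourier(2)[OF e, symmetric]
      by (rule integral_mono[OF Bochner_Integration.integrable_bound[OF gi] gi]) (auto simp: abs_mult mult_left_le)
    then show ?thesis by (simp add: field_simps)
  qed
  then obtain C where C: "\<And>z :: 'a. gauss e z \<le> C" by blast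
  have ga: "f v * \<bar>gauss e (x - v)\<bar> \<le> f v * \<bar>C\<bar>" for v
    using C[of "x - v"] gauss_nonneg[of e "x - v"] prob_densityD(2)[OF f, of v] by (intro mult_left_mono) auto
  show fg: "integrable lborel (\<lambda>v. f v * gauss e (x - v))"
    by (rule Bochner_Integration.integrable_bound[where f="\<lambda>v. f v * C"])
       (use prob_densityD[OF f] ga in \<open>auto simp: abs_mult\<close>)
  have "(\<integral>v. f v * gauss e (x - v) \<partial>lborel)
    = (\<integral>v. \<integral>t. f v * (exp (- (e * norm t)\<^sup>2 / 2) * cos (t \<bullet> (x - v))) \<partial>lborel \<partial>lborel) / (2 * pi) ^ DIM('a)"
  proof -
    have "gauss e z = (\<integral>t. exp (- (e * norm t)\<^sup>2 / 2) * cos (t \<bullet> z) \<partial>lborel) / (2 * pi) ^ DIM('a)" for z :: 'a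
      unfolding gauss_fourier(2)[OF e] by simp
    then show ?thesis by simp
  qed
  also have "(\<integral>v. \<integral>t. f v * (exp (- (e * norm t)\<^sup>2 / 2) * cos (t \<bullet> (x - v))) \<partial>lborel \<partial>lborel)
    = (\<integral>t. \<integral>v. f v * (exp (- (e * norm t)\<^sup>2 / 2) * cos (t \<bullet> (x - v))) \<partial>lborel \<partial>lborel)"
  proof (rule lborel_pair.Fubini_integral[symmetric])
    have "integrable (lborel \<Otimes>\<^sub>M lborel) (\<lambda>(v, t::'a). f v * exp (- (e * norm t)\<^sup>2 / 2))"
      by (rule lborel_pair.Fubini_integrable)
         (use prob_densityD[OF f] gi in \<open>auto simp: case_prod_beta' abs_mult\<close>)
    then show "integrable (lborel \<Otimes>\<^sub>M lborel) (\<lambda>(v, t). f v * (exp (- (e * norm t)\<^sup>2 / 2) * cos (t \<bullet> (x - v))))"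
      by (rule Bochner_Integration.integrable_bound)
         (auto simp: case_prod_beta' abs_mult mult.assoc[symmetric] mult_left_le)
  qed
  also have "\<dots> = (\<integral>t. exp (- (e * norm t)\<^sup>2 / 2) * inv_integrand f x t \<partial>lborel)"
    unfolding inv_integrand_def
    by (intro Bochner_Integration.integral_cong refl) (simp add: mult.left_commute[of "f _"])
  finally show "(\<integral>v. f v * gauss e (x - v) \<partial>lborel)
      = (\<integral>t. exp (- (e * norm t)\<^sup>2 / 2) * inv_integrand f x t \<partial>lborel) / (2 * pi) ^ DIM('a)" .
qed

section \<open>Inversion when the Fourier transform is integrable\<close>

definition inv_fourier :: "('a::euclidean_space \<Rightarrow> real) \<Rightarrow> 'a \<Rightarrow> real" where
  "inv_fourier f x = (\<integral>t. inv_integrand f x t \<partial>lborel) / (2 * pi) ^ DIM('a)"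

lemma inv_fourier_measurable[measurable]:
  assumes [measurable]: "f \<in> borel_measurable borel"
  shows "inv_fourier f \<in> borel_measurable borel"
  unfolding inv_fourier_def[abs_def]
  by (intro borel_measurable_divide lborel.borel_measurable_lebesgue_integral) (simp_all add: case_prod_beta')

context
  fixes f :: "'a::euclidean_space \<Rightarrow> real"
  assumes f: "prob_density f" and Fint: "integrable lborel (\<lambda>t. cmod (char_fun f t))"
begin

context
  notes prob_densityD(1)[OF f, measurable]
begin

lemma integrable_inv_integrand: "integrable lborel (inv_integrand f x)"
  by (rule Bochner_Integration.integrable_bound[OF Fint])
     (use abs_inv_integrand_le[OF prob_densityD(3)[OF f]] in auto)

lemma continuous_inv_fourier: "continuous_on UNIV (inv_fourier f)"
  unfolding continuous_on_sequentially
proof (intro allI ballI impI)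
  fix X :: "nat \<Rightarrow> 'a" and x assume X: "(\<forall>n. X n \<in> UNIV) \<and> X \<longlonglongrightarrow> x"
  have "(\<lambda>n. \<integral>t. inv_integrand f (X n) t \<partial>lborel) \<longlonglongrightarrow> (\<integral>t. inv_integrand f x t \<partial>lborel)"
  proof (rule integral_dominated_convergence[OF _ _ Fint])
    show "AE t in lborel. (\<lambda>n. inv_integrand f (X n) t) \<longlonglongrightarrow> inv_integrand f x t"
    proof (rule AE_I2)
      fix t
      have "(\<lambda>n. t \<bullet> X n) \<longlonglongrightarrow> t \<bullet> x" using X by (intro tendsto_intros) auto
      then show "(\<lambda>n. inv_integrand f (X n) t) \<longlonglongrightarrow> inv_integrand f x t"
        by (simp add: inv_integrand_eq[OF prob_densityD(3)[OF f]] tendsto_intros)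
    qed
  qed (use abs_inv_integrand_le[OF prob_densityD(3)[OF f]] in auto)
  then show "(inv_fourier f \<circ> X) \<longlonglongrightarrow> inv_fourier f x"
    unfolding inv_fourier_def comp_def by (intro tendsto_intros) auto
qed

lemma gauss_smoothing_tendsto:
  assumes e: "e \<longlonglongrightarrow> (0::real)"
  shows "(\<lambda>n. (\<integral>t. exp (- (e n * norm t)\<^sup>2 / 2) * inv_integrand f x t \<partial>lborel) / (2 * pi) ^ DIM('a)) \<longlonglongrightarrow> inv_fourier f x"
  unfolding inv_fourier_def
proof (intro tendsto_divide tendsto_const)
  show "(\<lambda>n. \<integral>t. exp (- (e n * norm t)\<^sup>2 / 2) * inv_integrand f x t \<partial>lborel) \<longlonglongrightarrow> (\<integral>t. inv_integrand f x t \<partial>lborel)"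
  proof (rule integral_dominated_convergence[OF _ _ Fint])
    show "AE t in lborel. (\<lambda>n. exp (- (e n * norm t)\<^sup>2 / 2) * inv_integrand f x t) \<longlonglongrightarrow> inv_integrand f x t"
    proof (rule AE_I2)
      fix t :: 'a
      have "(\<lambda>n. exp (- (e n * norm t)\<^sup>2 / 2) * inv_integrand f x t) \<longlonglongrightarrow> exp (- (0 * norm t)\<^sup>2 / 2) * inv_integrand f x t"
        by (intro tendsto_intros e) auto
      then show "(\<lambda>n. exp (- (e n * norm t)\<^sup>2 / 2) * inv_integrand f x t) \<longlonglongrightarrow> inv_integrand f x t" by simp
    qed
    show "AE t in lborel. norm (exp (- (e n * norm t)\<^sup>2 / 2) * inv_integrand f x t) \<le> cmod (char_fun f t)" for n
    proof (rule AE_I2)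
      fix t
      have "norm (exp (- (e n * norm t)\<^sup>2 / 2) * inv_integrand f x t) \<le> 1 * cmod (char_fun f t)"
        unfolding norm_mult using abs_inv_integrand_le[OF prob_densityD(3)[OF f]] by (intro mult_mono) auto
      then show "norm (exp (- (e n * norm t)\<^sup>2 / 2) * inv_integrand f x t) \<le> cmod (char_fun f t)" by simp
    qed
  qed measurable
qed simp

text \<open>A limit of convolutions of \<open>f\<close> with Gaussians, each nonnegative. The sign
  is needed to read an equality of \<open>ennreal\<close> densities as an equality of real
  functions.\<close>

lemma inv_fourier_nonneg: "0 \<le> inv_fourier f x"
proof (rule LIMSEQ_le_const[OF gauss_smoothing_tendsto[OF LIMSEQ_inverse_real_of_nat]], intro exI allI impI)
  fix n :: nat
  show "0 \<le> (\<integral>t. exp (- (inverse (real (Suc n)) * norm t)\<^sup>2 / 2) * inv_integrand f x t \<partial>lborel) / (2 * pi) ^ DIM('a)"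
    (is "0 \<le> ?J")
    unfolding gauss_convolution(2)[OF f positive_imp_inverse_positive[OF of_nat_0_less_iff[THEN iffD2, OF zero_less_Suc]], symmetric]
    by (intro Bochner_Integration.integral_nonneg mult_nonneg_nonneg prob_densityD(2)[OF f] gauss_nonneg)
qed

lemma nn_integral_gauss_convolution:
  assumes e: "0 < e"
  shows "(\<integral>\<^sup>+v. ennreal (f v) * ennreal (gauss e (x - v)) \<partial>lborel)
    = ennreal ((\<integral>t. exp (- (e * norm t)\<^sup>2 / 2) * inv_integrand f x t \<partial>lborel) / (2 * pi) ^ DIM('a))"
proof -
  have "(\<integral>\<^sup>+v. ennreal (f v) * ennreal (gauss e (x - v)) \<partial>lborel) = (\<integral>\<^sup>+v. ennreal (f v * gauss e (x - v)) \<partial>lborel)"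
    using prob_densityD[OF f] by (simp add: ennreal_mult gauss_nonneg)
  also have "\<dots> = ennreal (\<integral>v. f v * gauss e (x - v) \<partial>lborel)"
    by (intro nn_integral_eq_integral gauss_convolution(1)[OF f e] AE_I2 mult_nonneg_nonneg prob_densityD(2)[OF f] gauss_nonneg)
  finally show ?thesis by (simp add: gauss_convolution(2)[OF f e])
qed

text \<open>Both sides are the limit of the integrals over the box of \<open>f\<close> smoothed at
  scale e n. On one side the smoothed densities converge boundedly to \<open>inv_fourier f\<close>.
  On the other, Fubini transfers the smoothing from \<open>f\<close> to the indicator of the box,
  where convergence is easy.\<close>

lemma nn_integral_box_inv_fourier:
  fixes l u :: 'a
  shows "(\<integral>\<^sup>+x. ennreal (inv_fourier f x) * indicator (box l u) x \<partial>lborel)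
    = (\<integral>\<^sup>+x. ennreal (f x) * indicator (box l u) x \<partial>lborel)"
proof -
  let ?I = "indicator (box l u) :: 'a \<Rightarrow> ennreal"
  define e where "e n = inverse (real (Suc n))" for n
  have epos: "0 < e n" for n by (simp add: e_def)
  have e0: "e \<longlonglongrightarrow> 0" unfolding e_def[abs_def] by (rule LIMSEQ_inverse_real_of_nat)
  define J where "J n x = (\<integral>t. exp (- (e n * norm t)\<^sup>2 / 2) * inv_integrand f x t \<partial>lborel) / (2 * pi) ^ DIM('a)" for n x
  have Jm[measurable]: "J n \<in> borel_measurable borel" for n
    unfolding J_def[abs_def]
    by (intro borel_measurable_divide lborel.borel_measurable_lebesgue_integral) (simp_all add: case_prod_beta')
  \<comment> \<open>A common bound for all smoothed densities; on a box, which has finite volume, it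
    is an integrable majorant.\<close>
  define C where "C = (\<integral>t. cmod (char_fun f t) \<partial>lborel) / (2 * pi) ^ DIM('a)"
  have JC: "J n x \<le> C" for n x
  proof -
    have "(\<integral>t. exp (- (e n * norm t)\<^sup>2 / 2) * inv_integrand f x t \<partial>lborel) \<le> (\<integral>t. cmod (char_fun f t) \<partial>lborel)"
    proof (rule integral_mono'[OF Fint])
      fix t :: 'a
      have "\<bar>exp (- (e n * norm t)\<^sup>2 / 2) * inv_integrand f x t\<bar> \<le> 1 * cmod (char_fun f t)"
        unfolding abs_mult using abs_inv_integrand_le[OF prob_densityD(3)[OF f]] by (intro mult_mono) auto
      then show "exp (- (e n * norm t)\<^sup>2 / 2) * inv_integrand f x t \<le> cmod (char_fun f t)" by simp
    qed auto
    then show ?thesis unfolding J_def C_def by (intro divide_right_mono) auto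
  qed
  have "(\<lambda>n. \<integral>\<^sup>+x. ennreal (J n x) * ?I x \<partial>lborel)
    \<longlonglongrightarrow> (\<integral>\<^sup>+x. ennreal (inv_fourier f x) * ?I x \<partial>lborel)"
  proof (rule nn_integral_dominated_convergence[where w="\<lambda>x. ennreal C * ?I x"])
    show "(\<integral>\<^sup>+x. ennreal C * ?I x \<partial>lborel) < \<infinity>"
      by (subst nn_integral_cmult_indicator) (auto simp: ennreal_mult_less_top emeasure_lborel_box_eq)
    show "AE x in lborel. (\<lambda>n. ennreal (J n x) * ?I x) \<longlonglongrightarrow> ennreal (inv_fourier f x) * ?I x"
      using gauss_smoothing_tendsto[OF e0]
      by (intro AE_I2) (auto simp: indicator_def J_def intro!: tendsto_ennrealI)
  qed (use JC in \<open>auto simp: indicator_def intro!: ennreal_leI\<close>)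
  moreover have "(\<lambda>n. \<integral>\<^sup>+x. ennreal (J n x) * ?I x \<partial>lborel)
    \<longlonglongrightarrow> (\<integral>\<^sup>+x. ennreal (f x) * ?I x \<partial>lborel)"
  proof -
    \<comment> \<open>The probability that v + e n * Z lies in the box for a standard normal vector
      Z: the smoothed indicator.\<close>
    define H where "H n v = (\<integral>\<^sup>+z. ennreal (gauss 1 z) * ?I (v + e n *\<^sub>R z) \<partial>lborel)" for n v
    have "(\<integral>\<^sup>+x. ennreal (J n x) * ?I x \<partial>lborel) = (\<integral>\<^sup>+v. ennreal (f v) * H n v \<partial>lborel)" for n
    proof -
      have "(\<integral>\<^sup>+x. ennreal (J n x) * ?I x \<partial>lborel)
        = (\<integral>\<^sup>+x. \<integral>\<^sup>+v. ennreal (f v) * (ennreal (gauss (e n) (x - v)) * ?I x) \<partial>lborel \<partial>lborel)"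
        unfolding J_def nn_integral_gauss_convolution[OF epos, symmetric]
        by (intro nn_integral_cong, subst nn_integral_multc[symmetric]) (auto simp: mult.assoc)
      also have "\<dots> = (\<integral>\<^sup>+v. \<integral>\<^sup>+x. ennreal (f v) * (ennreal (gauss (e n) (x - v)) * ?I x) \<partial>lborel \<partial>lborel)"
        by (rule lborel_pair.Fubini') (simp add: case_prod_beta')
      also have "\<dots> = (\<integral>\<^sup>+v. ennreal (f v) * H n v \<partial>lborel)"
      proof (rule nn_integral_cong)
        fix v :: 'a
        have sc: "ennreal (\<bar>e n\<bar> ^ DIM('a)) * ennreal (gauss (e n) (e n *\<^sub>R z)) = ennreal (gauss 1 z)" for z :: 'a
        proof -
          have "normal_density 0 (e n) (e n * y) = normal_density 0 1 y / e n" for y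
          proof -
            have "(e n * y)\<^sup>2 / (2 * (e n)\<^sup>2) = y\<^sup>2 / 2" using epos[of n] by (simp add: power_mult_distrib)
            then show ?thesis using epos[of n] by (simp add: normal_density_def real_sqrt_mult)
          qed
          then have "gauss (e n) (e n *\<^sub>R z) = gauss 1 z / e n ^ DIM('a)"
            by (simp add: gauss_def prod_dividef)
          then show ?thesis using epos[of n] gauss_nonneg[of 1 z] by (simp flip: ennreal_mult)
        qed
        have "(\<integral>\<^sup>+x. ennreal (gauss (e n) (x - v)) * ?I x \<partial>lborel)
          = (\<integral>\<^sup>+x. ennreal (gauss (e n) (x - v)) * ?I x
              \<partial>density (distr lborel borel (\<lambda>z. v + e n *\<^sub>R z)) (\<lambda>_. ennreal (\<bar>e n\<bar> ^ DIM('a))))"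
          using epos[of n] by (subst lborel_affine[symmetric]) auto
        also have "\<dots> = H n v"
          unfolding H_def
          by (simp add: nn_integral_density nn_integral_distr sc[symmetric] mult.assoc)
        finally show "(\<integral>\<^sup>+x. ennreal (f v) * (ennreal (gauss (e n) (x - v)) * ?I x) \<partial>lborel) = ennreal (f v) * H n v"
          by (subst nn_integral_cmult) auto
      qed
      finally show ?thesis .
    qed
    moreover have "(\<lambda>n. \<integral>\<^sup>+v. ennreal (f v) * H n v \<partial>lborel) \<longlonglongrightarrow> (\<integral>\<^sup>+x. ennreal (f x) * ?I x \<partial>lborel)"
    proof (rule nn_integral_dominated_convergence[where w="\<lambda>v. ennreal (f v)"])
      show "(\<integral>\<^sup>+v. ennreal (f v) \<partial>lborel) < \<infinity>" using f by (simp add: prob_density_def)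
      have "H n v \<le> (\<integral>\<^sup>+z. ennreal (gauss 1 z) \<partial>(lborel :: 'a measure))" for n v
        unfolding H_def by (intro nn_integral_mono) (auto simp: indicator_def)
      then have "H n v \<le> 1" for n v by (simp add: nn_integral_gauss)
      then show "AE v in lborel. ennreal (f v) * H n v \<le> ennreal (f v)" for n
        by (intro AE_I2) (metis mult.right_neutral mult_left_mono zero_le)
      \<comment> \<open>The smoothed indicator converges to the indicator at every point off the
        boundary of the box, so the boundary has to be null.\<close>
      have "emeasure lborel (cbox l u - box l u) = 0"
        by (cases "\<forall>b\<in>Basis. l \<bullet> b \<le> u \<bullet> b")
           (auto simp: emeasure_Diff box_subset_cbox emeasure_lborel_box_eq emeasure_lborel_cbox_eq)
      then have "AE v in lborel. v \<notin> cbox l u - box l u"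
        by (intro AE_not_in) auto
      then show "AE v in lborel. (\<lambda>n. ennreal (f v) * H n v) \<longlonglongrightarrow> ennreal (f v) * ?I v"
      proof eventually_elim
        case (elim v)
        have "(\<lambda>n. H n v) \<longlonglongrightarrow> (\<integral>\<^sup>+z. ennreal (gauss 1 z) * ?I v \<partial>(lborel :: 'a measure))"
          unfolding H_def
        proof (rule nn_integral_dominated_convergence[where w="\<lambda>z. ennreal (gauss 1 z)"])
          show "AE z in lborel. (\<lambda>n. ennreal (gauss 1 z) * ?I (v + e n *\<^sub>R z)) \<longlonglongrightarrow> ennreal (gauss 1 z) * ?I v"
          proof (rule AE_I2)
            fix z :: 'a
            have lim: "(\<lambda>n. v + e n *\<^sub>R z) \<longlonglongrightarrow> v"
              using tendsto_add[OF tendsto_const tendsto_scaleR[OF e0 tendsto_const]] by fastforce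
            have "\<forall>\<^sub>F n in sequentially. ?I (v + e n *\<^sub>R z) = ?I v"
            proof (cases "v \<in> box l u")
              case True
              then show ?thesis using topological_tendstoD[OF lim open_box True]
                by (auto elim!: eventually_mono)
            next
              case False
              then have "v \<in> - cbox l u" using elim by auto
              from topological_tendstoD[OF lim _ this] have "\<forall>\<^sub>F n in sequentially. v + e n *\<^sub>R z \<in> - cbox l u"
                by (simp add: open_Compl closed_cbox)
              then show ?thesis using False box_subset_cbox[of l u] by (auto elim!: eventually_mono simp: indicator_def)
            qed
            then show "(\<lambda>n. ennreal (gauss 1 z) * ?I (v + e n *\<^sub>R z)) \<longlonglongrightarrow> ennreal (gauss 1 z) * ?I v"
              by (intro tendsto_eventually) (auto elim: eventually_mono)
          qed
          show "AE z in lborel. ennreal (gauss 1 z) * ?I (v + e n *\<^sub>R z) \<le> ennreal (gauss 1 z)" for n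
            by (auto simp: indicator_def)
        qed (auto simp: nn_integral_gauss)
        also have "(\<integral>\<^sup>+z. ennreal (gauss 1 z) * ?I v \<partial>(lborel :: 'a measure)) = ?I v"
          by (subst nn_integral_multc) (auto simp: nn_integral_gauss)
        finally show ?case by (intro ennreal_tendsto_cmult) auto
      qed
    qed (auto simp: H_def)
    ultimately show ?thesis by simp
  qed
  ultimately show ?thesis by (rule LIMSEQ_unique)
qed

text \<open>Open boxes generate the Borel sets and are stable under intersection, so the two
  densities define the same measure and hence agree almost everywhere.\<close>

lemma AE_eq_inv_fourier: "AE x in lborel. f x = inv_fourier f x"
proof -
  have "density lborel (\<lambda>x. ennreal (f x)) = density lborel (\<lambda>x. ennreal (inv_fourier f x))" (is "?M = ?N")
  proof (rule measure_eqI_generator_eq)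
    let ?E = "range (\<lambda>(a, b). box a b :: 'a set)"
    show "Int_stable ?E" by (auto simp: Int_stable_def box_Int_box)
    show "?E \<subseteq> Pow UNIV" "sets ?M = sigma_sets UNIV ?E" "sets ?N = sigma_sets UNIV ?E"
      by (simp_all add: borel_eq_box)
    let ?A = "\<lambda>n::nat. box (- (real n *\<^sub>R One)) (real n *\<^sub>R One) :: 'a set"
    show "range ?A \<subseteq> ?E" "(\<Union>i. ?A i) = UNIV"
      unfolding UN_box_eq_UNIV by auto
    show "emeasure ?M (?A i) \<noteq> \<infinity>" for i
      using finite_measure.emeasure_finite[OF prob_space.finite_measure[OF prob_densityD(5)[OF f]]] by auto
    show "emeasure ?M X = emeasure ?N X" if "X \<in> ?E" for X
      using that by (auto simp: emeasure_density nn_integral_box_inv_fourier)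
  qed
  then have "AE x in lborel. ennreal (f x) = ennreal (inv_fourier f x)"
    by (rule sigma_finite_measure.density_unique[OF sigma_finite_lborel, rotated 2]) auto
  then show ?thesis
    by eventually_elim (use prob_densityD(2)[OF f] inv_fourier_nonneg in auto)
qed

text \<open>Continuous functions that agree almost everywhere agree everywhere, because the set
  where they differ is open and null, hence empty. The choice in \<open>continuous_version\<close>
  is therefore forced.\<close>

lemma continuous_version_eq: "continuous_version f = inv_fourier f"
proof -
  have ex: "continuous_on UNIV (inv_fourier f) \<and> (AE y in lborel. f y = inv_fourier f y)"
    using continuous_inv_fourier AE_eq_inv_fourier by blast
  let ?g = "continuous_version f"
  have g: "continuous_on UNIV ?g" and ae: "AE y in lborel. f y = ?g y"
    using someI[of "\<lambda>g. continuous_on UNIV g \<and> (AE y in lborel. f y = g y)", OF ex]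
    by (auto simp: continuous_version_def)
  let ?U = "{x. ?g x \<noteq> inv_fourier f x}"
  have "open ?U" by (rule open_Collect_neq[OF g continuous_inv_fourier])
  have "AE y in lborel. ?g y = inv_fourier f y"
    using ae AE_eq_inv_fourier by eventually_elim simp
  then have "emeasure lborel ?U = 0"
    using \<open>open ?U\<close> by (subst (asm) AE_iff_measurable[OF _ refl]) auto
  have "?U = {}"
  proof (rule ccontr)
    assume "?U \<noteq> {}"
    with \<open>open ?U\<close> have "\<not> negligible ?U" by (rule open_not_negligible)
    moreover have "?U \<in> null_sets lborel" using \<open>open ?U\<close> \<open>emeasure lborel ?U = 0\<close> by auto
    ultimately show False by (simp add: negligible_iff_null_sets null_sets_completionI)
  qed
  then show ?thesis by auto
qed

end

end

section \<open>Concentration of empirical means\<close>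

text \<open>On this range a pure quadratic remainder suffices, which keeps the exponential moments
  below of Gaussian form.\<close>

lemma exp_le_one_plus_sq:
  fixes y :: real
  assumes "\<bar>y\<bar> \<le> 1"
  shows "exp y \<le> 1 + y + y\<^sup>2"
proof (cases "0 \<le> y")
  case True
  then show ?thesis using exp_bound[of y] assms by simp
next
  case False
  define z where "z = - y"
  have z: "0 \<le> z" using False by (simp add: z_def)
  \<comment> \<open>It suffices that (1 - z + z^2) exp z is at least 1, and the quadratic Taylor
    polynomial of exp already yields this.\<close>
  have "1 + z + z\<^sup>2 / 2 \<le> exp z" using exp_lower_Taylor_quadratic[OF z] .
  moreover have "(1 - z + z\<^sup>2) * (1 + z + z\<^sup>2 / 2) = 1 + z\<^sup>2 / 2 + (z ^ 3 + z ^ 4) / 2"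
    by (simp add: field_simps power2_eq_square power3_eq_cube power4_eq_xxxx)
  moreover have "0 \<le> 1 - z + z\<^sup>2"
  proof -
    have "1 - z + z\<^sup>2 = (z - 1/2)\<^sup>2 + 3/4" by (simp add: power2_eq_square algebra_simps)
    then show ?thesis by simp
  qed
  ultimately have "1 \<le> (1 - z + z\<^sup>2) * exp z"
    using z by (smt (verit, best) mult_left_mono zero_le_power divide_nonneg_nonneg)
  then have "exp (- z) * 1 \<le> exp (- z) * ((1 - z + z\<^sup>2) * exp z)" by simp
  also have "\<dots> = 1 - z + z\<^sup>2" by (simp add: exp_minus)
  finally show ?thesis by (simp add: z_def)
qed

text \<open>The slope 1/2 is the source of the halved expectation in
  \<open>lower_tail_iid\<close>.\<close>

lemma exp_minus_le_chord:
  fixes y :: real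
  assumes "0 \<le> y" "y \<le> 1"
  shows "exp (- y) \<le> 1 - y / 2"
proof -
  have "1 + y + y\<^sup>2 / 2 \<le> exp y" using exp_lower_Taylor_quadratic[OF assms(1)] .
  then have "(1 - y / 2) * (1 + y + y\<^sup>2 / 2) \<le> (1 - y / 2) * exp y"
    using assms by (intro mult_left_mono) auto
  moreover have "(1 - y / 2) * (1 + y + y\<^sup>2 / 2) = 1 + y / 2 * (1 - y * y / 2)"
    by (simp add: power2_eq_square field_simps)
  moreover have "y * y \<le> 1" using assms by (simp add: mult_le_one)
  ultimately have "1 \<le> (1 - y / 2) * exp y"
    using assms by (smt (verit, best) mult_nonneg_nonneg divide_nonneg_nonneg field_sum_of_halves)
  then show ?thesis by (simp add: exp_minus inverse_eq_divide pos_divide_le_eq)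
qed

context prob_space
begin

abbreviation iid :: "nat \<Rightarrow> (nat \<Rightarrow> 'a) measure" where
  "iid n \<equiv> \<Pi>\<^sub>M i\<in>{1..n}. M"

lemma chernoff_iid:
  assumes [measurable]: "Y \<in> borel_measurable M"
    and le: "(\<integral>\<^sup>+x. ennreal (exp (Y x)) \<partial>M) \<le> ennreal (exp c)"
  shows "emeasure (iid n) {\<omega> \<in> space (iid n). real n * c + t \<le> (\<Sum>i=1..n. Y (\<omega> i))} \<le> ennreal (exp (- t))"
proof -
  interpret P: product_sigma_finite "\<lambda>_. M"
    by (simp add: product_sigma_finite_def sigma_finite_measure_axioms)
  let ?k = "exp (- (real n * c + t))"
  have "emeasure (iid n) {\<omega> \<in> space (iid n). real n * c + t \<le> (\<Sum>i=1..n. Y (\<omega> i))}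
     = (\<integral>\<^sup>+\<omega>. indicator {\<omega> \<in> space (iid n). real n * c + t \<le> (\<Sum>i=1..n. Y (\<omega> i))} \<omega> \<partial>iid n)"
    by (rule nn_integral_indicator[symmetric]) measurable
  also have "\<dots> \<le> (\<integral>\<^sup>+\<omega>. ennreal ?k * (\<Prod>i\<in>{1..n}. ennreal (exp (Y (\<omega> i)))) \<partial>iid n)"
  proof (rule nn_integral_mono)
    fix \<omega>
    have "ennreal ?k * (\<Prod>i\<in>{1..n}. ennreal (exp (Y (\<omega> i)))) = ennreal (exp ((\<Sum>i=1..n. Y (\<omega> i)) - (real n * c + t)))"
      by (simp add: prod_ennreal prod_nonneg exp_sum exp_diff exp_minus exp_add field_simps flip: ennreal_mult)
    moreover have "1 \<le> exp ((\<Sum>i=1..n. Y (\<omega> i)) - (real n * c + t))"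
      if "real n * c + t \<le> (\<Sum>i=1..n. Y (\<omega> i))" using that by simp
    ultimately show "indicator {\<omega> \<in> space (iid n). real n * c + t \<le> (\<Sum>i=1..n. Y (\<omega> i))} \<omega>
      \<le> ennreal ?k * (\<Prod>i\<in>{1..n}. ennreal (exp (Y (\<omega> i))))"
      by (auto simp: indicator_def simp del: one_le_exp_iff)
  qed
  also have "\<dots> = ennreal ?k * (\<integral>\<^sup>+\<omega>. (\<Prod>i\<in>{1..n}. ennreal (exp (Y (\<omega> i)))) \<partial>iid n)"
    by (rule nn_integral_cmult) measurable
  also have "\<dots> = ennreal ?k * (\<integral>\<^sup>+x. ennreal (exp (Y x)) \<partial>M) ^ n"
    by (subst P.product_nn_integral_prod) auto
  also have "\<dots> \<le> ennreal ?k * ennreal (exp c) ^ n"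
    by (intro mult_left_mono power_mono le) auto
  also have "\<dots> = ennreal (exp (- t))"
    by (simp add: ennreal_power exp_of_nat_mult[symmetric] flip: ennreal_mult exp_add)
  finally show ?thesis .
qed

text \<open>The quadratic bound is applied to \<open>Y\<close> before centring; after 1 + z \<le>
  exp z the factor coming from the mean cancels the linear term. Hence the sup bound and the raw
  second moment of \<open>Y\<close> itself enter.\<close>

lemma exp_moment_centered:
  assumes [measurable]: "Y \<in> borel_measurable M"
    and b: "\<And>x. x \<in> space M \<Longrightarrow> \<bar>Y x\<bar> \<le> b" and v: "expectation (\<lambda>x. (Y x)\<^sup>2) \<le> v"
    and l: "\<bar>l\<bar> * b \<le> 1"
  shows "(\<integral>\<^sup>+x. ennreal (exp (l * (Y x - expectation Y))) \<partial>M) \<le> ennreal (exp (l\<^sup>2 * v))"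
proof -
  let ?E = "expectation Y"
  have "0 \<le> b" using b not_empty by (meson abs_ge_zero ex_in_conv order_trans)
  have iY: "integrable M Y" by (rule integrable_const_bound[of _ b]) (use b in auto)
  have iY2: "integrable M (\<lambda>x. (Y x)\<^sup>2)"
    by (rule integrable_const_bound[of _ "b\<^sup>2"]) (use b in \<open>auto simp: abs_le_square_iff[symmetric] \<open>0 \<le> b\<close>\<close>)
  have "(\<integral>\<^sup>+x. ennreal (exp (l * (Y x - ?E))) \<partial>M)
     \<le> (\<integral>\<^sup>+x. ennreal (exp (- l * ?E) * (1 + l * Y x + l\<^sup>2 * (Y x)\<^sup>2)) \<partial>M)"
  proof (rule nn_integral_mono)
    fix x assume "x \<in> space M"
    then have "\<bar>l * Y x\<bar> \<le> 1" using mult_left_mono[OF b[of x], of "\<bar>l\<bar>"] l by (simp add: abs_mult)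
    from exp_le_one_plus_sq[OF this]
    have "exp (- l * ?E) * exp (l * Y x) \<le> exp (- l * ?E) * (1 + l * Y x + l\<^sup>2 * (Y x)\<^sup>2)"
      by (simp add: power_mult_distrib)
    then show "ennreal (exp (l * (Y x - ?E))) \<le> ennreal (exp (- l * ?E) * (1 + l * Y x + l\<^sup>2 * (Y x)\<^sup>2))"
      by (intro ennreal_leI) (simp add: algebra_simps flip: exp_add)
  qed
  also have "\<dots> = ennreal (expectation (\<lambda>x. exp (- l * ?E) * (1 + l * Y x + l\<^sup>2 * (Y x)\<^sup>2)))"
  proof (rule nn_integral_eq_integral)
    show "integrable M (\<lambda>x. exp (- l * ?E) * (1 + l * Y x + l\<^sup>2 * (Y x)\<^sup>2))"
      using iY iY2 by auto
    have "0 \<le> 1 + y + y\<^sup>2" for y :: real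
    proof -
      have "1 + y + y\<^sup>2 = (y + 1/2)\<^sup>2 + 3/4" by (simp add: power2_eq_square algebra_simps)
      then show ?thesis by simp
    qed
    from this[of "l * Y x" for x]
    show "AE x in M. 0 \<le> exp (- l * ?E) * (1 + l * Y x + l\<^sup>2 * (Y x)\<^sup>2)"
      by (simp add: power_mult_distrib)
  qed
  also have "expectation (\<lambda>x. exp (- l * ?E) * (1 + l * Y x + l\<^sup>2 * (Y x)\<^sup>2))
      = exp (- l * ?E) * (1 + l * ?E + l\<^sup>2 * expectation (\<lambda>x. (Y x)\<^sup>2))"
    using iY iY2 by (simp add: prob_space)
  also have "ennreal \<dots> \<le> ennreal (exp (- l * ?E) * exp (l * ?E + l\<^sup>2 * v))"
  proof (intro ennreal_leI mult_left_mono)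
    have "1 + l * ?E + l\<^sup>2 * expectation (\<lambda>x. (Y x)\<^sup>2) \<le> 1 + (l * ?E + l\<^sup>2 * v)"
      using mult_left_mono[OF v, of "l\<^sup>2"] by simp
    also have "\<dots> \<le> exp (l * ?E + l\<^sup>2 * v)" by (rule exp_ge_add_one_self)
    finally show "1 + l * ?E + l\<^sup>2 * expectation (\<lambda>x. (Y x)\<^sup>2) \<le> exp (l * ?E + l\<^sup>2 * v)" .
  qed simp
  also have "exp (- l * ?E) * exp (l * ?E + l\<^sup>2 * v) = exp (l\<^sup>2 * v)"
    by (simp flip: exp_add)
  finally show ?thesis .
qed

text \<open>Bernstein's inequality in its Gaussian regime: the last hypothesis says precisely that
  the exponent \<open>l\<close> chosen below satisfies l b \<le> 1, so the deviation carries no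
  linear term.\<close>

lemma bernstein_iid:
  assumes [measurable]: "Y \<in> borel_measurable M"
    and b: "\<And>x. x \<in> space M \<Longrightarrow> \<bar>Y x\<bar> \<le> b" and v: "expectation (\<lambda>x. (Y x)\<^sup>2) \<le> v"
    and pos: "0 < v" "0 < t" "0 < n" and tb: "t * b\<^sup>2 \<le> real n * v"
  shows "emeasure (iid n) {\<omega> \<in> space (iid n). 4 * t * v / real n < ((\<Sum>i=1..n. Y (\<omega> i)) / real n - expectation Y)\<^sup>2}
    \<le> ennreal (2 * exp (- t))"
proof -
  let ?E = "expectation Y"
  have b0: "0 \<le> b" using b not_empty by (meson abs_ge_zero ex_in_conv order_trans)
  \<comment> \<open>This value makes n l^2 v equal to t, so the Chernoff threshold is 2 t. A
    deviation of 2 t / (l n) has square 4 t v / n.\<close>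
  define l where "l = sqrt (t / (real n * v))"
  have l: "0 < l" "l\<^sup>2 = t / (real n * v)" using pos by (auto simp: l_def)
  have "(l * b)\<^sup>2 \<le> 1\<^sup>2" using tb pos by (simp add: power_mult_distrib l field_simps)
  then have lb: "l * b \<le> 1" by (rule power2_le_imp_le) simp
  have tail: "emeasure (iid n) {\<omega> \<in> space (iid n). 2 * t \<le> (\<Sum>i=1..n. a * (Y (\<omega> i) - ?E))} \<le> ennreal (exp (- t))"
    if "a = l \<or> a = - l" for a
  proof -
    have "(\<integral>\<^sup>+x. ennreal (exp (a * (Y x - ?E))) \<partial>M) \<le> ennreal (exp (a\<^sup>2 * v))"
      by (rule exp_moment_centered[OF _ b v]) (use that lb l in auto)
    from chernoff_iid[OF _ this, of n t]
    moreover have "real n * (a\<^sup>2 * v) = t" using that pos l by auto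
    ultimately show ?thesis using that by auto
  qed
  have "emeasure (iid n) {\<omega> \<in> space (iid n). 4 * t * v / real n < ((\<Sum>i=1..n. Y (\<omega> i)) / real n - ?E)\<^sup>2}
    \<le> emeasure (iid n) ({\<omega> \<in> space (iid n). 2 * t \<le> (\<Sum>i=1..n. l * (Y (\<omega> i) - ?E))}
       \<union> {\<omega> \<in> space (iid n). 2 * t \<le> (\<Sum>i=1..n. (- l) * (Y (\<omega> i) - ?E))})"
  proof (rule emeasure_mono)
    show "{\<omega> \<in> space (iid n). 4 * t * v / real n < ((\<Sum>i=1..n. Y (\<omega> i)) / real n - ?E)\<^sup>2}
      \<subseteq> {\<omega> \<in> space (iid n). 2 * t \<le> (\<Sum>i=1..n. l * (Y (\<omega> i) - ?E))}
       \<union> {\<omega> \<in> space (iid n). 2 * t \<le> (\<Sum>i=1..n. (- l) * (Y (\<omega> i) - ?E))}"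
    proof (intro subsetI)
      fix \<omega> assume w: "\<omega> \<in> {\<omega> \<in> space (iid n). 4 * t * v / real n < ((\<Sum>i=1..n. Y (\<omega> i)) / real n - ?E)\<^sup>2}"
      define D where "D = (\<Sum>i=1..n. Y (\<omega> i)) / real n - ?E"
      have s: "(\<Sum>i=1..n. a * (Y (\<omega> i) - ?E)) = a * (real n * D)" for a
        using pos by (simp add: D_def sum_subtractf flip: sum_distrib_left) (simp add: field_simps)
      have "4 * t * v / real n < D\<^sup>2" using w by (simp add: D_def)
      then have "(l * real n)\<^sup>2 * (4 * t * v / real n) < (l * real n)\<^sup>2 * D\<^sup>2"
        using l pos by (intro mult_strict_left_mono) auto
      also have "(l * real n)\<^sup>2 * (4 * t * v / real n) = (2 * t)\<^sup>2"
      proof -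
        have "(l * real n)\<^sup>2 * (4 * t * v / real n) = l\<^sup>2 * (4 * t * v * real n)"
          using pos by (simp add: power2_eq_square)
        then show ?thesis unfolding l(2) using pos by (simp add: power2_eq_square)
      qed
      finally have "(2 * t)\<^sup>2 < (l * (real n * D))\<^sup>2" by (simp add: power_mult_distrib mult.assoc)
      then have "2 * t < \<bar>l * (real n * D)\<bar>"
        using pos by (metis abs_ge_zero power2_abs power2_less_imp_less)
      then have "2 * t \<le> (\<Sum>i=1..n. l * (Y (\<omega> i) - ?E)) \<or> 2 * t \<le> (\<Sum>i=1..n. (- l) * (Y (\<omega> i) - ?E))"
        unfolding s by (simp add: abs_if split: if_splits)
      then show "\<omega> \<in> {\<omega> \<in> space (iid n). 2 * t \<le> (\<Sum>i=1..n. l * (Y (\<omega> i) - ?E))}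
       \<union> {\<omega> \<in> space (iid n). 2 * t \<le> (\<Sum>i=1..n. (- l) * (Y (\<omega> i) - ?E))}"
        using w by blast
    qed
  qed measurable
  also have "\<dots> \<le> emeasure (iid n) {\<omega> \<in> space (iid n). 2 * t \<le> (\<Sum>i=1..n. l * (Y (\<omega> i) - ?E))}
       + emeasure (iid n) {\<omega> \<in> space (iid n). 2 * t \<le> (\<Sum>i=1..n. (- l) * (Y (\<omega> i) - ?E))}"
    by (rule emeasure_subadditive) measurable
  also have "\<dots> \<le> ennreal (exp (- t)) + ennreal (exp (- t))"
    by (intro add_mono tail) auto
  also have "\<dots> = ennreal (2 * exp (- t))" by (simp flip: ennreal_plus)
  finally show ?thesis .
qed

text \<open>Chernoff's bound for -Z / B, with exponential moment controlled by the chord of exp.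
  Giving up half the mean yields an exponent linear in \<delta> that involves no variance.\<close>

lemma lower_tail_iid:
  assumes [measurable]: "Z \<in> borel_measurable M"
    and B: "\<And>x. x \<in> space M \<Longrightarrow> 0 \<le> Z x \<and> Z x \<le> B" and pos: "0 < B" "0 < n"
  shows "emeasure (iid n) {\<omega> \<in> space (iid n). (\<Sum>i=1..n. Z (\<omega> i)) / real n \<le> expectation Z / 2 - \<delta>}
    \<le> ennreal (exp (- (real n * \<delta> / B)))"
proof -
  have iZ: "integrable M Z" by (rule integrable_const_bound[of _ B]) (use B in auto)
  have "(\<integral>\<^sup>+x. ennreal (exp (- (Z x / B))) \<partial>M) \<le> (\<integral>\<^sup>+x. ennreal (1 - Z x / (2 * B)) \<partial>M)"
  proof (rule nn_integral_mono)
    fix x assume "x \<in> space M"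
    then show "ennreal (exp (- (Z x / B))) \<le> ennreal (1 - Z x / (2 * B))"
      using exp_minus_le_chord[of "Z x / B"] B[of x] pos by (intro ennreal_leI) (simp add: field_simps)
  qed
  also have "\<dots> = ennreal (expectation (\<lambda>x. 1 - Z x / (2 * B)))"
  proof (rule nn_integral_eq_integral)
    show "integrable M (\<lambda>x. 1 - Z x / (2 * B))" using iZ by auto
    show "AE x in M. 0 \<le> 1 - Z x / (2 * B)"
    proof (rule AE_I2)
      fix x assume "x \<in> space M"
      then show "0 \<le> 1 - Z x / (2 * B)" using B[of x] pos by (simp add: field_simps)
    qed
  qed
  also have "expectation (\<lambda>x. 1 - Z x / (2 * B)) = 1 + - expectation Z / (2 * B)"
    using iZ by (simp add: prob_space)
  also have "ennreal \<dots> \<le> ennreal (exp (- expectation Z / (2 * B)))"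
    by (intro ennreal_leI exp_ge_add_one_self)
  finally have "(\<integral>\<^sup>+x. ennreal (exp (- (Z x / B))) \<partial>M) \<le> ennreal (exp (- expectation Z / (2 * B)))" .
  from chernoff_iid[OF _ this, of n "real n * \<delta> / B"]
  have *: "emeasure (iid n) {\<omega> \<in> space (iid n). real n * (- expectation Z / (2 * B)) + real n * \<delta> / B \<le> (\<Sum>i=1..n. - (Z (\<omega> i) / B))}
    \<le> ennreal (exp (- (real n * \<delta> / B)))" by simp
  have "real n * (- expectation Z / (2 * B)) + real n * \<delta> / B \<le> (\<Sum>i=1..n. - (Z (\<omega> i) / B))
    \<longleftrightarrow> (\<Sum>i=1..n. Z (\<omega> i)) / real n \<le> expectation Z / 2 - \<delta>" for \<omega>
  proof -
    have "real n * (- expectation Z / (2 * B)) + real n * \<delta> / B = (real n * \<delta> - real n * expectation Z / 2) / B"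
      using pos by (simp add: field_simps)
    moreover have "(\<Sum>i=1..n. - (Z (\<omega> i) / B)) = (- (\<Sum>i=1..n. Z (\<omega> i))) / B"
      by (simp add: sum_negf sum_divide_distrib)
    ultimately show ?thesis using pos by (simp add: divide_le_cancel pos_divide_le_eq) (auto simp: algebra_simps)
  qed
  with * show ?thesis by simp
qed

text \<open>Bernstein's inequality with the unknown second moment replaced by its empirical
  counterpart. The lower tail bound ensures that the empirical value is not much too small, and the
  three tails involved each cost exp (- t).\<close>

lemma empirical_bernstein_iid:
  assumes Ym[measurable]: "Y \<in> borel_measurable M"
    and b: "\<And>x. x \<in> space M \<Longrightarrow> \<bar>Y x\<bar> \<le> b"
    and pos: "0 < b" "0 < q" "0 < t" "0 < n" and tb: "3 * t * b\<^sup>2 \<le> 2 * real n * q"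
  shows "emeasure (iid n) {\<omega> \<in> space (iid n).
      16 * t * q * (1 + (\<Sum>i=1..n. (Y (\<omega> i))\<^sup>2 / q) / real n) / real n
        < 2 * ((\<Sum>i=1..n. Y (\<omega> i)) / real n - expectation Y)\<^sup>2}
    \<le> ennreal (3 * exp (- t))" (is "emeasure _ ?bad \<le> _")
proof -
  define \<mu> where "\<mu> = expectation (\<lambda>x. (Y x)\<^sup>2 / q)"
  have mu0: "0 \<le> \<mu>" using pos by (simp add: \<mu>_def)
  \<comment> \<open>The summand 2/3 is both the floor of the variance proxy and the shift in the
    lower tail event, and solves 2 x + x = 2. Outside \<open>?B\<close> it gives \<mu> + 2/3 \<le> 2
    (1 + m) with m the empirical mean, so 4 t v / n is at most 8 t q (1 + m) / n; doubling produces
    the 16. As a floor and as a shift it turns \<open>tb\<close> into the condition needed each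
    time.\<close>
  let ?v = "q * (\<mu> + 2/3)"
  let ?A = "{\<omega> \<in> space (iid n). 4 * t * ?v / real n < ((\<Sum>i=1..n. Y (\<omega> i)) / real n - expectation Y)\<^sup>2}"
  let ?B = "{\<omega> \<in> space (iid n). (\<Sum>i=1..n. (Y (\<omega> i))\<^sup>2 / q) / real n \<le> \<mu> / 2 - 2/3}"
  have A: "emeasure (iid n) ?A \<le> ennreal (2 * exp (- t))"
  proof (rule bernstein_iid[OF Ym b])
    show "expectation (\<lambda>x. (Y x)\<^sup>2) \<le> ?v" using pos by (simp add: \<mu>_def algebra_simps)
    show "0 < ?v" using pos mu0 by simp
    have "0 \<le> real n * (q * \<mu>)" using pos mu0 by simp
    then show "t * b\<^sup>2 \<le> real n * ?v" using tb by (simp add: algebra_simps)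
  qed (use pos in auto)
  have "emeasure (iid n) ?B \<le> ennreal (exp (- (real n * (2/3) / (b\<^sup>2 / q))))"
    unfolding \<mu>_def
    by (rule lower_tail_iid) (use pos b in \<open>auto simp: divide_right_mono power2_le_iff_abs_le\<close>)
  also have "\<dots> \<le> ennreal (exp (- t))"
    using tb pos by (intro ennreal_leI) (simp add: field_simps)
  finally have B: "emeasure (iid n) ?B \<le> ennreal (exp (- t))" .
  have "?bad \<subseteq> ?A \<union> ?B"
  proof (intro subsetI, rule ccontr)
    fix \<omega> assume w: "\<omega> \<in> ?bad" "\<omega> \<notin> ?A \<union> ?B"
    define m where "m = (\<Sum>i=1..n. (Y (\<omega> i))\<^sup>2 / q) / real n"
    define D where "D = ((\<Sum>i=1..n. Y (\<omega> i)) / real n - expectation Y)\<^sup>2"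
    define W where "W = 16 * t * q * (1 + m) / real n"
    have "\<mu> + 2/3 \<le> 2 * (1 + m)" and D: "D \<le> 4 * t * ?v / real n"
      and bad: "16 * t * q * (1 + m) / real n < 2 * D"
      using w by (auto simp: m_def D_def)
    then have "4 * t * (q * (\<mu> + 2/3)) / real n \<le> 4 * t * (q * (2 * (1 + m))) / real n"
      using pos by (intro divide_right_mono mult_left_mono) auto
    also have "\<dots> = W / 2" by (simp add: W_def)
    finally show False using D bad unfolding W_def[symmetric] by linarith
  qed
  then have "emeasure (iid n) ?bad \<le> emeasure (iid n) (?A \<union> ?B)"
    by (rule emeasure_mono) measurable
  also have "\<dots> \<le> emeasure (iid n) ?A + emeasure (iid n) ?B"
    by (rule emeasure_subadditive) measurable
  also have "\<dots> \<le> ennreal (2 * exp (- t)) + ennreal (exp (- t))" by (intro add_mono A B)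
  also have "\<dots> = ennreal (3 * exp (- t))" by (simp flip: ennreal_plus)
  finally show ?thesis .
qed

text \<open>The excess vanishes off the bad event. On it the deviation is at most 2 b, so the excess
  is at most 8 b^2; the probability bound contributes the remaining factor 3 exp (- t).\<close>

lemma nn_integral_excess_iid:
  assumes Ym[measurable]: "Y \<in> borel_measurable M"
    and b: "\<And>x. x \<in> space M \<Longrightarrow> \<bar>Y x\<bar> \<le> b"
    and pos: "0 < b" "0 < q" "0 < t" "0 < n" and tb: "3 * t * b\<^sup>2 \<le> 2 * real n * q"
  shows "(\<integral>\<^sup>+\<omega>. ennreal (max 0 (2 * ((\<Sum>i=1..n. Y (\<omega> i)) / real n - expectation Y)\<^sup>2
      - 16 * t * q * (1 + (\<Sum>i=1..n. (Y (\<omega> i))\<^sup>2 / q) / real n) / real n)) \<partial>iid n)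
    \<le> ennreal (24 * b\<^sup>2 * exp (- t))"
proof -
  let ?V = "\<lambda>\<omega>. 16 * t * q * (1 + (\<Sum>i=1..n. (Y (\<omega> i))\<^sup>2 / q) / real n) / real n"
  let ?D = "\<lambda>\<omega>. (\<Sum>i=1..n. Y (\<omega> i)) / real n - expectation Y"
  let ?bad = "{\<omega> \<in> space (iid n). ?V \<omega> < 2 * (?D \<omega>)\<^sup>2}"
  have iY: "integrable M Y" by (rule integrable_const_bound[of _ b]) (use b in auto)
  have E: "\<bar>expectation Y\<bar> \<le> b"
  proof -
    have "expectation (\<lambda>x. \<bar>Y x\<bar>) \<le> expectation (\<lambda>_. b)"
      using iY b by (intro integral_mono) auto
    then show ?thesis by (simp add: prob_space) (rule order_trans[OF integral_abs_bound])
  qed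
  have "(\<integral>\<^sup>+\<omega>. ennreal (max 0 (2 * (?D \<omega>)\<^sup>2 - ?V \<omega>)) \<partial>iid n) \<le> (\<integral>\<^sup>+\<omega>. ennreal (8 * b\<^sup>2) * indicator ?bad \<omega> \<partial>iid n)"
  proof (rule nn_integral_mono)
    fix \<omega> assume w: "\<omega> \<in> space (iid n)"
    have "\<bar>\<Sum>i=1..n. Y (\<omega> i)\<bar> \<le> (\<Sum>i=1..n. b)"
      using w b by (intro sum_abs[THEN order_trans] sum_mono) (auto simp: space_PiM PiE_iff)
    then have "\<bar>(\<Sum>i=1..n. Y (\<omega> i)) / real n\<bar> \<le> b" using pos by (simp add: abs_divide field_simps)
    then have "\<bar>?D \<omega>\<bar> \<le> 2 * b" using E by linarith
    then have "\<bar>?D \<omega>\<bar>\<^sup>2 \<le> (2 * b)\<^sup>2" by (rule power_mono) simp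
    then have "(?D \<omega>)\<^sup>2 \<le> (2 * b)\<^sup>2" by simp
    moreover have "0 \<le> ?V \<omega>" using pos by (auto intro!: divide_nonneg_nonneg mult_nonneg_nonneg add_nonneg_nonneg sum_nonneg)
    ultimately show "ennreal (max 0 (2 * (?D \<omega>)\<^sup>2 - ?V \<omega>)) \<le> ennreal (8 * b\<^sup>2) * indicator ?bad \<omega>"
      using w by (auto simp: indicator_def max_def intro!: ennreal_leI)
  qed
  also have "\<dots> = ennreal (8 * b\<^sup>2) * emeasure (iid n) ?bad"
    by (rule nn_integral_cmult_indicator) measurable
  also have "\<dots> \<le> ennreal (8 * b\<^sup>2) * ennreal (3 * exp (- t))"
    by (intro mult_left_mono empirical_bernstein_iid[OF Ym b pos tb]) auto
  also have "\<dots> = ennreal (24 * b\<^sup>2 * exp (- t))" by (simp flip: ennreal_mult)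
  finally show ?thesis .
qed

end

section \<open>Bias and second moment of the kernel\<close>

text \<open>Polar coordinates leave the power d - 1 - 2 \<beta> of r beyond m, integrable since 2
  \<beta> > d.\<close>

lemma nn_integral_tail:
  assumes \<beta>: "real DIM('a::euclidean_space) < 2 * \<beta>" and m: "0 < m"
  shows "(\<integral>\<^sup>+t. ennreal (indicator {m<..} (norm t) * (1 + (norm t)\<^sup>2) powr (- \<beta>)) \<partial>(lborel :: 'a measure))
    \<le> ennreal (sphere_area DIM('a) / (2 * \<beta> - real DIM('a)) * m powr (real DIM('a) - 2 * \<beta>))"
proof -
  let ?d = "DIM('a)"
  have d: "0 < ?d" by simp
  have "(\<integral>\<^sup>+t. ennreal (indicator {m<..} (norm t) * (1 + (norm t)\<^sup>2) powr (- \<beta>)) \<partial>(lborel :: 'a measure))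
    = ennreal (sphere_area ?d) * (\<integral>\<^sup>+r. ennreal (indicator {0<..} r * r ^ (?d - 1)) * ennreal (indicator {m<..} r * (1 + r\<^sup>2) powr (- \<beta>)) \<partial>lborel)"
    by (rule nn_integral_polar) measurable
  also have "\<dots> \<le> ennreal (sphere_area ?d) * (\<integral>\<^sup>+r. ennreal (r powr (real ?d - 1 - 2 * \<beta>)) * indicator {m..} r \<partial>lborel)"
  proof (rule mult_left_mono[OF nn_integral_mono])
    fix r :: real
    show "ennreal (indicator {0<..} r * r ^ (?d - 1)) * ennreal (indicator {m<..} r * (1 + r\<^sup>2) powr (- \<beta>))
      \<le> ennreal (r powr (real ?d - 1 - 2 * \<beta>)) * indicator {m..} r"
    proof (cases "m < r")
      case True
      then have r: "0 < r" using m by simp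
      have "(1 + r\<^sup>2) powr (- \<beta>) \<le> (r\<^sup>2) powr (- \<beta>)"
        using r \<beta> by (intro powr_mono2') auto
      also have "\<dots> = r powr (- 2 * \<beta>)"
      proof -
        have "r\<^sup>2 = r powr 2" using r by simp
        then show ?thesis by (simp only: powr_powr) simp
      qed
      finally have "r ^ (?d - 1) * (1 + r\<^sup>2) powr (- \<beta>) \<le> r powr (real ?d - 1) * r powr (- 2 * \<beta>)"
      proof (intro mult_mono)
        show "r ^ (?d - 1) \<le> r powr (real ?d - 1)"
          using r powr_realpow[of r "?d - 1"] by (simp add: of_nat_diff Suc_leI)
      qed (use r in auto)
      also have "\<dots> = r powr (real ?d - 1 - 2 * \<beta>)" by (simp flip: powr_add)
      finally show ?thesis using True r by (simp add: ennreal_leI flip: ennreal_mult)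
    qed (auto simp: indicator_def)
  qed simp
  also have "(\<integral>\<^sup>+r. ennreal (r powr (real ?d - 1 - 2 * \<beta>)) * indicator {m..} r \<partial>lborel)
     = ennreal (0 - m powr (real ?d - 2 * \<beta>) / (real ?d - 2 * \<beta>))"
  proof (rule nn_integral_FTC_atLeast)
    fix r :: real assume "m \<le> r"
    then have "0 < r" using m by simp
    have eq: "real ?d - 1 - 2 * \<beta> = real ?d - 2 * \<beta> - 1" by simp
    show "DERIV (\<lambda>r. r powr (real ?d - 2 * \<beta>) / (real ?d - 2 * \<beta>)) r :> r powr (real ?d - 1 - 2 * \<beta>)"
      unfolding eq using \<open>0 < r\<close> DERIV_cdivide[OF has_real_derivative_powr, of r "real ?d - 2 * \<beta>" "real ?d - 2 * \<beta>"] \<beta> by simp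
  next
    have "((\<lambda>r. r powr (real ?d - 2 * \<beta>) / (real ?d - 2 * \<beta>)) \<longlongrightarrow> 0 / (real ?d - 2 * \<beta>)) at_top"
      using \<beta> by (intro tendsto_divide tendsto_neg_powr filterlim_ident tendsto_const) auto
    then show "((\<lambda>r. r powr (real ?d - 2 * \<beta>) / (real ?d - 2 * \<beta>)) \<longlongrightarrow> 0) at_top" by simp
  qed auto
  also have "0 - m powr (real ?d - 2 * \<beta>) / (real ?d - 2 * \<beta>) = m powr (real ?d - 2 * \<beta>) / (2 * \<beta> - real ?d)"
    using \<beta> by (simp add: field_simps)
  also have "ennreal (sphere_area ?d) * ennreal (m powr (real ?d - 2 * \<beta>) / (2 * \<beta> - real ?d))
    = ennreal (sphere_area ?d / (2 * \<beta> - real ?d) * m powr (real ?d - 2 * \<beta>))"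
    using \<beta> sphere_area_pos[OF d] by (simp flip: ennreal_mult)
  finally show ?thesis .
qed

text \<open>The product of the two Cauchy-Schwarz factors without their power of m: the Sobolev
  radius and the constant of \<open>nn_integral_tail\<close>. It scales the squared integral of the
  Fourier transform outside a ball.\<close>

definition tail_const :: "nat \<Rightarrow> real \<Rightarrow> real \<Rightarrow> real" where
  "tail_const d L \<beta> = L * (sphere_area d / (2 * \<beta> - real d))"

lemma tail_const_pos: "0 < L \<Longrightarrow> 0 < d \<Longrightarrow> real d < 2 * \<beta> \<Longrightarrow> 0 < tail_const d L \<beta>"
  using sphere_area_pos[of d] by (simp add: tail_const_def)

context
  fixes f :: "'a::euclidean_space \<Rightarrow> real" and L \<beta> :: real
  assumes f: "prob_density f" and sob: "f \<in> sobolev_ellipsoid \<beta> L"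
    and L: "0 < L" and \<beta>: "real DIM('a) < 2 * \<beta>"
begin

context
  notes prob_densityD(1)[OF f, measurable]
begin

text \<open>A density is integrable, so \<open>fourier_transform\<close> takes its integral
  branch.\<close>

lemma char_fun_sobolev: "(\<integral>\<^sup>+t. ennreal ((1 + (norm t)\<^sup>2) powr \<beta> * (cmod (char_fun f t))\<^sup>2) \<partial>lborel) \<le> ennreal L"
  using sob prob_densityD[OF f] by (simp add: sobolev_ellipsoid_def fourier_transform_def)

text \<open>Cauchy-Schwarz against the Sobolev weight, carried out pointwise as a weighted
  arithmetic-geometric inequality so that integrability need not be known beforehand.\<close>

lemma nn_integral_char_fun_tail:
  assumes m: "0 < m"
  shows "(\<integral>\<^sup>+t. ennreal (indicator {m<..} (norm t) * cmod (char_fun f t)) \<partial>lborel)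
    \<le> ennreal (sqrt (tail_const DIM('a) L \<beta> * m powr (real DIM('a) - 2 * \<beta>)))"
proof -
  define J where "J = sphere_area DIM('a) / (2 * \<beta> - real DIM('a)) * m powr (real DIM('a) - 2 * \<beta>)"
  have J: "0 < J" using \<beta> m sphere_area_pos[of "DIM('a)"] by (simp add: J_def)
  \<comment> \<open>The optimal weight: it equalises a L / 2 and J / (2 a), whose sum is then sqrt
    (L J).\<close>
  define a where "a = sqrt (J / L)"
  have a: "0 < a" using J L by (simp add: a_def)
  have "(\<integral>\<^sup>+t. ennreal (indicator {m<..} (norm t) * cmod (char_fun f t)) \<partial>lborel)
    \<le> (\<integral>\<^sup>+t. ennreal (a / 2) * ennreal ((1 + (norm t)\<^sup>2) powr \<beta> * (cmod (char_fun f t))\<^sup>2)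
        + ennreal (1 / (2 * a)) * ennreal (indicator {m<..} (norm t) * (1 + (norm t)\<^sup>2) powr (- \<beta>)) \<partial>lborel)"
  proof (rule nn_integral_mono)
    fix t :: 'a
    define w where "w = (1 + (norm t)\<^sup>2) powr \<beta>"
    define F where "F = cmod (char_fun f t)"
    have w: "0 < w" using add_pos_nonneg[of 1 "(norm t)\<^sup>2"] by (simp add: w_def less_imp_neq[symmetric])
    have "0 \<le> (a * w * F - 1)\<^sup>2" by simp
    then have "(2 * a * w) * F \<le> (a * w * F)\<^sup>2 + 1" by (simp add: power2_diff)
    also have "(a * w * F)\<^sup>2 + 1 = (2 * a * w) * (a / 2 * (w * F\<^sup>2) + 1 / (2 * a) * (1 / w))"
      using a w by (simp add: power2_eq_square field_simps)
    finally have "F \<le> a / 2 * (w * F\<^sup>2) + 1 / (2 * a) * (1 / w)"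
      by (rule mult_left_le_imp_le) (use a w in auto)
    then have "indicator {m<..} (norm t) * F \<le> a / 2 * (w * F\<^sup>2) + 1 / (2 * a) * (indicator {m<..} (norm t) * (1 / w))"
      using a w by (auto simp: indicator_def)
    then show "ennreal (indicator {m<..} (norm t) * cmod (char_fun f t))
      \<le> ennreal (a / 2) * ennreal ((1 + (norm t)\<^sup>2) powr \<beta> * (cmod (char_fun f t))\<^sup>2)
        + ennreal (1 / (2 * a)) * ennreal (indicator {m<..} (norm t) * (1 + (norm t)\<^sup>2) powr (- \<beta>))"
      using a w unfolding powr_minus_divide w_def[symmetric] F_def[symmetric]
      by (simp add: ennreal_leI flip: ennreal_mult ennreal_plus)
  qed
  also have "\<dots> = ennreal (a / 2) * (\<integral>\<^sup>+t. ennreal ((1 + (norm t)\<^sup>2) powr \<beta> * (cmod (char_fun f t))\<^sup>2) \<partial>lborel)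
     + ennreal (1 / (2 * a)) * (\<integral>\<^sup>+t. ennreal (indicator {m<..} (norm t) * (1 + (norm t)\<^sup>2) powr (- \<beta>)) \<partial>(lborel :: 'a measure))"
    by (subst nn_integral_add, measurable, subst nn_integral_cmult, measurable, subst nn_integral_cmult, measurable)
  also have "\<dots> \<le> ennreal (a / 2) * ennreal L + ennreal (1 / (2 * a)) * ennreal J"
    using nn_integral_tail[OF \<beta> m] char_fun_sobolev unfolding J_def by (intro add_mono mult_left_mono) auto
  also have "\<dots> = ennreal (a / 2 * L + 1 / (2 * a) * J)"
    using a L J by (simp flip: ennreal_mult ennreal_plus)
  also have "a / 2 * L + 1 / (2 * a) * J = sqrt (L * J)"
  proof -
    have "J = a * a * L" using J L by (simp add: a_def)
    moreover have "sqrt (L * (a * a * L)) = a * L" using a L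
      by (intro real_sqrt_unique) (auto simp: power2_eq_square)
    ultimately show ?thesis using a by (simp add: field_simps)
  qed
  also have "L * J = tail_const DIM('a) L \<beta> * m powr (real DIM('a) - 2 * \<beta>)"
    by (simp add: J_def tail_const_def)
  finally show ?thesis .
qed

lemma integrable_char_fun: "integrable lborel (\<lambda>t. cmod (char_fun f t))"
proof (rule integrableI_bounded)
  have "(\<integral>\<^sup>+t. ennreal (norm (cmod (char_fun f t))) \<partial>lborel)
    \<le> (\<integral>\<^sup>+t. indicator (cball 0 1) t + ennreal (indicator {1<..} (norm t) * cmod (char_fun f t)) \<partial>lborel)"
    using cmod_char_fun_le_1[OF f] by (intro nn_integral_mono) (auto simp: indicator_def)
  also have "\<dots> = emeasure lborel (cball (0::'a) 1) + (\<integral>\<^sup>+t. ennreal (indicator {1<..} (norm t) * cmod (char_fun f t)) \<partial>lborel)"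
    by (subst nn_integral_add) (auto intro!: borel_measurable_indicator)
  also have "\<dots> < \<infinity>"
    using nn_integral_char_fun_tail[of 1] by (auto simp: emeasure_cball less_top[symmetric] top_unique)
  finally show "(\<integral>\<^sup>+t. ennreal (norm (cmod (char_fun f t))) \<partial>lborel) < \<infinity>" .
qed measurable

text \<open>Inside the unit ball the Fourier transform is at most 1 and the polar volume element
  cancels the singular weight, leaving the area of the sphere. Outside, the weight is at most 1 and
  the tail bound applies.\<close>

lemma nn_integral_char_fun_weighted:
  "(\<integral>\<^sup>+t. ennreal (cmod (char_fun f t) / norm t ^ (DIM('a) - 1)) \<partial>lborel)
    \<le> ennreal (sphere_area DIM('a) + sqrt (tail_const DIM('a) L \<beta>))"
proof -
  let ?d = "DIM('a)"
  have "(\<integral>\<^sup>+t. ennreal (cmod (char_fun f t) / norm t ^ (?d - 1)) \<partial>lborel)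
    \<le> (\<integral>\<^sup>+t. ennreal (indicator {..1} (norm t) / norm t ^ (?d - 1)) + ennreal (indicator {1<..} (norm t) * cmod (char_fun f t)) \<partial>lborel)"
  proof (rule nn_integral_mono)
    fix t :: 'a
    show "ennreal (cmod (char_fun f t) / norm t ^ (?d - 1))
      \<le> ennreal (indicator {..1} (norm t) / norm t ^ (?d - 1)) + ennreal (indicator {1<..} (norm t) * cmod (char_fun f t))"
    proof (cases "norm t \<le> 1")
      case True
      then show ?thesis using cmod_char_fun_le_1[OF f, of t] by (simp add: divide_right_mono ennreal_leI)
    next
      case False
      then have "1 \<le> norm t ^ (?d - 1)" by simp
      then have "cmod (char_fun f t) / norm t ^ (?d - 1) \<le> cmod (char_fun f t) / 1"
        by (intro divide_left_mono) auto
      with False show ?thesis by (simp add: ennreal_leI)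
    qed
  qed
  also have "\<dots> = (\<integral>\<^sup>+t. ennreal (indicator {..1} (norm t) / norm t ^ (?d - 1)) \<partial>(lborel :: 'a measure))
     + (\<integral>\<^sup>+t. ennreal (indicator {1<..} (norm t) * cmod (char_fun f t)) \<partial>lborel)"
    by (rule nn_integral_add) measurable
  also have "(\<integral>\<^sup>+t. ennreal (indicator {..1} (norm t) / norm t ^ (?d - 1)) \<partial>(lborel :: 'a measure))
     = ennreal (sphere_area ?d) * (\<integral>\<^sup>+r. ennreal (indicator {0<..} r * r ^ (?d - 1)) * ennreal (indicator {..1} r / r ^ (?d - 1)) \<partial>lborel)"
    by (rule nn_integral_polar) measurable
  also have "(\<integral>\<^sup>+r. ennreal (indicator {0<..} r * r ^ (?d - 1)) * ennreal (indicator {..1} r / r ^ (?d - 1)) \<partial>lborel)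
     = (\<integral>\<^sup>+r. indicator {0<..1::real} r \<partial>lborel)"
    by (intro nn_integral_cong) (auto simp: indicator_def simp flip: ennreal_mult)
  also have "\<dots> = 1" by simp
  also have "(\<integral>\<^sup>+t. ennreal (indicator {1<..} (norm t) * cmod (char_fun f t)) \<partial>lborel) \<le> ennreal (sqrt (tail_const ?d L \<beta>))"
    using nn_integral_char_fun_tail[of 1] by simp
  finally show ?thesis
    using sphere_area_pos[of ?d] tail_const_pos[OF L _ \<beta>] by (simp add: add_left_mono ennreal_plus)
qed

end

end

section \<open>Size, scaling and decay of the kernel\<close>

definition kern_scale :: "nat \<Rightarrow> real" where
  "kern_scale d = sphere_area d / (2 * pi) ^ d"

lemma kern_scale_pos: "0 < d \<Longrightarrow> 0 < kern_scale d"
  by (simp add: kern_scale_def sphere_area_pos)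

lemma integrable_kern_weight: "integrable lborel (\<lambda>r::real. indicator {0<..} r * (c * r ^ k * indicator {..m} r))"
proof -
  have "integrable lborel (\<lambda>r::real. indicator {0..m} r *\<^sub>R (c * r ^ k))"
    by (rule borel_integrable_compact) (auto intro!: continuous_intros)
  then show ?thesis
  proof (rule integrable_cong_AE_imp)
    show "AE r in lborel. indicator {0..m} r *\<^sub>R (c * r ^ k) = indicator {0<..} r * (c * r ^ k * indicator {..m} r)"
      using AE_lborel_singleton[of 0] by eventually_elim (auto simp: indicator_def)
  qed measurable
qed

text \<open>The form required by \<open>expectation_radial_cosine_transform\<close>: a Lebesgue
  cosine transform on the half-line, with a truncated power as weight.\<close>

lemma kern_eq_integral:
  "kern d m u = (\<integral>r. indicator {0<..} r * (kern_scale d * r ^ (d - 1) * indicator {..m} r) * cos (u * r) \<partial>lborel)"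
proof -
  have "integral {0..m} (\<lambda>r. r ^ (d - 1) * cos (u * r)) = (LINT r:{0..m}|lborel. r ^ (d - 1) * cos (u * r))"
    by (intro set_borel_integral_eq_integral(2)[symmetric] borel_integrable_atLeastAtMost')
       (auto intro!: continuous_intros)
  also have "\<dots> = (\<integral>r. indicator {0<..} r * (r ^ (d - 1) * indicator {..m} r) * cos (u * r) \<partial>lborel)"
    unfolding set_lebesgue_integral_def
  proof (rule integral_cong_AE)
    show "AE r in lborel. indicator {0..m} r *\<^sub>R (r ^ (d - 1) * cos (u * r)) = indicator {0<..} r * (r ^ (d - 1) * indicator {..m} r) * cos (u * r)"
      using AE_lborel_singleton[of 0] by eventually_elim (auto simp: indicator_def)
  qed measurable
  finally have "kern d m u = kern_scale d * (\<integral>r. indicator {0<..} r * (r ^ (d - 1) * indicator {..m} r) * cos (u * r) \<partial>lborel)"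
    by (simp add: kern_def kern_scale_def)
  also have "\<dots> = (\<integral>r. kern_scale d * (indicator {0<..} r * (r ^ (d - 1) * indicator {..m} r) * cos (u * r)) \<partial>lborel)"
    by (rule integral_mult_right_zero[symmetric])
  finally show ?thesis by (simp add: mult_ac)
qed

lemma kern_measurable[measurable]: "kern d m \<in> borel_measurable borel"
  unfolding kern_eq_integral[abs_def] by measurable

text \<open>The substitution r = m r' reduces every cutoff to the kernel at cutoff 1, the one that
  occurs in \<open>mu_hat\<close>.\<close>

lemma kern_rescale:
  assumes m: "0 < m" and d: "0 < d"
  shows "kern d m u = m ^ d * kern d 1 (m * u)"
proof -
  let ?g = "\<lambda>m u r. indicator {0<..} r * (kern_scale d * r ^ (d - 1) * indicator {..m} r) * cos (u * r) :: real"
  have md: "m * m ^ (d - 1) = m ^ d" using d by (cases d) auto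
  have "kern d m u = \<bar>m\<bar> *\<^sub>R (\<integral>r. ?g m u (0 + m * r) \<partial>lborel)"
    unfolding kern_eq_integral using m by (intro lborel_integral_real_affine) simp
  also have "(\<integral>r. ?g m u (0 + m * r) \<partial>lborel) = (\<integral>r. m ^ (d - 1) * ?g 1 (m * u) r \<partial>lborel)"
    using m by (intro Bochner_Integration.integral_cong refl)
      (auto simp: indicator_def power_mult_distrib zero_less_mult_iff mult_ac)
  also have "\<dots> = m ^ (d - 1) * kern d 1 (m * u)"
    unfolding kern_eq_integral by (rule integral_mult_right_zero)
  also have "\<bar>m\<bar> *\<^sub>R (m ^ (d - 1) * kern d 1 (m * u)) = (m * m ^ (d - 1)) * kern d 1 (m * u)"
    using m by simp
  finally show ?thesis by (simp only: md)
qed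

lemma abs_kern_1_le:
  assumes d: "0 < d"
  shows "\<bar>kern d 1 u\<bar> \<le> kern_scale d / real d"
proof -
  have "norm (integral {0..1} (\<lambda>r. r ^ (d - 1) * cos (u * r))) \<le> integral {0..1::real} (\<lambda>r. r ^ (d - 1))"
    by (rule integral_norm_bound_integral) (auto intro!: integrable_continuous_real continuous_intros simp: abs_mult mult_left_le)
  also have "integral {0..1::real} (\<lambda>r. r ^ (d - 1)) = 1 / real d"
  proof (rule integral_unique)
    have "((\<lambda>r. r ^ (d - 1)) has_integral (1 ^ d / real d - 0 ^ d / real d)) {0..1::real}"
      using d by (intro fundamental_theorem_of_calculus)
        (auto intro!: derivative_eq_intros simp flip: has_real_derivative_iff_has_vector_derivative)
    then show "((\<lambda>r. r ^ (d - 1)) has_integral 1 / real d) {0..1::real}" using d by (simp add: zero_power)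
  qed
  finally have *: "\<bar>integral {0..1} (\<lambda>r. r ^ (d - 1) * cos (u * r))\<bar> \<le> 1 / real d" by simp
  have "\<bar>kern d 1 u\<bar> = kern_scale d * \<bar>integral {0..1} (\<lambda>r. r ^ (d - 1) * cos (u * r))\<bar>"
  proof -
    have "kern d 1 u = kern_scale d * integral {0..1} (\<lambda>r. r ^ (d - 1) * cos (u * r))"
      by (simp add: kern_def kern_scale_def)
    then show ?thesis using kern_scale_pos[OF d] by (simp only: abs_mult abs_of_pos)
  qed
  also have "\<dots> \<le> kern_scale d * (1 / real d)"
    using kern_scale_pos[OF d] * by (intro mult_left_mono) auto
  finally show ?thesis by simp
qed

text \<open>Integration by parts: the boundary term is sin u, and the remaining integral is at most
  that of (d - 1) r^(d-2), which is 1.\<close>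

lemma abs_kern_1_decay:
  assumes d: "2 \<le> d"
  shows "\<bar>u * kern d 1 u\<bar> \<le> 2 * kern_scale d"
proof -
  let ?I = "integral {0..1} (\<lambda>r. r ^ (d - 1) * cos (u * r))"
  let ?J = "integral {0..1} (\<lambda>r. real (d - 1) * r ^ (d - 2) * sin (u * r))"
  have d2: "d - 1 - Suc 0 = d - 2" "d - Suc (Suc 0) = d - 2" by (simp_all add: numeral_2_eq_2)
  have "((\<lambda>r. u * (r ^ (d - 1) * cos (u * r)) + real (d - 1) * r ^ (d - 2) * sin (u * r)) has_integral
      (1 ^ (d - 1) * sin (u * 1) - 0 ^ (d - 1) * sin (u * 0))) {0..1}"
    by (intro fundamental_theorem_of_calculus)
       (auto intro!: derivative_eq_intros simp: d2 simp flip: has_real_derivative_iff_has_vector_derivative)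
  moreover have "((\<lambda>r. u * (r ^ (d - 1) * cos (u * r)) + real (d - 1) * r ^ (d - 2) * sin (u * r)) has_integral (u * ?I + ?J)) {0..1}"
    by (intro has_integral_add has_integral_mult_right integrable_integral integrable_continuous_real continuous_intros)
  ultimately have eq: "u * ?I + ?J = sin u" by (auto dest: has_integral_unique)
  have "norm ?J \<le> integral {0..1} (\<lambda>r. real (d - 1) * r ^ (d - 2))"
    by (rule integral_norm_bound_integral) (auto intro!: integrable_continuous_real continuous_intros simp: abs_mult mult_left_le)
  also have "\<dots> = 1"
  proof (rule integral_unique)
    have "((\<lambda>r. real (d - 1) * r ^ (d - 2)) has_integral (1 ^ (d - 1) - 0 ^ (d - 1))) {0..1::real}"
      by (intro fundamental_theorem_of_calculus)
         (auto intro!: derivative_eq_intros simp: d2 simp flip: has_real_derivative_iff_has_vector_derivative)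
    then show "((\<lambda>r. real (d - 1) * r ^ (d - 2)) has_integral 1) {0..1::real}" using d by (simp add: zero_power)
  qed
  finally have "\<bar>?J\<bar> \<le> 1" by (simp only: real_norm_def)
  then have "\<bar>u * ?I\<bar> \<le> 2" using eq abs_sin_le_one[of u] by linarith
  moreover have "0 \<le> kern_scale d" using kern_scale_pos[of d] d by simp
  ultimately have "kern_scale d * \<bar>u * ?I\<bar> \<le> kern_scale d * 2" by (intro mult_left_mono)
  moreover have "\<bar>u * kern d 1 u\<bar> = kern_scale d * \<bar>u * ?I\<bar>"
  proof -
    have "u * kern d 1 u = kern_scale d * (u * ?I)" by (simp add: kern_def kern_scale_def)
    then show ?thesis using \<open>0 \<le> kern_scale d\<close> by (metis abs_mult abs_of_nonneg)
  qed
  ultimately show ?thesis by simp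
qed

text \<open>With c the kernel scale, c bounds the kernel and 2 c bounds u times the kernel; adding
  the squares gives 1 + 4 = 5. The majorant is a Cauchy density up to scale.\<close>

lemma kern_1_squared_le:
  assumes d: "2 \<le> d"
  shows "(kern d 1 u)\<^sup>2 \<le> 5 * (kern_scale d)\<^sup>2 / (1 + u\<^sup>2)"
proof -
  have c: "0 < kern_scale d" using kern_scale_pos d by simp
  have "\<bar>kern d 1 u\<bar> \<le> kern_scale d / real d" using d by (intro abs_kern_1_le) simp
  also have "\<dots> \<le> kern_scale d" using c d by (simp add: field_simps)
  finally have "\<bar>kern d 1 u\<bar>\<^sup>2 \<le> (kern_scale d)\<^sup>2" by (rule power_mono) simp
  moreover have "\<bar>u * kern d 1 u\<bar>\<^sup>2 \<le> (2 * kern_scale d)\<^sup>2" by (rule power_mono[OF abs_kern_1_decay[OF d]]) simp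
  ultimately have "(kern d 1 u)\<^sup>2 * (1 + u\<^sup>2) \<le> 5 * (kern_scale d)\<^sup>2"
    by (simp add: power_mult_distrib algebra_simps)
  then show ?thesis by (simp add: pos_le_divide_eq add_pos_nonneg)
qed

lemma exp_cos_integral:
  fixes a u :: real
  assumes a: "0 < a"
  shows "integrable lborel (\<lambda>r. indicator {0<..} r * exp (- a * r))"
    and "(\<integral>r. indicator {0<..} r * exp (- a * r) * cos (u * r) \<partial>lborel) = a / (a\<^sup>2 + u\<^sup>2)"
proof -
  have "(\<integral>\<^sup>+r. ennreal (exp (- a * r)) * indicator {0..} r \<partial>lborel) = ennreal (0 - (- exp (- a * 0) / a))"
  proof (rule nn_integral_FTC_atLeast)
    show "((\<lambda>r. - exp (- a * r) / a) \<longlongrightarrow> 0) at_top" using a by real_asymp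
  qed (use a in \<open>auto intro!: derivative_eq_intros\<close>)
  then have "integrable lborel (\<lambda>r. exp (- a * r) * indicator {0..} r)"
    by (intro integrableI_nonneg) (auto simp: ennreal_mult ennreal_indicator)
  then show i: "integrable lborel (\<lambda>r. indicator {0<..} r * exp (- a * r))"
  proof (rule integrable_cong_AE_imp)
    show "AE r in lborel. exp (- a * r) * indicator {0..} r = indicator {0<..} r * exp (- a * r)"
      using AE_lborel_singleton[of 0] by eventually_elim (auto simp: indicator_def)
  qed measurable
  let ?h = "\<lambda>r. indicator {0<..} r * exp (- a * r) * cos (u * r)"
  have ih: "integrable lborel ?h"
    by (rule Bochner_Integration.integrable_bound[OF i]) (auto simp: abs_mult mult_left_le)
  \<comment> \<open>An antiderivative of exp (- a r) cos (u r), vanishing at infinity.\<close>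
  define G where "G r = exp (- a * r) * (u * sin (u * r) - a * cos (u * r)) / (a\<^sup>2 + u\<^sup>2)" for r
  have pos: "0 < a\<^sup>2 + u\<^sup>2" using a by (simp add: add_pos_nonneg)
  have "((\<lambda>y. \<integral>r. indicator {..y} r *\<^sub>R ?h r \<partial>lborel) \<longlongrightarrow> integral\<^sup>L lborel ?h) at_top"
    by (rule tendsto_integral_at_top[OF _ ih]) simp
  moreover have "\<forall>\<^sub>F y in at_top. (\<integral>r. indicator {..y} r *\<^sub>R ?h r \<partial>lborel) = G y - G 0"
    using eventually_ge_at_top[of "0::real"]
  proof eventually_elim
    case (elim y)
    have "(\<integral>r. indicator {..y} r *\<^sub>R ?h r \<partial>lborel) = (\<integral>r. indicator {0..y} r *\<^sub>R (exp (- a * r) * cos (u * r)) \<partial>lborel)"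
    proof (rule integral_cong_AE)
      show "AE r in lborel. indicator {..y} r *\<^sub>R ?h r = indicator {0..y} r *\<^sub>R (exp (- a * r) * cos (u * r))"
        using AE_lborel_singleton[of 0] by eventually_elim (auto simp: indicator_def)
    qed measurable
    also have "\<dots> = G y - G 0"
    proof (rule integral_FTC_atLeastAtMost[OF elim])
      fix r
      have "((\<lambda>r. exp (- a * r) * (u * sin (u * r) - a * cos (u * r))) has_real_derivative
          (a\<^sup>2 + u\<^sup>2) * (exp (- a * r) * cos (u * r))) (at r within {0..y})"
        by (auto intro!: derivative_eq_intros simp: algebra_simps power2_eq_square)
      from DERIV_cdivide[OF this, of "a\<^sup>2 + u\<^sup>2"] a
      have "(G has_real_derivative exp (- a * r) * cos (u * r)) (at r within {0..y})"
        unfolding G_def[abs_def] by simp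
      then show "(G has_vector_derivative exp (- a * r) * cos (u * r)) (at r within {0..y})"
        by (simp add: has_real_derivative_iff_has_vector_derivative)
    qed (intro continuous_intros)
    finally show ?case .
  qed
  ultimately have "((\<lambda>y. G y - G 0) \<longlongrightarrow> integral\<^sup>L lborel ?h) at_top"
    by (rule Lim_transform_eventually)
  moreover have "((\<lambda>y. G y - G 0) \<longlongrightarrow> 0 - G 0) at_top"
  proof (intro tendsto_diff tendsto_const)
    have Gb: "\<bar>G y\<bar> \<le> (\<bar>u\<bar> + a) / (a\<^sup>2 + u\<^sup>2) * exp (- a * y)" for y
    proof -
      have "\<bar>u * sin (u * y) - a * cos (u * y)\<bar> \<le> \<bar>u * sin (u * y)\<bar> + \<bar>a * cos (u * y)\<bar>" by simp
      also have "\<dots> \<le> \<bar>u\<bar> + a" using a by (intro add_mono) (simp_all add: abs_mult mult_left_le)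
      finally have "exp (- a * y) * \<bar>u * sin (u * y) - a * cos (u * y)\<bar> / (a\<^sup>2 + u\<^sup>2)
          \<le> exp (- a * y) * (\<bar>u\<bar> + a) / (a\<^sup>2 + u\<^sup>2)"
        using pos by (intro divide_right_mono mult_left_mono) auto
      moreover have "\<bar>G y\<bar> = exp (- a * y) * \<bar>u * sin (u * y) - a * cos (u * y)\<bar> / (a\<^sup>2 + u\<^sup>2)"
        using pos by (simp only: G_def abs_mult abs_divide abs_exp_cancel abs_of_pos)
      moreover have "exp (- a * y) * (\<bar>u\<bar> + a) / (a\<^sup>2 + u\<^sup>2) = (\<bar>u\<bar> + a) / (a\<^sup>2 + u\<^sup>2) * exp (- a * y)" by simp
      ultimately show ?thesis by (simp only:)
    qed
    have "((\<lambda>y. (\<bar>u\<bar> + a) / (a\<^sup>2 + u\<^sup>2) * exp (- a * y)) \<longlongrightarrow> (\<bar>u\<bar> + a) / (a\<^sup>2 + u\<^sup>2) * 0) at_top"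
    proof (intro tendsto_mult tendsto_const)
      show "((\<lambda>y. exp (- a * y)) \<longlongrightarrow> 0) at_top" using a by real_asymp
    qed
    then have lim: "((\<lambda>y. (\<bar>u\<bar> + a) / (a\<^sup>2 + u\<^sup>2) * exp (- a * y)) \<longlongrightarrow> 0) at_top" by (simp only: mult_zero_right)
    show "(G \<longlongrightarrow> 0) at_top"
      by (rule Lim_null_comparison[OF always_eventually lim]) (simp only: real_norm_def Gb, simp)
  qed
  ultimately have "integral\<^sup>L lborel ?h = 0 - G 0"
    by (rule tendsto_unique[OF trivial_limit_at_top_linorder])
  then show "integral\<^sup>L lborel ?h = a / (a\<^sup>2 + u\<^sup>2)" by (simp add: G_def)
qed

text \<open>The ratio is the volume of the unit ball over (2 pi)^d, and the ball lies in a cube of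
  volume 2^d, whence pi^(-d). This numerical margin later keeps Bernstein's inequality in its
  Gaussian regime for every \<open>n \<ge> 2\<close> and absorbs the factor 24 in the expected
  excess.\<close>

lemma kern_scale_le:
  assumes "DIM('a::euclidean_space) \<ge> 2"
  shows "kern_scale DIM('a) / real DIM('a) \<le> 1 / 9"
proof -
  let ?d = "DIM('a)"
  have "emeasure lborel (cball (0::'a) 1) \<le> emeasure lborel (cbox (- One) One :: 'a set)"
  proof (intro emeasure_mono subsetI)
    fix x :: 'a assume "x \<in> cball 0 1"
    then have "\<bar>x \<bullet> i\<bar> \<le> 1" if "i \<in> Basis" for i using Basis_le_norm[OF that, of x] by simp
    then show "x \<in> cbox (- One) One" by (force simp: mem_box abs_le_iff)
  qed simp
  also have "\<dots> = ennreal (2 ^ ?d)"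
    by (subst emeasure_lborel_cbox) (auto simp: inner_add_left)
  finally have v: "unit_ball_vol (real ?d) \<le> 2 ^ ?d" by (simp add: emeasure_cball)
  have "kern_scale ?d / real ?d = unit_ball_vol (real ?d) / (2 * pi) ^ ?d"
    by (simp add: kern_scale_def flip: DIM_unit_ball_vol)
  also have "\<dots> \<le> 2 ^ ?d / (2 * pi) ^ ?d" using v by (intro divide_right_mono) auto
  also have "\<dots> = 1 / pi ^ ?d" by (simp add: power_mult_distrib)
  also have "\<dots> \<le> 1 / 3 ^ 2"
  proof (rule divide_left_mono)
    have "(3::real) ^ 2 \<le> 3 ^ ?d" using assms by (intro power_increasing) auto
    also have "\<dots> \<le> pi ^ ?d" using pi_gt3 by (intro power_mono) auto
    finally show "(3::real) ^ 2 \<le> pi ^ ?d" .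
  qed auto
  finally show ?thesis by simp
qed

section \<open>Moments of the kernel under the law of an observation\<close>

lemma sets_radon_law[measurable_cong]: "sets (radon_law f) = sets (sphere_measure \<Otimes>\<^sub>M lborel)"
  by (simp add: radon_law_def)

lemma space_radon_law: "space (radon_law f) = sphere 0 1 \<times> UNIV"
  by (simp add: radon_law_def space_pair_measure)

lemma prob_space_radon_law:
  assumes f: "prob_density f"
  shows "prob_space (radon_law f)"
proof -
  interpret S: prob_space uniform_sphere by (rule prob_space_uniform_sphere)
  interpret D: prob_space "density lborel (\<lambda>y. ennreal (f y))" by (rule prob_densityD(5)[OF f])
  interpret P: pair_prob_space uniform_sphere "density lborel (\<lambda>y. ennreal (f y))" ..
  show ?thesis unfolding radon_law_eq_distr[OF f]
    by (rule P.P.prob_space_distr) (simp add: case_prod_beta')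
qed

lemma fst_radon_measurable[measurable]: "fst \<in> borel_measurable (radon_law f)"
  using measurable_fst_sphere(1)[of lborel] by (simp cong: measurable_cong_sets add: sets_radon_law)

lemma snd_radon_measurable[measurable]: "snd \<in> borel_measurable (radon_law f)"
proof -
  have "snd \<in> (sphere_measure \<Otimes>\<^sub>M lborel) \<rightarrow>\<^sub>M (borel :: real measure)" by simp
  then show ?thesis by (simp cong: measurable_cong_sets add: sets_radon_law)
qed

text \<open>The factor 5 and the squared scale come from the Cauchy majorant of the squared kernel,
  the bracket from \<open>nn_integral_char_fun_weighted\<close>. Neither involves the cutoff, the
  point x or the density.\<close>

definition second_moment_const :: "nat \<Rightarrow> real \<Rightarrow> real \<Rightarrow> real" where
  "second_moment_const d L \<beta> = 5 * (kern_scale d)\<^sup>2 * (sphere_area d + sqrt (tail_const d L \<beta>)) / sphere_area d"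

context
  fixes f :: "'a::euclidean_space \<Rightarrow> real" and L \<beta> :: real
  assumes f: "prob_density f" and sob: "f \<in> sobolev_ellipsoid \<beta> L"
    and L: "0 < L" and \<beta>: "real DIM('a) < 2 * \<beta>"
begin

context
  notes prob_densityD(1)[OF f, measurable]
begin

text \<open>The Cauchy kernel \<open>m / (1 + m\<^sup>2 u\<^sup>2)\<close> is the cosine transform of \<open>exp (- r / m)\<close>, so dominating the
  squared kernel by it replaces a sup-norm bound on the density of \<open>S \<bullet> x - U\<close>.\<close>

lemma expectation_squared_kern_le:
  assumes d: "2 \<le> DIM('a)" and m: "0 < m"
  shows "(\<integral>p. m * (kern DIM('a) 1 (m * (fst p \<bullet> x - snd p)))\<^sup>2 \<partial>radon_law f) \<le> second_moment_const DIM('a) L \<beta>"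
proof -
  let ?d = "DIM('a)"
  let ?c = "kern_scale ?d" and ?\<rho> = "sphere_area ?d"
  interpret M: prob_space "radon_law f" by (rule prob_space_radon_law[OF f])
  have \<rho>: "0 < ?\<rho>" by (simp add: sphere_area_pos)
  define W where "W u = (\<integral>r. indicator {0<..} r * exp (- (1 / m) * r) * cos (u * r) \<partial>lborel)" for u
  have W: "W u = m / (1 + (m * u)\<^sup>2)" for u
  proof -
    have "W u = (1 / m) / ((1 / m)\<^sup>2 + u\<^sup>2)"
      unfolding W_def by (rule exp_cos_integral(2)) (use m in simp)
    also have "\<dots> = m / (1 + (m * u)\<^sup>2)"
    proof -
      have "(1 / m)\<^sup>2 + u\<^sup>2 = (1 + (m * u)\<^sup>2) / m\<^sup>2" using m by (simp add: field_simps)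
      then show ?thesis using m by (simp add: power2_eq_square)
    qed
    finally show ?thesis .
  qed
  have Wb: "\<bar>W u\<bar> \<le> m" and Wn: "0 \<le> W u" for u
  proof -
    have pos: "0 < 1 + (m * u)\<^sup>2" by (simp add: add_pos_nonneg)
    then have "m / (1 + (m * u)\<^sup>2) \<le> m / 1" using m by (intro divide_left_mono) auto
    then show "0 \<le> W u" "\<bar>W u\<bar> \<le> m" using m by (auto simp: W)
  qed
  have Wm[measurable]: "W \<in> borel_measurable borel" unfolding W[abs_def] by measurable
  have le: "m * (kern ?d 1 (m * u))\<^sup>2 \<le> 5 * ?c\<^sup>2 * W u" for u
    using mult_left_mono[OF kern_1_squared_le[OF d, of "m * u"], of m] m by (simp add: W mult_ac)
  have iW: "integrable (radon_law f) (\<lambda>p. 5 * ?c\<^sup>2 * W (fst p \<bullet> x - snd p))"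
    by (intro integrable_mult_right M.integrable_const_bound[of _ m]) (use Wb in auto)
  have iK: "integrable (radon_law f) (\<lambda>p. m * (kern ?d 1 (m * (fst p \<bullet> x - snd p)))\<^sup>2)"
    by (rule Bochner_Integration.integrable_bound[OF iW]) (use m le order_trans[OF le abs_ge_self] in auto)
  have gint: "integrable lborel (\<lambda>t. cmod (char_fun f t) / norm t ^ (?d - 1))"
    using nn_integral_char_fun_weighted[OF f sob L \<beta>]
    by (intro integrableI_nonneg) (auto simp: less_top[symmetric] top_unique)
  have "ennreal (\<integral>t. cmod (char_fun f t) / norm t ^ (?d - 1) \<partial>lborel) \<le> ennreal (?\<rho> + sqrt (tail_const ?d L \<beta>))"
    using nn_integral_char_fun_weighted[OF f sob L \<beta>] by (subst (asm) nn_integral_eq_integral[OF gint]) auto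
  then have gle: "(\<integral>t. cmod (char_fun f t) / norm t ^ (?d - 1) \<partial>lborel) \<le> ?\<rho> + sqrt (tail_const ?d L \<beta>)"
    using \<rho> tail_const_pos[OF L _ \<beta>] by (subst (asm) ennreal_le_iff) auto
  have "(\<integral>p. m * (kern ?d 1 (m * (fst p \<bullet> x - snd p)))\<^sup>2 \<partial>radon_law f)
    \<le> (\<integral>p. 5 * ?c\<^sup>2 * W (fst p \<bullet> x - snd p) \<partial>radon_law f)"
    by (rule integral_mono[OF iK iW le])
  also have "\<dots> = 5 * ?c\<^sup>2 * (\<integral>p. W (fst p \<bullet> x - snd p) \<partial>radon_law f)" by simp
  also have "(\<integral>p. W (fst p \<bullet> x - snd p) \<partial>radon_law f)
    = (\<integral>t. exp (- (1 / m) * norm t) / norm t ^ (?d - 1) * inv_integrand f x t \<partial>lborel) / ?\<rho>"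
    unfolding W_def by (rule expectation_radial_cosine_transform[OF f]) (use exp_cos_integral(1)[of "1 / m"] m in auto)
  also have "\<dots> \<le> (?\<rho> + sqrt (tail_const ?d L \<beta>)) / ?\<rho>"
  \<comment> \<open>The damping factor exp (- norm t / m) is at most 1, which frees the bound from
    m.\<close>
  proof (intro divide_right_mono order_trans[OF _ gle] integral_mono'[OF gint])
    fix t
    have "exp (- (1 / m) * norm t) * inv_integrand f x t \<le> exp (- (1 / m) * norm t) * cmod (char_fun f t)"
      using order_trans[OF abs_ge_self abs_inv_integrand_le[OF prob_densityD(3)[OF f]], of x t] by (intro mult_left_mono) auto
    also have "\<dots> \<le> 1 * cmod (char_fun f t)" using m by (intro mult_right_mono) auto
    finally have "exp (- (1 / m) * norm t) * inv_integrand f x t \<le> cmod (char_fun f t)" by simp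
    then show "exp (- (1 / m) * norm t) / norm t ^ (?d - 1) * inv_integrand f x t \<le> cmod (char_fun f t) / norm t ^ (?d - 1)"
      by (simp add: divide_right_mono)
  qed (use \<rho> in auto)
  finally show ?thesis by (simp add: second_moment_const_def mult_left_mono)
qed

text \<open>Taking expectations cancels the power of r in the kernel and leaves the inversion
  integrand on the ball of radius m, so the bias is its integral over the complement. There (2 pi)^d
  \<ge> 1 is dropped and the tail bound applies.\<close>

lemma kern_bias:
  assumes m: "0 < m"
  shows "\<bar>(\<integral>p. kern DIM('a) m (fst p \<bullet> x - snd p) \<partial>radon_law f) - inv_fourier f x\<bar>\<^sup>2
    \<le> tail_const DIM('a) L \<beta> * m powr (real DIM('a) - 2 * \<beta>)"
proof -
  let ?d = "DIM('a)" and ?i = "inv_integrand f x"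
  have \<rho>: "0 < sphere_area ?d" by (simp add: sphere_area_pos)
  note Fint = integrable_char_fun[OF f sob L \<beta>]
  have iint: "integrable lborel ?i" by (rule integrable_inv_integrand[OF f Fint])
  have iint': "integrable lborel (\<lambda>t. indicator {..m} (norm t) * ?i t)" "integrable lborel (\<lambda>t. indicator {m<..} (norm t) * ?i t)"
    by (rule Bochner_Integration.integrable_bound[OF iint]; auto simp: indicator_def)+
  have Fint': "integrable lborel (\<lambda>t. indicator {m<..} (norm t) * cmod (char_fun f t))"
    by (rule Bochner_Integration.integrable_bound[OF Fint]) (auto simp: indicator_def)
  have "(\<integral>p. kern ?d m (fst p \<bullet> x - snd p) \<partial>radon_law f)
    = (\<integral>t. (kern_scale ?d * norm t ^ (?d - 1) * indicator {..m} (norm t)) / norm t ^ (?d - 1) * ?i t \<partial>lborel) / sphere_area ?d"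
    unfolding kern_eq_integral
    by (rule expectation_radial_cosine_transform[OF f _ integrable_kern_weight]) measurable
  also have "(\<integral>t. (kern_scale ?d * norm t ^ (?d - 1) * indicator {..m} (norm t)) / norm t ^ (?d - 1) * ?i t \<partial>lborel)
    = (\<integral>t. kern_scale ?d * (indicator {..m} (norm t) * ?i t) \<partial>lborel)"
  proof (rule integral_cong_AE)
    \<comment> \<open>The cancellation requires t to be nonzero, hence only an equality almost
      everywhere.\<close>
    show "AE t in lborel. (kern_scale ?d * norm t ^ (?d - 1) * indicator {..m} (norm t)) / norm t ^ (?d - 1) * ?i t
      = kern_scale ?d * (indicator {..m} (norm t) * ?i t)"
      using AE_lborel_singleton[of "0::'a"] by eventually_elim auto
  qed measurable
  also have "\<dots> = kern_scale ?d * (\<integral>t. indicator {..m} (norm t) * ?i t \<partial>lborel)" by simp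
  finally have E: "(\<integral>p. kern ?d m (fst p \<bullet> x - snd p) \<partial>radon_law f) = (\<integral>t. indicator {..m} (norm t) * ?i t \<partial>lborel) / (2 * pi) ^ ?d"
    using \<rho> by (simp add: kern_scale_def)
  have "(\<integral>t. ?i t \<partial>lborel) = (\<integral>t. indicator {..m} (norm t) * ?i t + indicator {m<..} (norm t) * ?i t \<partial>lborel)"
    by (intro Bochner_Integration.integral_cong) (auto simp: indicator_def)
  also have "\<dots> = (\<integral>t. indicator {..m} (norm t) * ?i t \<partial>lborel) + (\<integral>t. indicator {m<..} (norm t) * ?i t \<partial>lborel)"
    by (rule Bochner_Integration.integral_add[OF iint'])
  finally have "\<bar>(\<integral>p. kern ?d m (fst p \<bullet> x - snd p) \<partial>radon_law f) - inv_fourier f x\<bar>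
    = \<bar>\<integral>t. indicator {m<..} (norm t) * ?i t \<partial>lborel\<bar> / (2 * pi) ^ ?d"
    unfolding E inv_fourier_def by (simp add: add_divide_distrib abs_divide)
  also have "\<dots> \<le> \<bar>\<integral>t. indicator {m<..} (norm t) * ?i t \<partial>lborel\<bar> / 1"
  proof (intro divide_left_mono)
    have "1 \<le> 2 * pi" using pi_gt3 by simp
    then show "1 \<le> (2 * pi) ^ ?d" by (rule one_le_power)
  qed auto
  also have "\<dots> \<le> (\<integral>t. \<bar>indicator {m<..} (norm t) * ?i t\<bar> \<partial>lborel)" by simp
  also have "\<dots> \<le> (\<integral>t. indicator {m<..} (norm t) * cmod (char_fun f t) \<partial>lborel)"
    by (rule integral_mono[OF integrable_abs[OF iint'(2)] Fint'])
       (auto simp: abs_mult indicator_def abs_inv_integrand_le[OF prob_densityD(3)[OF f]])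
  also have "\<dots> \<le> sqrt (tail_const ?d L \<beta> * m powr (real ?d - 2 * \<beta>))"
  proof -
    have "ennreal (\<integral>t. indicator {m<..} (norm t) * cmod (char_fun f t) \<partial>lborel) \<le> ennreal (sqrt (tail_const ?d L \<beta> * m powr (real ?d - 2 * \<beta>)))"
      using nn_integral_char_fun_tail[OF f sob L \<beta> m] by (subst (asm) nn_integral_eq_integral[OF Fint']) auto
    then show ?thesis using tail_const_pos[OF L _ \<beta>] by (subst (asm) ennreal_le_iff) auto
  qed
  finally show ?thesis
    using power_mono[of "\<bar>_\<bar>" _ 2] tail_const_pos[OF L _ \<beta>] by (fastforce simp: real_sqrt_pow2)
qed

end

end

section \<open>Oracle inequality and choice of the cutoff\<close>

lemma square_add_le: "(a + b)\<^sup>2 \<le> 2 * a\<^sup>2 + 2 * b\<^sup>2" for a b :: real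
  using zero_le_power2[of "a - b"] by (simp add: power2_diff power2_sum)

lemma square_add3_le: "(a + b + c)\<^sup>2 \<le> 3 * a\<^sup>2 + 3 * b\<^sup>2 + 3 * c\<^sup>2" for a b c :: real
  using zero_le_power2[of "a - b"] zero_le_power2[of "a - c"] zero_le_power2[of "b - c"]
  by (simp add: power2_eq_square algebra_simps)

text \<open>The deterministic part of the Goldenshluger-Lepski method. The error at
  \<open>mh\<close> passes through the estimators at \<open>min mh m0\<close> and at
  \<open>m0\<close>; the first two increments are controlled by \<open>A\<close> at
  \<open>m0\<close> and at \<open>mh\<close>, and minimality trades \<open>mh\<close> for
  \<open>m0\<close>. The 2 in the excess comes from splitting a difference of estimators into two
  stochastic errors.\<close>

lemma oracle_inequality:
  fixes est e V B A :: "nat \<Rightarrow> real" and M :: "nat set" and \<tau> :: real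
  assumes fin: "finite M" and m0: "m0 \<in> M" and mh: "mh \<in> M"
    and V: "\<And>m. m \<in> M \<Longrightarrow> 0 \<le> V m"
    and bias: "\<And>m. m \<in> M \<Longrightarrow> \<bar>e m - \<tau>\<bar> \<le> B m"
    and B: "\<And>m. m \<in> M \<Longrightarrow> m0 \<le> m \<Longrightarrow> B m \<le> B m0"
    and A: "\<And>m. A m = (SUP m'\<in>M. max 0 (\<bar>est (min m' m) - est m'\<bar>\<^sup>2 - V m'))"
    and arg: "A mh + V mh \<le> A m0 + V m0"
  shows "\<bar>est mh - \<tau>\<bar>\<^sup>2 \<le> 21 * (\<Sum>m\<in>M. max 0 (2 * (est m - e m)\<^sup>2 - V m)) + 21 * V m0 + 102 * (B m0)\<^sup>2"
proof -
  define N where "N m = (est m - e m)\<^sup>2" for m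
  define Z where "Z m = max 0 (2 * N m - V m)" for m
  define S where "S = (\<Sum>m\<in>M. Z m)"
  have Z0: "0 \<le> Z m" for m by (simp add: Z_def)
  have ZS: "Z m \<le> S" if "m \<in> M" for m
    unfolding S_def using fin that Z0 by (intro member_le_sum) auto
  have S0: "0 \<le> S" unfolding S_def by (intro sum_nonneg Z0)
  have N0: "2 * N m0 \<le> S + V m0"
    using ZS[OF m0] by (simp add: Z_def)
  have up: "max 0 (\<bar>est (min m' m) - est m'\<bar>\<^sup>2 - V m') \<le> A m" if "m' \<in> M" for m m'
    unfolding A using fin that by (intro cSUP_upper bdd_above_finite) auto
  have B0: "0 \<le> B m0" using bias[OF m0] by linarith
  \<comment> \<open>Only m > m0 matters, since otherwise the difference vanishes. There 2 N m - V m
    is at most S, 4 N m0 at most 2 S + 2 V m0, and 4 D^2 at most 16 (B m0)^2.\<close>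
  have A0: "A m0 \<le> 3 * S + 2 * V m0 + 16 * (B m0)\<^sup>2"
    unfolding A
  proof (rule cSUP_least)
    fix m assume m: "m \<in> M"
    have R: "0 \<le> 3 * S + 2 * V m0 + 16 * (B m0)\<^sup>2" using S0 V[OF m0] by simp
    show "max 0 (\<bar>est (min m m0) - est m\<bar>\<^sup>2 - V m) \<le> 3 * S + 2 * V m0 + 16 * (B m0)\<^sup>2"
    proof (cases "m \<le> m0")
      case True
      then show ?thesis using V[OF m] R by (simp add: min_absorb1)
    next
      case False
      then have mm: "min m m0 = m0" "m0 \<le> m" by auto
      define D where "D = e m0 - e m"
      have "\<bar>D\<bar> \<le> 2 * B m0"
        using bias[OF m0] bias[OF m] B[OF m mm(2)] unfolding D_def by linarith
      then have "\<bar>D\<bar>\<^sup>2 \<le> (2 * B m0)\<^sup>2" by (rule power_mono) simp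
      then have D: "D\<^sup>2 \<le> 4 * (B m0)\<^sup>2" by (simp add: power_mult_distrib)
      define Q where "Q = \<bar>est m0 - est m\<bar>\<^sup>2"
      have "Q = ((- (est m - e m)) + ((est m0 - e m0) + D))\<^sup>2"
        by (simp add: Q_def D_def algebra_simps)
      also have "\<dots> \<le> 2 * (- (est m - e m))\<^sup>2 + 2 * ((est m0 - e m0) + D)\<^sup>2" by (rule square_add_le)
      also have "\<dots> \<le> 2 * N m + 2 * (2 * N m0 + 2 * D\<^sup>2)"
        using square_add_le[of "est m0 - e m0" D] unfolding N_def by (simp only: power2_minus) (intro add_left_mono mult_left_mono, auto)
      finally have "Q \<le> 2 * N m + 4 * N m0 + 4 * D\<^sup>2" by simp
      moreover have "2 * N m - V m \<le> Z m" by (simp add: Z_def)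
      ultimately have "Q - V m \<le> 3 * S + 2 * V m0 + 16 * (B m0)\<^sup>2"
        using N0 D ZS[OF m] by linarith
      then show ?thesis using R by (simp add: mm(1) Q_def)
    qed
  qed (use m0 in auto)
  have a: "(est mh - est (min mh m0))\<^sup>2 \<le> A m0 + V mh"
    using up[OF mh, of m0] by (simp add: power2_commute)
  have b: "(est (min mh m0) - est m0)\<^sup>2 \<le> A mh + V m0"
    using up[OF m0, of mh] by (simp add: min.commute)
  have "\<bar>e m0 - \<tau>\<bar>\<^sup>2 \<le> (B m0)\<^sup>2" using bias[OF m0] by (rule power_mono) simp
  then have c: "(est m0 - \<tau>)\<^sup>2 \<le> S + V m0 + 2 * (B m0)\<^sup>2"
    using square_add_le[of "est m0 - e m0" "e m0 - \<tau>"] N0 by (simp add: N_def)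
  have "\<bar>est mh - \<tau>\<bar>\<^sup>2 = ((est mh - est (min mh m0)) + (est (min mh m0) - est m0) + (est m0 - \<tau>))\<^sup>2" by simp
  also have "\<dots> \<le> 3 * (est mh - est (min mh m0))\<^sup>2 + 3 * (est (min mh m0) - est m0)\<^sup>2 + 3 * (est m0 - \<tau>)\<^sup>2"
    by (rule square_add3_le)
  \<comment> \<open>By \<open>arg\<close>, a and b together cost at most 2 (A m0 + V m0). With A0
    this gives 6 (3 S + 3 V m0 + 16 (B m0)^2), and c adds 3 (S + V m0 + 2 (B m0)^2).\<close>
  also have "\<dots> \<le> 21 * S + 21 * V m0 + 102 * (B m0)\<^sup>2"
    using a b c arg A0 by linarith
  finally show ?thesis by (simp add: S_def Z_def N_def)
qed

section \<open>Elementary bounds on the cutoffs\<close>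

lemma cutoffsD:
  assumes d: "2 \<le> d" and n: "2 \<le> n" and m: "m \<in> cutoffs d n"
  shows "1 \<le> m" "m ^ (2 * d - 1) \<le> n" "m\<^sup>2 \<le> n"
proof -
  show m1: "1 \<le> m" using m by (simp add: cutoffs_def)
  have "real m ^ (2 * d - 1) \<le> (real n powr (1 / (2 * real d - 1))) ^ (2 * d - 1)"
    using m by (intro power_mono) (auto simp: cutoffs_def)
  also have "\<dots> = real n powr (1 / (2 * real d - 1) * real (2 * d - 1))"
    using n by (simp add: powr_realpow[symmetric] powr_powr del: of_nat_diff)
  also have "1 / (2 * real d - 1) * real (2 * d - 1) = 1"
    using d by (simp add: of_nat_diff)
  finally have "real (m ^ (2 * d - 1)) \<le> real n" using n by simp
  then show p: "m ^ (2 * d - 1) \<le> n" by (simp only: of_nat_le_iff)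
  have "m\<^sup>2 \<le> m ^ (2 * d - 1)" using m1 d by (intro power_increasing) auto
  with p show "m\<^sup>2 \<le> n" by simp
qed

lemma finite_cutoffs:
  assumes "2 \<le> d" "2 \<le> n"
  shows "finite (cutoffs d n)"
proof (rule finite_subset)
  show "cutoffs d n \<subseteq> {..n}"
  proof
    fix m assume "m \<in> cutoffs d n"
    from cutoffsD[OF assms this] have "1 \<le> m" "m * m \<le> n" by (auto simp: power2_eq_square)
    then have "m * 1 \<le> n" by (meson le_trans mult_le_mono2)
    then show "m \<in> {..n}" by simp
  qed
qed simp

text \<open>The largest cutoff s bounds both the number of cutoffs and each of them, and its square
  is at most n. Excesses of order m / n^2 therefore add up to 1 / n.\<close>

lemma sum_cutoffs_le:
  assumes "2 \<le> d" "2 \<le> n"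
  shows "(\<Sum>m\<in>cutoffs d n. m) \<le> n"
proof (cases "cutoffs d n = {}")
  case False
  note fin = finite_cutoffs[OF assms]
  define s where "s = Max (cutoffs d n)"
  have s: "s \<in> cutoffs d n" "\<And>m. m \<in> cutoffs d n \<Longrightarrow> m \<le> s"
    using fin False by (auto simp: s_def)
  have "cutoffs d n \<subseteq> {1..s}" using s cutoffsD(1)[OF assms] by auto
  then have "card (cutoffs d n) \<le> s" using card_mono[of "{1..s}"] by fastforce
  moreover have "(\<Sum>m\<in>cutoffs d n. m) \<le> card (cutoffs d n) * s"
    using sum_bounded_above[of "cutoffs d n" "\<lambda>m. m" s] s by simp
  ultimately have "(\<Sum>m\<in>cutoffs d n. m) \<le> s * s" by (meson le_trans mult_le_mono1)
  also have "\<dots> \<le> n" using cutoffsD(3)[OF assms s(1)] by (simp add: power2_eq_square)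
  finally show ?thesis .
qed simp

text \<open>Precise enough to give \<open>real m * ln (real n) \<le> 2 * real n\<close> on the
  cutoffs and \<open>2 * ln (real n) \<le> real n\<close>, both for every
  \<open>n \<ge> 2\<close>.\<close>

lemma ln_le_two_sqrt: "0 < x \<Longrightarrow> ln x \<le> 2 * sqrt x - 2"
proof -
  assume x: "0 < x"
  have "ln x = ln (sqrt x * sqrt x)" using x by simp
  also have "\<dots> = 2 * ln (sqrt x)" using x by (subst ln_mult_pos) auto
  also have "\<dots> \<le> 2 * (sqrt x - 1)" using ln_le_minus_one[of "sqrt x"] x by simp
  finally show ?thesis by simp
qed

lemma V_hat_nonneg:
  assumes "0 \<le> \<kappa>"
  shows "0 \<le> V_hat \<kappa> n \<omega> x m"
proof -
  have "0 \<le> mu_hat n \<omega> x m"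
    unfolding mu_hat_def by (intro divide_nonneg_nonneg sum_nonneg mult_nonneg_nonneg) auto
  moreover have "0 \<le> ln (real n)" by (cases "n = 0") auto
  ultimately show ?thesis
    unfolding V_hat_def using assms
    by (intro divide_nonneg_nonneg mult_nonneg_nonneg add_nonneg_nonneg zero_le_power) auto
qed

section \<open>Expected excess, expected penalty and risk\<close>

context
  fixes f :: "'a::euclidean_space \<Rightarrow> real" and L \<beta> \<kappa> :: real and x :: 'a and n :: nat
  assumes f: "prob_density f" and sob: "f \<in> sobolev_ellipsoid \<beta> L"
    and L: "0 < L" and \<beta>: "real DIM('a) < 2 * \<beta>"
    and d: "2 \<le> DIM('a)" and n: "2 \<le> n" and \<kappa>: "24 \<le> \<kappa>"
begin

definition mean_estimator :: "nat \<Rightarrow> real" where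
  "mean_estimator m = (\<integral>p. kern DIM('a) (real m) (fst p \<bullet> x - snd p) \<partial>radon_law f)"

text \<open>An instance of \<open>nn_integral_excess_iid\<close>: dividing the squared kernel by
  m^(2d-1) turns its empirical mean into \<open>mu_hat\<close>, so the penalty has exactly the
  self-normalised form.\<close>

lemma nn_integral_excess:
  assumes m: "m \<in> cutoffs DIM('a) n"
  shows "(\<integral>\<^sup>+\<omega>. ennreal (max 0 (2 * (estimator n \<omega> x (real m) - mean_estimator m)\<^sup>2 - V_hat \<kappa> n \<omega> x m)) \<partial>sample_law n f)
    \<le> ennreal (real m / (real n)\<^sup>2)"
proof -
  let ?d = "DIM('a)"
  interpret M: prob_space "radon_law f" by (rule prob_space_radon_law[OF f])
  note mD = cutoffsD[OF d n m]
  have m1: "1 \<le> real m" and mp: "0 < real m" using mD(1) by auto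
  have ln0: "0 < ln (real n)" using n by simp
  define k where "k = kern_scale ?d / real ?d"
  have k0: "0 < k" using kern_scale_pos[of ?d] by (simp add: k_def)
  have k9: "k \<le> 1 / 9" unfolding k_def by (rule kern_scale_le[OF d])
  have "k\<^sup>2 \<le> (1 / 9)\<^sup>2" using k0 k9 by (intro power_mono) auto
  then have k2: "k\<^sup>2 \<le> 1 / 81" by (simp add: power2_eq_square)
  define Y where "Y p = kern ?d (real m) (fst p \<bullet> x - snd p)" for p :: "'a \<times> real"
  define b where "b = k * real m ^ ?d"
  \<comment> \<open>The normalisation hidden in \<open>mu_hat\<close>: rescaling puts m^(2d) in
    front of the squared kernel at cutoff 1, and dividing by q leaves the single factor m.\<close>
  define q where "q = real m ^ (2 * ?d - 1)"
  \<comment> \<open>The factor 3 makes 16 t equal to 2 * 24 * ln n, the penalty at constant 24, and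
    exp (- t) equal to n^(-3).\<close>
  define t where "t = 3 * ln (real n)"
  have q0: "0 < q" and b0: "0 < b" and t0: "0 < t" using mp k0 ln0 by (auto simp: q_def b_def t_def)
  have mq: "(real m ^ ?d)\<^sup>2 = q * real m"
  proof -
    have "(real m ^ ?d)\<^sup>2 = real m ^ (2 * ?d)" by (simp add: power_mult[symmetric] mult.commute)
    also have "2 * ?d = Suc (2 * ?d - 1)" using d by simp
    finally show ?thesis by (simp only: q_def power_Suc2)
  qed
  have b2: "b\<^sup>2 = k\<^sup>2 * (q * real m)" by (simp add: b_def power_mult_distrib mq)
  have Y: "Y p = real m ^ ?d * kern ?d 1 (real m * (fst p \<bullet> x - snd p))" for p
    unfolding Y_def by (rule kern_rescale[OF mp]) simp
  have Yb: "\<bar>Y p\<bar> \<le> b" for p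
    using mult_left_mono[OF abs_kern_1_le[of ?d "real m * (fst p \<bullet> x - snd p)"], of "real m ^ ?d"]
    by (simp add: Y b_def k_def abs_mult mult.commute)
  have Y2: "(Y p)\<^sup>2 / q = real m * (kern ?d 1 (real m * (fst p \<bullet> x - snd p)))\<^sup>2" for p
    using q0 by (simp add: Y power_mult_distrib mq)
  have Ym: "Y \<in> borel_measurable (radon_law f)" unfolding Y_def[abs_def] by measurable
  have "real m * real m \<le> real n"
    using mD(3) by (metis of_nat_le_iff of_nat_mult power2_eq_square)
  then have ms: "real m \<le> sqrt (real n)" by (intro real_le_rsqrt) (simp add: power2_eq_square)
  have "real m * ln (real n) \<le> sqrt (real n) * (2 * sqrt (real n))"
    using ms ln_le_two_sqrt[of "real n"] n ln0 by (intro mult_mono) auto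
  also have "sqrt (real n) * (2 * sqrt (real n)) = 2 * real n"
    by (simp only: mult.left_commute[of _ 2] real_sqrt_mult_self abs_of_nat)
  finally have ml: "real m * ln (real n) \<le> 2 * real n" .
  have tb: "3 * t * b\<^sup>2 \<le> 2 * real n * q"
  proof -
    have "k\<^sup>2 * (real m * ln (real n)) \<le> 1 / 81 * (2 * real n)"
      by (rule mult_mono[OF k2 ml]) (use mp ln0 in auto)
    then have "9 * q * (k\<^sup>2 * (real m * ln (real n))) \<le> 9 * q * (1 / 81 * (2 * real n))"
      using q0 by (intro mult_left_mono) auto
    also have "\<dots> \<le> 2 * real n * q" using q0 by simp
    finally show ?thesis by (simp add: t_def b2 mult_ac)
  qed
  have "(\<integral>\<^sup>+\<omega>. ennreal (max 0 (2 * (estimator n \<omega> x (real m) - mean_estimator m)\<^sup>2 - V_hat \<kappa> n \<omega> x m)) \<partial>sample_law n f)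
    \<le> (\<integral>\<^sup>+\<omega>. ennreal (max 0 (2 * ((\<Sum>i=1..n. Y (\<omega> i)) / real n - M.expectation Y)\<^sup>2
      - 16 * t * q * (1 + (\<Sum>i=1..n. (Y (\<omega> i))\<^sup>2 / q) / real n) / real n)) \<partial>M.iid n)"
    unfolding sample_law_def
  proof (intro nn_integral_mono ennreal_leI max.mono order_refl)
    fix \<omega> :: "nat \<Rightarrow> 'a \<times> real"
    have mu: "(\<Sum>i=1..n. (Y (\<omega> i))\<^sup>2 / q) / real n = mu_hat n \<omega> x m"
      by (simp add: mu_hat_def Y2)
    have mu0: "0 \<le> mu_hat n \<omega> x m" unfolding mu_hat_def by (intro divide_nonneg_nonneg sum_nonneg) auto
    have "16 * t * q * (1 + mu_hat n \<omega> x m) / real n = 2 * 24 * ((1 + mu_hat n \<omega> x m) * q * ln (real n) / real n)"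
      by (simp add: t_def)
    also have "\<dots> \<le> 2 * \<kappa> * ((1 + mu_hat n \<omega> x m) * q * ln (real n) / real n)"
      using \<kappa> mu0 q0 ln0 by (intro mult_right_mono) auto
    also have "\<dots> = V_hat \<kappa> n \<omega> x m" by (simp add: V_hat_def q_def)
    finally show "2 * (estimator n \<omega> x (real m) - mean_estimator m)\<^sup>2 - V_hat \<kappa> n \<omega> x m
      \<le> 2 * ((\<Sum>i=1..n. Y (\<omega> i)) / real n - M.expectation Y)\<^sup>2
      - 16 * t * q * (1 + (\<Sum>i=1..n. (Y (\<omega> i))\<^sup>2 / q) / real n) / real n"
      unfolding mu by (simp add: estimator_def mean_estimator_def Y_def[abs_def])
  qed
  also have "\<dots> \<le> ennreal (24 * b\<^sup>2 * exp (- t))"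
    by (rule M.nn_integral_excess_iid[OF Ym Yb b0 q0 t0 _ tb]) (use n in simp)
  also have "\<dots> \<le> ennreal (real m / (real n)\<^sup>2)"
  proof (rule ennreal_leI)
    have qn: "q \<le> real n" using mD(2) unfolding q_def by (metis of_nat_le_iff of_nat_power)
    have e: "exp (- t) = 1 / (real n) ^ 3"
      using n by (simp add: t_def exp_minus field_simps exp_of_nat_mult[of 3, simplified])
    \<comment> \<open>Here b^2 = k^2 q m with q \<le> n, and k^2 \<le> 1/81 absorbs the 24. One of
      the three powers of n in exp (- t) is spent on q.\<close>
    have "24 * b\<^sup>2 \<le> real n * real m"
    proof -
      have "24 * k\<^sup>2 \<le> 1" using k2 by simp
      then have "(24 * k\<^sup>2) * (q * real m) \<le> 1 * (real n * real m)"
        using qn q0 mp by (intro mult_mono) auto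
      then show ?thesis by (simp add: b2)
    qed
    then have "24 * b\<^sup>2 * exp (- t) \<le> real n * real m * (1 / (real n) ^ 3)"
      unfolding e by (rule mult_right_mono) simp
    also have "\<dots> = real m / (real n)\<^sup>2" using n by (simp add: power2_eq_square power3_eq_cube)
    finally show "24 * b\<^sup>2 * exp (- t) \<le> real m / (real n)\<^sup>2" .
  qed
  finally show ?thesis .
qed

text \<open>The penalty is affine in an empirical mean whose expectation
  \<open>expectation_squared_kern_le\<close> bounds uniformly in m, x and f.\<close>

lemma nn_integral_V_hat:
  assumes m: "0 < m"
  shows "(\<integral>\<^sup>+\<omega>. ennreal (V_hat \<kappa> n \<omega> x m) \<partial>sample_law n f)
    \<le> ennreal (2 * \<kappa> * (1 + second_moment_const DIM('a) L \<beta>) * real m ^ (2 * DIM('a) - 1) * ln (real n) / real n)"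
proof -
  let ?d = "DIM('a)"
  interpret M: prob_space "radon_law f" by (rule prob_space_radon_law[OF f])
  interpret P: product_prob_space "\<lambda>_. radon_law f" "{1..n}" ..
  define h where "h p = real m * (kern ?d 1 (real m * (fst p \<bullet> x - snd p)))\<^sup>2" for p :: "'a \<times> real"
  have hm[measurable]: "h \<in> borel_measurable (radon_law f)" unfolding h_def[abs_def] by measurable
  have h0: "0 \<le> h p" for p by (simp add: h_def)
  define a where "a = 2 * \<kappa> * real m ^ (2 * ?d - 1) * ln (real n) / real n"
  have a0: "0 \<le> a" using \<kappa> n by (simp add: a_def)
  have comp: "(\<integral>\<^sup>+\<omega>. ennreal (h (\<omega> j)) \<partial>sample_law n f) \<le> ennreal (second_moment_const ?d L \<beta>)" if j: "j \<in> {1..n}" for j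
  proof -
    have "(\<integral>\<^sup>+\<omega>. ennreal (h (\<omega> j)) \<partial>sample_law n f) = (\<integral>\<^sup>+p. ennreal (h p) \<partial>distr (M.iid n) (radon_law f) (\<lambda>\<omega>. \<omega> j))"
      unfolding sample_law_def using j by (subst nn_integral_distr) auto
    also have "\<dots> = (\<integral>\<^sup>+p. ennreal (h p) \<partial>radon_law f)" by (subst P.PiM_component[OF j]) simp
    also have "\<dots> = ennreal (M.expectation h)"
    proof (rule nn_integral_eq_integral)
      have "\<bar>kern ?d 1 u\<bar>\<^sup>2 \<le> (kern_scale ?d / real ?d)\<^sup>2" for u by (rule power_mono[OF abs_kern_1_le]) auto
      then have "norm (h p) \<le> real m * (kern_scale ?d / real ?d)\<^sup>2" for p
        unfolding h_def by (simp add: abs_mult mult_left_mono)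
      then show "integrable (radon_law f) h" by (intro M.integrable_const_bound[of _ "real m * (kern_scale ?d / real ?d)\<^sup>2"]) auto
    qed (simp add: h0)
    also have "\<dots> \<le> ennreal (second_moment_const ?d L \<beta>)"
      unfolding h_def[abs_def] using m by (intro ennreal_leI expectation_squared_kern_le[OF f sob L \<beta> d]) simp
    finally show ?thesis .
  qed
  have c0: "0 \<le> second_moment_const ?d L \<beta>"
    using tail_const_pos[OF L _ \<beta>] sphere_area_pos[of ?d] by (simp add: second_moment_const_def)
  have "(\<integral>\<^sup>+\<omega>. ennreal (V_hat \<kappa> n \<omega> x m) \<partial>sample_law n f)
    = (\<integral>\<^sup>+\<omega>. ennreal a + ennreal (a / real n) * (\<Sum>j=1..n. ennreal (h (\<omega> j))) \<partial>sample_law n f)"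
  proof (rule nn_integral_cong)
    fix \<omega> :: "nat \<Rightarrow> 'a \<times> real"
    have "V_hat \<kappa> n \<omega> x m = a + a / real n * (\<Sum>j=1..n. h (\<omega> j))"
      by (simp add: V_hat_def mu_hat_def a_def h_def algebra_simps add_divide_distrib)
    then show "ennreal (V_hat \<kappa> n \<omega> x m) = ennreal a + ennreal (a / real n) * (\<Sum>j=1..n. ennreal (h (\<omega> j)))"
    proof -
      have "(\<Sum>j=1..n. ennreal (h (\<omega> j))) = ennreal (\<Sum>j=1..n. h (\<omega> j))" by (intro sum_ennreal h0)
      moreover have "0 \<le> (\<Sum>j=1..n. h (\<omega> j))" by (intro sum_nonneg h0)
      moreover have "0 \<le> a / real n" using a0 by simp
      ultimately show ?thesis
        using a0 \<open>V_hat \<kappa> n \<omega> x m = _\<close> by (simp only: ennreal_plus ennreal_mult mult_nonneg_nonneg)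
    qed
  qed
  also have "\<dots> = ennreal a * emeasure (sample_law n f) (space (sample_law n f))
      + ennreal (a / real n) * (\<Sum>j=1..n. \<integral>\<^sup>+\<omega>. ennreal (h (\<omega> j)) \<partial>sample_law n f)"
    unfolding sample_law_def
    by (subst nn_integral_add, measurable, subst nn_integral_cmult, measurable, subst nn_integral_sum, measurable)
  also have "emeasure (sample_law n f) (space (sample_law n f)) = 1"
    unfolding sample_law_def by (rule P.emeasure_space_1)
  also have "ennreal a * 1 + ennreal (a / real n) * (\<Sum>j=1..n. \<integral>\<^sup>+\<omega>. ennreal (h (\<omega> j)) \<partial>sample_law n f)
    \<le> ennreal a * 1 + ennreal (a / real n) * (\<Sum>j=1..n. ennreal (second_moment_const ?d L \<beta>))"
    by (intro add_left_mono mult_left_mono sum_mono comp) auto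
  also have "\<dots> = ennreal (a + a / real n * (real n * second_moment_const ?d L \<beta>))"
    using a0 c0 by (simp add: ennreal_of_nat_eq_real_of_nat flip: ennreal_mult ennreal_plus)
  also have "a + a / real n * (real n * second_moment_const ?d L \<beta>)
    = 2 * \<kappa> * (1 + second_moment_const ?d L \<beta>) * real m ^ (2 * ?d - 1) * ln (real n) / real n"
    using n by (simp add: a_def field_simps)
  finally show ?thesis .
qed

lemma estimator_measurable[measurable]: "(\<lambda>\<omega>. estimator n \<omega> x m) \<in> borel_measurable (sample_law n f)"
  unfolding sample_law_def estimator_def by measurable

lemma V_hat_measurable[measurable]: "(\<lambda>\<omega>. V_hat \<kappa> n \<omega> x m) \<in> borel_measurable (sample_law n f)"
  unfolding sample_law_def V_hat_def mu_hat_def by measurable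

text \<open>The integral of \<open>oracle_inequality\<close> over the sample: the excesses sum to at
  most 1 / n, the penalty at \<open>m0\<close> contributes its expectation, and the bias bound is
  deterministic.\<close>

lemma risk_oracle_bound:
  assumes sel: "cutoff_selection \<kappa> n x m_hat" and m0: "m0 \<in> cutoffs DIM('a) n"
  shows "(\<integral>\<^sup>+\<omega>. ennreal (\<bar>estimator n \<omega> x (real (m_hat \<omega>)) - continuous_version f x\<bar>\<^sup>2) \<partial>sample_law n f)
    \<le> ennreal (21 * (1 / real n)
      + 21 * (2 * \<kappa> * (1 + second_moment_const DIM('a) L \<beta>) * real m0 ^ (2 * DIM('a) - 1) * ln (real n) / real n)
      + 102 * (tail_const DIM('a) L \<beta> * real m0 powr (real DIM('a) - 2 * \<beta>)))"
proof -
  let ?d = "DIM('a)" and ?M = "cutoffs DIM('a) n"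
  let ?W = "2 * \<kappa> * (1 + second_moment_const ?d L \<beta>) * real m0 ^ (2 * ?d - 1) * ln (real n) / real n"
  define T where "T = tail_const ?d L \<beta>"
  have T0: "0 < T" unfolding T_def by (rule tail_const_pos[OF L _ \<beta>]) simp
  \<comment> \<open>The bound on the bias rather than the bias itself: it decreases in m because d <
    2 \<beta>, as the oracle inequality demands.\<close>
  define B where "B m = sqrt (T * real m powr (real ?d - 2 * \<beta>))" for m :: nat
  define Z where "Z m \<omega> = max 0 (2 * (estimator n \<omega> x (real m) - mean_estimator m)\<^sup>2 - V_hat \<kappa> n \<omega> x m)" for m \<omega>
  have cv: "continuous_version f x = inv_fourier f x"
    using continuous_version_eq[OF f integrable_char_fun[OF f sob L \<beta>]] by simp
  have "(\<integral>\<^sup>+\<omega>. ennreal (\<bar>estimator n \<omega> x (real (m_hat \<omega>)) - continuous_version f x\<bar>\<^sup>2) \<partial>sample_law n f)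
    \<le> (\<integral>\<^sup>+\<omega>. ennreal 21 * (\<Sum>m\<in>?M. ennreal (Z m \<omega>)) + ennreal 21 * ennreal (V_hat \<kappa> n \<omega> x m0) + ennreal (102 * (B m0)\<^sup>2) \<partial>sample_law n f)"
  proof (rule nn_integral_mono)
    fix \<omega> assume w: "\<omega> \<in> space (sample_law n f)"
    then have "\<omega> \<in> space (sample_space n)"
      by (simp add: sample_law_def sample_space_def space_PiM space_radon_law space_pair_measure)
    with sel have am: "is_arg_min (\<lambda>m. A_hat \<kappa> n \<omega> x m + V_hat \<kappa> n \<omega> x m) (\<lambda>m. m \<in> ?M) (m_hat \<omega>)"
      by (simp add: cutoff_selection_def)
    have "\<bar>estimator n \<omega> x (real (m_hat \<omega>)) - inv_fourier f x\<bar>\<^sup>2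
      \<le> 21 * (\<Sum>m\<in>?M. max 0 (2 * (estimator n \<omega> x (real m) - mean_estimator m)\<^sup>2 - V_hat \<kappa> n \<omega> x m))
        + 21 * V_hat \<kappa> n \<omega> x m0 + 102 * (B m0)\<^sup>2"
    proof (rule oracle_inequality[where A="A_hat \<kappa> n \<omega> x" and est="\<lambda>m. estimator n \<omega> x (real m)"])
      show "finite ?M" by (rule finite_cutoffs[OF d n])
      show "m_hat \<omega> \<in> ?M" using am by (simp add: is_arg_min_def)
      show "A_hat \<kappa> n \<omega> x (m_hat \<omega>) + V_hat \<kappa> n \<omega> x (m_hat \<omega>) \<le> A_hat \<kappa> n \<omega> x m0 + V_hat \<kappa> n \<omega> x m0"
        using am m0 by (auto simp: is_arg_min_def not_less)
      show "0 \<le> V_hat \<kappa> n \<omega> x m" for m using \<kappa> by (intro V_hat_nonneg) simp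
      show "\<bar>mean_estimator m - inv_fourier f x\<bar> \<le> B m" if "m \<in> ?M" for m
        unfolding B_def T_def mean_estimator_def
        using cutoffsD(1)[OF d n that] by (intro real_le_rsqrt kern_bias[OF f sob L \<beta>]) simp
      show "B m \<le> B m0" if "m \<in> ?M" "m0 \<le> m" for m
        unfolding B_def using T0 \<beta> that cutoffsD(1)[OF d n m0]
        by (intro real_sqrt_le_mono mult_left_mono powr_mono2') auto
    qed (auto simp: A_hat_def m0)
    then have "ennreal (\<bar>estimator n \<omega> x (real (m_hat \<omega>)) - continuous_version f x\<bar>\<^sup>2)
      \<le> ennreal (21 * (\<Sum>m\<in>?M. Z m \<omega>) + 21 * V_hat \<kappa> n \<omega> x m0 + 102 * (B m0)\<^sup>2)"
      unfolding cv Z_def by (rule ennreal_leI)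
    also have "\<dots> = ennreal 21 * (\<Sum>m\<in>?M. ennreal (Z m \<omega>)) + ennreal 21 * ennreal (V_hat \<kappa> n \<omega> x m0) + ennreal (102 * (B m0)\<^sup>2)"
    proof -
      have "0 \<le> (\<Sum>m\<in>?M. Z m \<omega>)" by (intro sum_nonneg) (simp add: Z_def)
      moreover have "0 \<le> V_hat \<kappa> n \<omega> x m0" using \<kappa> by (intro V_hat_nonneg) simp
      moreover have "(\<Sum>m\<in>?M. ennreal (Z m \<omega>)) = ennreal (\<Sum>m\<in>?M. Z m \<omega>)" by (intro sum_ennreal) (simp add: Z_def)
      ultimately show ?thesis by (simp only: ennreal_plus ennreal_mult mult_nonneg_nonneg add_nonneg_nonneg zero_le_power2 zero_le_numeral)
    qed
    finally show "ennreal (\<bar>estimator n \<omega> x (real (m_hat \<omega>)) - continuous_version f x\<bar>\<^sup>2)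
      \<le> ennreal 21 * (\<Sum>m\<in>?M. ennreal (Z m \<omega>)) + ennreal 21 * ennreal (V_hat \<kappa> n \<omega> x m0) + ennreal (102 * (B m0)\<^sup>2)" .
  qed
  also have "\<dots> = ennreal 21 * (\<Sum>m\<in>?M. \<integral>\<^sup>+\<omega>. ennreal (Z m \<omega>) \<partial>sample_law n f)
    + ennreal 21 * (\<integral>\<^sup>+\<omega>. ennreal (V_hat \<kappa> n \<omega> x m0) \<partial>sample_law n f)
    + ennreal (102 * (B m0)\<^sup>2) * emeasure (sample_law n f) (space (sample_law n f))"
  proof -
    have [measurable]: "(\<lambda>\<omega>. Z m \<omega>) \<in> borel_measurable (sample_law n f)" for m
      unfolding Z_def by measurable
    show ?thesis
      by (simp add: nn_integral_add nn_integral_cmult nn_integral_sum)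
  qed
  also have "emeasure (sample_law n f) (space (sample_law n f)) = 1"
  proof -
    interpret M: prob_space "radon_law f" by (rule prob_space_radon_law[OF f])
    interpret P: product_prob_space "\<lambda>_. radon_law f" "{1..n}" ..
    show ?thesis unfolding sample_law_def by (rule P.emeasure_space_1)
  qed
  also have "ennreal 21 * (\<Sum>m\<in>?M. \<integral>\<^sup>+\<omega>. ennreal (Z m \<omega>) \<partial>sample_law n f)
    + ennreal 21 * (\<integral>\<^sup>+\<omega>. ennreal (V_hat \<kappa> n \<omega> x m0) \<partial>sample_law n f) + ennreal (102 * (B m0)\<^sup>2) * 1
    \<le> ennreal 21 * (\<Sum>m\<in>?M. ennreal (real m / (real n)\<^sup>2))
    + ennreal 21 * ennreal (?W)
    + ennreal (102 * (B m0)\<^sup>2) * 1"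
    unfolding Z_def using cutoffsD(1)[OF d n m0]
    by (intro add_mono mult_left_mono sum_mono nn_integral_excess nn_integral_V_hat order_refl) auto
  also have "\<dots> \<le> ennreal 21 * ennreal (1 / real n)
    + ennreal 21 * ennreal (?W)
    + ennreal (102 * (B m0)\<^sup>2) * 1"
  proof (intro add_mono mult_left_mono order_refl)
    have "(\<Sum>m\<in>?M. ennreal (real m / (real n)\<^sup>2)) = ennreal (\<Sum>m\<in>?M. real m / (real n)\<^sup>2)"
      by (rule sum_ennreal) simp
    also have "(\<Sum>m\<in>?M. real m / (real n)\<^sup>2) = real (\<Sum>m\<in>?M. m) / (real n)\<^sup>2"
      by (simp add: sum_divide_distrib)
    also have "ennreal \<dots> \<le> ennreal (real n / (real n)\<^sup>2)"
      using sum_cutoffs_le[OF d n] by (intro ennreal_leI divide_right_mono of_nat_mono) auto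
    also have "real n / (real n)\<^sup>2 = 1 / real n" using n by (simp add: power2_eq_square)
    finally show "(\<Sum>m\<in>?M. ennreal (real m / (real n)\<^sup>2)) \<le> ennreal (1 / real n)" .
  qed auto
  also have "(B m0)\<^sup>2 = T * real m0 powr (real ?d - 2 * \<beta>)"
    unfolding B_def using T0 by simp
  also have "ennreal 21 * ennreal (1 / real n)
    + ennreal 21 * ennreal (?W)
    + ennreal (102 * (T * real m0 powr (real ?d - 2 * \<beta>))) * 1
    = ennreal (21 * (1 / real n)
      + 21 * (?W)
      + 102 * (T * real m0 powr (real ?d - 2 * \<beta>)))"
  proof -
    have gen: "ennreal 21 * ennreal u + ennreal 21 * ennreal v + ennreal w * 1 = ennreal (21 * u + 21 * v + w)"
      if "0 \<le> u" "0 \<le> v" "0 \<le> w" for u v w :: real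
      using that by (simp only: ennreal_plus ennreal_mult mult_1_right mult_nonneg_nonneg add_nonneg_nonneg zero_le_numeral)
    have "0 \<le> second_moment_const ?d L \<beta>"
      using T0 sphere_area_pos[of ?d] by (simp add: second_moment_const_def T_def)
    then have "0 \<le> ?W"
      using \<kappa> n by simp
    then show ?thesis using T0 by (intro gen) auto
  qed
  finally show ?thesis by (simp only: T_def)
qed

end

text \<open>Rounding down a power of \<open>n / (2 * ln n)\<close> rather than of \<open>n / ln n\<close> keeps the base in \<open>[1, n]\<close>
  for every \<open>n \<ge> 2\<close>.\<close>

lemma balanced_cutoff:
  fixes \<beta> :: real and d n :: nat
  assumes d: "2 \<le> d" and n: "2 \<le> n" and \<beta>: "real d < 2 * \<beta>"
  defines "r \<equiv> (real n / ln (real n)) powr (- ((2 * \<beta> - real d) / (2 * \<beta> + real d - 1)))"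
    and "c \<equiv> 2 powr ((2 * \<beta> - real d) / (2 * \<beta> + real d - 1))"
  obtains m where "m \<in> cutoffs d n"
    and "real m ^ (2 * d - 1) * ln (real n) / real n \<le> c * r / 2"
    and "real m powr (real d - 2 * \<beta>) \<le> 2 powr (2 * \<beta> - real d) * (c * r)"
    and "1 / real n \<le> c * r"
proof -
  \<comment> \<open>The cutoff a^\<theta> has variance term a^(\<theta> (2 d - 1) - 1) and squared
    bias a^(\<theta> (d - 2 \<beta>)). Equating the exponents determines \<theta>, and - \<gamma> is
    their common value.\<close>
  define \<theta> where "\<theta> = 1 / (2 * \<beta> + real d - 1)"
  define \<gamma> where "\<gamma> = (2 * \<beta> - real d) / (2 * \<beta> + real d - 1)"
  define a where "a = real n / (2 * ln (real n))"
  have den: "0 < 2 * \<beta> + real d - 1" using \<beta> d by simp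
  have \<theta>: "0 < \<theta>" using den by (simp add: \<theta>_def)
  have \<gamma>: "0 < \<gamma>" "\<gamma> < 1" using den \<beta> d by (auto simp: \<gamma>_def)
  have \<gamma>\<theta>: "\<theta> * (real d - 2 * \<beta>) = - \<gamma>" "\<theta> * (2 * real d - 1) - 1 = - \<gamma>"
    using den by (simp_all add: \<theta>_def \<gamma>_def field_simps)
  have "ln 2 \<le> ln (real n)" using n by simp
  then have ln2: "1 \<le> 2 * ln (real n)" using ln2_ge_two_thirds by linarith
  then have ln0: "0 < ln (real n)" by simp
  have an: "a \<le> real n"
    using ln2 ln0 n mult_left_mono[OF ln2, of "real n"] by (simp add: a_def pos_divide_le_eq)
  have a1: "1 \<le> a"
  proof -
    \<comment> \<open>This square and ln n \<le> 2 sqrt n - 2 combine to 2 ln n \<le> 4 sqrt n - 4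
      \<le> n.\<close>
    have "0 \<le> (sqrt (real n) - 2)\<^sup>2" by simp
    then have "4 * sqrt (real n) - 4 \<le> real n" by (simp add: power2_diff)
    moreover have "ln (real n) \<le> 2 * sqrt (real n) - 2" using n by (intro ln_le_two_sqrt) simp
    ultimately have "2 * ln (real n) \<le> real n" by linarith
    then show ?thesis using ln0 by (simp add: a_def pos_le_divide_eq)
  qed
  have ar: "a powr (- \<gamma>) = c * r"
  proof -
    have "a = (real n / ln (real n)) / 2" by (simp add: a_def)
    then have "a powr (- \<gamma>) = (real n / ln (real n)) powr (- \<gamma>) / 2 powr (- \<gamma>)"
      using ln0 by (simp only:) (subst powr_divide, auto)
    also have "\<dots> = 2 powr \<gamma> * (real n / ln (real n)) powr (- \<gamma>)"
      by (simp add: powr_minus divide_inverse)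
    finally show ?thesis by (simp add: r_def c_def \<gamma>_def)
  qed
  define y where "y = a powr \<theta>"
  have y1: "1 \<le> y" using a1 \<theta> by (simp add: y_def ge_one_powr_ge_zero)
  \<comment> \<open>Since y \<ge> 1, rounding down loses at most a factor 2. It costs nothing in the
    variance and a factor 2^(2 \<beta> - d) in the squared bias.\<close>
  define m where "m = nat \<lfloor>y\<rfloor>"
  have m: "real m \<le> y" "y / 2 \<le> real m" "1 \<le> m"
  proof -
    have "1 \<le> \<lfloor>y\<rfloor>" using y1 by (simp add: le_floor_iff)
    then have "int m = \<lfloor>y\<rfloor>" by (simp add: m_def)
    then have mf: "real m = of_int \<lfloor>y\<rfloor>" and "1 \<le> m" using \<open>1 \<le> \<lfloor>y\<rfloor>\<close> by linarith+
    then show "1 \<le> m" by simp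
    show "real m \<le> y" unfolding mf by simp
    have "y < real m + 1" unfolding mf by linarith
    then show "y / 2 \<le> real m" using \<open>1 \<le> m\<close> by linarith
  qed
  show ?thesis
  proof (rule that)
    \<comment> \<open>The balancing cutoff is admissible because 2 \<beta> > d gives 2 \<beta> + d -
      1 > 2 d - 1.\<close>
    have "\<theta> \<le> 1 / (2 * real d - 1)"
      unfolding \<theta>_def using \<beta> d by (intro divide_left_mono) auto
    then have "y \<le> real n powr (1 / (2 * real d - 1))"
      unfolding y_def using an a1 n \<theta>
      by (intro order_trans[OF powr_mono2[of \<theta> a "real n"] powr_mono]) auto
    then show "m \<in> cutoffs d n" using m by (simp add: cutoffs_def)
    have "real m ^ (2 * d - 1) * ln (real n) / real n \<le> y ^ (2 * d - 1) * (1 / (2 * a))"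
    proof -
      have "ln (real n) / real n = 1 / (2 * a)" using ln0 n by (simp add: a_def)
      then have "real m ^ (2 * d - 1) * ln (real n) / real n = real m ^ (2 * d - 1) * (1 / (2 * a))"
        by (metis times_divide_eq_right)
      also have "\<dots> \<le> y ^ (2 * d - 1) * (1 / (2 * a))"
        using m a1 by (intro mult_right_mono power_mono) auto
      finally show ?thesis .
    qed
    also have "y ^ (2 * d - 1) = a powr (\<theta> * (2 * real d - 1))"
    proof -
      have "y ^ (2 * d - 1) = y powr (real (2 * d - 1))" using y1 by (simp add: powr_realpow)
      also have "real (2 * d - 1) = 2 * real d - 1" using d by (simp add: of_nat_diff)
      finally show ?thesis by (simp add: y_def powr_powr)
    qed
    also have "a powr (\<theta> * (2 * real d - 1)) * (1 / (2 * a)) = a powr (\<theta> * (2 * real d - 1) - 1) / 2"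
      using a1 by (simp add: powr_diff)
    also have "\<dots> = c * r / 2" by (simp only: \<gamma>\<theta> ar)
    finally show "real m ^ (2 * d - 1) * ln (real n) / real n \<le> c * r / 2" .
    have "real m powr (real d - 2 * \<beta>) \<le> (y / 2) powr (real d - 2 * \<beta>)"
      using m y1 \<beta> by (intro powr_mono2') auto
    also have "\<dots> = y powr (real d - 2 * \<beta>) / 2 powr (real d - 2 * \<beta>)"
      using y1 by (subst powr_divide) auto
    also have "\<dots> = 2 powr (2 * \<beta> - real d) * a powr (\<theta> * (real d - 2 * \<beta>))"
    proof -
      have "2 powr (2 * \<beta> - real d) = 1 / (2::real) powr (real d - 2 * \<beta>)"
        by (metis minus_diff_eq powr_minus_divide)
      then show ?thesis by (simp add: y_def powr_powr)
    qed
    finally show "real m powr (real d - 2 * \<beta>) \<le> 2 powr (2 * \<beta> - real d) * (c * r)" by (simp only: \<gamma>\<theta> ar)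
    \<comment> \<open>The contribution of the rare events is no larger than the rate, because a
      \<le> n and \<gamma> < 1.\<close>
    have "1 / real n \<le> 1 / a" using an a1 by (intro divide_left_mono) auto
    also have "\<dots> = a powr (- 1)" using a1 by (simp add: powr_minus_divide)
    also have "\<dots> \<le> a powr (- \<gamma>)" using a1 \<gamma> by (intro powr_mono) auto
    finally show "1 / real n \<le> c * r" by (simp only: ar)
  qed
qed

theorem corollary3p2:
  fixes \<kappa> L \<beta> :: real
  assumes "CARD('n::finite) \<ge> 2"
    and "\<kappa> \<ge> 24"
    and "L > 0"
    and "\<beta> > real CARD('n) / 2"
  shows "\<exists>C>0. \<forall>(x :: real ^ 'n) (n :: nat) m_hat. n \<ge> 2 \<longrightarrow> cutoff_selection \<kappa> n x m_hat \<longrightarrow>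
    (SUP f \<in> {f. prob_density f} \<inter> sobolev_ellipsoid \<beta> L.
       \<integral>\<^sup>+\<omega>. ennreal (\<bar>estimator n \<omega> x (real (m_hat \<omega>)) - continuous_version f x\<bar>\<^sup>2)
         \<partial>sample_law n f)
    \<le> ennreal (C * (real n / ln (real n)) powr
        (- ((2 * \<beta> - real CARD('n)) / (2 * \<beta> + real CARD('n) - 1))))"
proof -
  let ?d = "CARD('n)"
  have dim: "DIM(real ^ 'n) = ?d" by simp
  have d: "2 \<le> DIM(real ^ 'n)" and \<beta>: "real DIM(real ^ 'n) < 2 * \<beta>" using assms by auto
  define c where "c = 2 powr ((2 * \<beta> - real ?d) / (2 * \<beta> + real ?d - 1))"
  define K where "K = second_moment_const ?d L \<beta>"
  define T where "T = tail_const ?d L \<beta>"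
  have T: "0 < T" unfolding T_def using assms by (intro tail_const_pos) auto
  have K: "0 \<le> K" using T sphere_area_pos[of ?d] by (simp add: K_def T_def second_moment_const_def)
  \<comment> \<open>In units of c r, the rate up to its factor c, the three summands are the rare
    events, the penalty (42 halved by the bound of \<open>balanced_cutoff\<close>) and the squared
    bias with its rounding loss.\<close>
  define C where "C = c * (21 + 21 * \<kappa> * (1 + K) + 102 * (T * 2 powr (2 * \<beta> - real ?d)))"
  have "0 < C"
    unfolding C_def using T K assms by (intro mult_pos_pos add_pos_nonneg) (auto simp: c_def)
  moreover have "(SUP f \<in> {f. prob_density f} \<inter> sobolev_ellipsoid \<beta> L.
       \<integral>\<^sup>+\<omega>. ennreal (\<bar>estimator n \<omega> x (real (m_hat \<omega>)) - continuous_version f x\<bar>\<^sup>2)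
         \<partial>sample_law n f)
    \<le> ennreal (C * (real n / ln (real n)) powr (- ((2 * \<beta> - real ?d) / (2 * \<beta> + real ?d - 1))))"
    if n: "2 \<le> n" and sel: "cutoff_selection \<kappa> n x m_hat" for x :: "real ^ 'n" and n m_hat
  proof (rule SUP_least)
    fix f :: "real ^ 'n \<Rightarrow> real" assume "f \<in> {f. prob_density f} \<inter> sobolev_ellipsoid \<beta> L"
    then have f: "prob_density f" "f \<in> sobolev_ellipsoid \<beta> L" by auto
    define r where "r = (real n / ln (real n)) powr (- ((2 * \<beta> - real ?d) / (2 * \<beta> + real ?d - 1)))"
    obtain m where m: "m \<in> cutoffs ?d n"
      and var: "real m ^ (2 * ?d - 1) * ln (real n) / real n \<le> c * r / 2"
      and bias: "real m powr (real ?d - 2 * \<beta>) \<le> 2 powr (2 * \<beta> - real ?d) * (c * r)"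
      and rare: "1 / real n \<le> c * r"
      using balanced_cutoff[OF d n \<beta>] unfolding dim c_def r_def by blast
    have "21 * (1 / real n) + 21 * (2 * \<kappa> * (1 + K) * real m ^ (2 * ?d - 1) * ln (real n) / real n)
        + 102 * (T * real m powr (real ?d - 2 * \<beta>))
      = 21 * (1 / real n) + 42 * \<kappa> * (1 + K) * (real m ^ (2 * ?d - 1) * ln (real n) / real n)
        + 102 * T * (real m powr (real ?d - 2 * \<beta>))" by simp
    also have "\<dots> \<le> 21 * (c * r) + 42 * \<kappa> * (1 + K) * (c * r / 2) + 102 * T * (2 powr (2 * \<beta> - real ?d) * (c * r))"
      using K T assms(2) by (intro add_mono mult_left_mono var bias rare) auto
    also have "\<dots> = C * r" by (simp add: C_def algebra_simps)
    finally have "ennreal (21 * (1 / real n)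
        + 21 * (2 * \<kappa> * (1 + K) * real m ^ (2 * ?d - 1) * ln (real n) / real n)
        + 102 * (T * real m powr (real ?d - 2 * \<beta>))) \<le> ennreal (C * r)" by (rule ennreal_leI)
    with risk_oracle_bound[OF f assms(3) \<beta> d n assms(2) sel m[folded dim]]
    show "(\<integral>\<^sup>+\<omega>. ennreal (\<bar>estimator n \<omega> x (real (m_hat \<omega>)) - continuous_version f x\<bar>\<^sup>2) \<partial>sample_law n f)
      \<le> ennreal (C * (real n / ln (real n)) powr (- ((2 * \<beta> - real ?d) / (2 * \<beta> + real ?d - 1))))"
      unfolding dim K_def[symmetric] T_def[symmetric] r_def[symmetric] by (rule order_trans)
  qed
  ultimately show ?thesis by blast
qed

end
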